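(* Let $m$ be any positive rational number and let $\Lambda=\frac{g_{13m}}{g_{m/13}}$. Write $a=a_{m,13}$, $b=b_{4m,13}$, $S=\sqrt{a/b}-\sqrt{b/a}$, $T=\frac{1}{\sqrt{ab}}-\sqrt{ab}$ and $L=\Lambda-\frac1\Lambda$. Then $$S^2=S\left(L^3-L\right)-4L^2-4,$$ $$169\,T^2=13\,T\left(L^9+L^7-21L^5-35L^3+30L\right)+L^{12}-4L^{10}-26L^8-89L^6-829L^4-1821L^2-576.$$
   Context: For $|q|<1$: $\varphi(q)=\sum_{n\in\mathbb Z}q^{n^2}$, $\psi(q)=\sum_{n\ge0}q^{n(n+1)/2}$, $(a;q)_\infty=\prod_{k\ge0}(1-aq^k)$, $\chi(q)=(-q;q^2)_\infty$. For positive rational $r$, the Ramanujan class invariant is $g_r=2^{-1/4}q^{-1/24}\chi(-q)$ with $q=e^{-\pi\sqrt r}$. For positive rationals $m,n$, $$a_{m,n}=\frac{n\,q^{(n-1)/4}\psi^2(q^n)\varphi^2(-q^{2n})}{\psi^2(q)\varphi^2(-q^2)},\quad q=e^{-\pi\sqrt{m/n}},$$ and $$b_{m,n}=\frac{n\,q^{(n-1)/4}\psi^2(q^n)\varphi^2(-q^{n})}{\psi^2(q)\varphi^2(-q)},\quad q=e^{-\pi\sqrt{m/n}}.$$ *)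

theory Defs
  imports "HOL-Analysis.Analysis"
begin

text \<open>The series and products below are meant for \<open>norm q < 1\<close>, where all of them converge
  (elsewhere the values carry no meaning).\<close>

definition ramanujan_phi :: "'a :: {banach, real_normed_field} \<Rightarrow> 'a" where
  "ramanujan_phi q = (\<Sum>\<^sub>\<infinity>n\<in>(UNIV :: int set). q powi (n ^ 2))"

definition ramanujan_psi :: "'a :: {banach, real_normed_field} \<Rightarrow> 'a" where
  "ramanujan_psi q = (\<Sum>n. q ^ (n * (n + 1) div 2))"

definition qpochhammer_inf :: "'a :: {banach, real_normed_field} \<Rightarrow> 'a \<Rightarrow> 'a" where
  "qpochhammer_inf a q = (\<Prod>k. 1 - a * q ^ k)"

definition ramanujan_chi :: "'a :: {banach, real_normed_field} \<Rightarrow> 'a" where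
  "ramanujan_chi q = qpochhammer_inf (- q) (q ^ 2)"

definition class_invariant :: "rat \<Rightarrow> real" where
  "class_invariant r =
     (let q = exp (- pi * sqrt (of_rat r))
      in 2 powr (- 1 / 4) * q powr (- 1 / 24) * ramanujan_chi (- q))"

text \<open>As \<open>n\<close> is rational, the powers \<open>q\<^sup>n\<close> are real powers of the base \<open>q > 0\<close>.\<close>

definition theta_ratio_a :: "rat \<Rightarrow> rat \<Rightarrow> real" where
  "theta_ratio_a m n =
     (let q = exp (- pi * sqrt (of_rat (m / n))); n' = of_rat n
      in n' * q powr ((n' - 1) / 4)
           * (ramanujan_psi (q powr n')) ^ 2 * (ramanujan_phi (- (q powr (2 * n')))) ^ 2
         / ((ramanujan_psi q) ^ 2 * (ramanujan_phi (- (q ^ 2))) ^ 2))"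

definition theta_ratio_b :: "rat \<Rightarrow> rat \<Rightarrow> real" where
  "theta_ratio_b m n =
     (let q = exp (- pi * sqrt (of_rat (m / n))); n' = of_rat n
      in n' * q powr ((n' - 1) / 4)
           * (ramanujan_psi (q powr n')) ^ 2 * (ramanujan_phi (- (q powr n'))) ^ 2
         / ((ramanujan_psi q) ^ 2 * (ramanujan_phi (- q)) ^ 2))"

end

theory Submission
  imports Defs "HOL-Complex_Analysis.Complex_Analysis" "HOL-Number_Theory.Cong"
begin

text \<open>Write \<open>h(\<tau>) = \<eta>(13\<tau>)\<^sup>2/\<eta>(\<tau>)\<^sup>2\<close> and let \<open>h, k, l\<close> be its values at \<open>\<tau>, 2\<tau>, 4\<tau>\<close>, where
  \<open>exp (2\<pi>i\<tau>) = exp (- \<pi> \<surd>(m/13))\<close>. Gauss' product formulas give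
  \<open>\<Lambda>\<^sup>2 = h/k\<close>, \<open>a/b = k\<^sup>3/(l\<^sup>2h)\<close> and \<open>a b = 169 k\<^sup>5/h\<close>. Because the multiplier of \<open>\<eta>\<^sup>2\<close> only depends on
  the matrix modulo 12 and \<open>13 \<equiv> 1\<close>, the function \<open>h\<close> is invariant under \<open>\<Gamma>\<^sub>0(13)\<close>, and \<open>h(-1/(13\<tau>)) = 1/(13 h(\<tau>))\<close>.
  Hence \<open>M = L\<^sup>2\<close>, \<open>h k + 1/(169 h k)\<close> and the symmetric functions of \<open>S L\<close> and its Fricke conjugate are invariant
  under the group generated by \<open>\<Gamma>\<^sub>0(26)\<close> and all Atkin--Lehner operators, which has a single cusp. By the maximum
  principle such a function vanishes as soon as it tends to 0 there. This yields
  \<open>1/(h k) + 169 h k = M\<^sup>3 - 2 M\<^sup>2 - 15 M + 10\<close> and \<open>(S L)\<^sup>2 - (M\<^sup>2 - M) S L + 4 M\<^sup>2 + 4 M = 0\<close>,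
  and the theorem follows by algebra.\<close>

section \<open>Infinite \<open>q\<close>-Pochhammer products\<close>

text \<open>The square of \<eta> is used because its automorphy factor is c\<tau> + d itself: no
  branch of a square root and no Jacobi symbol occurs. The obstacle is l: the function h(4\<tau>) is
  modular only for Gamma_0(52). Its second conjugate under Gamma_0(26) is h(\<tau> + 1/2) = - k^3/(h
  l), and S L is unchanged by this exchange, which brings it down to level 26. S L is still not
  invariant under \<tau> -> -1/(26 \<tau>); its image is the second root of the quadratic equation.
  The polynomials in M are forced by the behaviour at the cusp: in q = exp (2\<pi>i\<tau>), M has a
  simple pole, 1/(h k) a triple and S L a double one, whereas the Fricke image of S L tends to 4.
  With all Atkin--Lehner operators included, a handful of coefficients at one cusp decides
  everything, without a valence formula or compactified modular curves.\<close>

lemma qpochhammer_inf_convergent: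
  fixes a q :: "'a :: {banach, real_normed_field}"
  assumes "norm q < 1"
  shows "convergent_prod (\<lambda>k. 1 - a * q ^ k)"
proof -
  have "summable (\<lambda>k. norm a * norm q ^ k)"
    by (intro summable_mult summable_geometric) (use assms in auto)
  then show ?thesis
    by (intro abs_convergent_prod_imp_convergent_prod)
       (simp add: abs_convergent_prod_conv_summable norm_mult norm_power)
qed

lemma qpochhammer_inf_LIMSEQ:
  fixes a q :: "'a :: {banach, real_normed_field}"
  assumes "norm q < 1"
  shows "(\<lambda>n. \<Prod>k<n. 1 - a * q ^ k) \<longlonglongrightarrow> qpochhammer_inf a q"
  using convergent_prod_LIMSEQ[OF qpochhammer_inf_convergent[OF assms]]
  by (simp add: qpochhammer_inf_def LIMSEQ_lessThan_iff_atMost)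

lemma qpochhammer_inf_eq_0_iff:
  fixes a q :: "'a :: {banach, real_normed_field}"
  assumes "norm q < 1"
  shows "qpochhammer_inf a q = 0 \<longleftrightarrow> (\<exists>k. a * q ^ k = 1)"
  using has_prod_eq_0_iff[OF convergent_prod_has_prod[OF qpochhammer_inf_convergent[OF assms]], of a]
  by (auto simp: qpochhammer_inf_def)

lemma qpochhammer_inf_nonzero:
  fixes a q :: "'a :: {banach, real_normed_field}"
  assumes "norm q < 1" "norm a < 1"
  shows "qpochhammer_inf a q \<noteq> 0"
proof
  assume "qpochhammer_inf a q = 0"
  then obtain k where "a * q ^ k = 1"
    using qpochhammer_inf_eq_0_iff assms by blast
  then have "norm a * norm q ^ k = 1"
    by (metis norm_mult norm_one norm_power)
  moreover have "norm a * norm q ^ k \<le> norm a * 1"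
    using assms by (intro mult_left_mono power_le_one) auto
  ultimately show False using assms by auto
qed

lemma qpochhammer_inf_rec:
  fixes a q :: "'a :: {banach, real_normed_field}"
  assumes "norm q < 1"
  shows "qpochhammer_inf a q = (1 - a) * qpochhammer_inf (a * q) q"
proof (rule LIMSEQ_unique)
  show "(\<lambda>n. \<Prod>k<Suc n. 1 - a * q ^ k) \<longlonglongrightarrow> qpochhammer_inf a q"
    by (rule LIMSEQ_Suc[OF qpochhammer_inf_LIMSEQ[OF assms]])
  have "(\<lambda>n. (1 - a) * (\<Prod>k<n. 1 - (a * q) * q ^ k)) \<longlonglongrightarrow> (1 - a) * qpochhammer_inf (a * q) q"
    by (intro tendsto_intros qpochhammer_inf_LIMSEQ assms)
  then show "(\<lambda>n. \<Prod>k<Suc n. 1 - a * q ^ k) \<longlonglongrightarrow> (1 - a) * qpochhammer_inf (a * q) q"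
    by (simp add: prod.lessThan_Suc_shift mult.assoc del: prod.lessThan_Suc)
qed

lemma qpochhammer_inf_mult_minus:
  fixes a q :: "'a :: {banach, real_normed_field}"
  assumes "norm q < 1"
  shows "qpochhammer_inf a q * qpochhammer_inf (- a) q = qpochhammer_inf (a\<^sup>2) (q\<^sup>2)"
proof (rule LIMSEQ_unique)
  show "(\<lambda>n. (\<Prod>k<n. 1 - a * q ^ k) * (\<Prod>k<n. 1 - (- a) * q ^ k))
          \<longlonglongrightarrow> qpochhammer_inf a q * qpochhammer_inf (- a) q"
    by (intro tendsto_intros qpochhammer_inf_LIMSEQ assms)
  have "norm (q\<^sup>2) < 1"
    using assms by (simp add: norm_power power_less_one_iff)
  from qpochhammer_inf_LIMSEQ[OF this, of "a\<^sup>2"]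
  show "(\<lambda>n. (\<Prod>k<n. 1 - a * q ^ k) * (\<Prod>k<n. 1 - (- a) * q ^ k))
          \<longlonglongrightarrow> qpochhammer_inf (a\<^sup>2) (q\<^sup>2)"
    by (simp add: prod.distrib[symmetric] algebra_simps power2_eq_square power_mult_distrib)
qed

lemma qpochhammer_inf_split_even_odd:
  fixes a q :: "'a :: {banach, real_normed_field}"
  assumes "norm q < 1"
  shows "qpochhammer_inf a q = qpochhammer_inf a (q\<^sup>2) * qpochhammer_inf (a * q) (q\<^sup>2)"
proof (rule LIMSEQ_unique)
  have q2: "norm (q\<^sup>2) < 1"
    using assms by (simp add: norm_power power_less_one_iff)
  have "strict_mono (\<lambda>n::nat. 2 * n)"
    by (simp add: strict_mono_def)
  from LIMSEQ_subseq_LIMSEQ[OF qpochhammer_inf_LIMSEQ[OF assms] this]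
  show "(\<lambda>n. \<Prod>k<2*n. 1 - a * q ^ k) \<longlonglongrightarrow> qpochhammer_inf a q"
    by (simp add: o_def)
  have "(\<Prod>k<2*n. 1 - a * q ^ k)
          = (\<Prod>k<n. 1 - a * (q\<^sup>2) ^ k) * (\<Prod>k<n. 1 - (a * q) * (q\<^sup>2) ^ k)" for n
    by (induction n) (simp_all add: power_mult[symmetric] mult_ac)
  then show "(\<lambda>n. \<Prod>k<2*n. 1 - a * q ^ k) \<longlonglongrightarrow> qpochhammer_inf a (q\<^sup>2) * qpochhammer_inf (a * q) (q\<^sup>2)"
    using tendsto_mult[OF qpochhammer_inf_LIMSEQ[OF q2] qpochhammer_inf_LIMSEQ[OF q2]] by simp
qed

text \<open>Removing the even factors from (q;q) leaves the odd ones; in this form \<chi>(-q)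
  becomes an \<eta>-quotient.\<close>

lemma qpochhammer_inf_odd:
  fixes q :: "'a :: {banach, real_normed_field}"
  assumes "norm q < 1"
  shows "qpochhammer_inf q (q\<^sup>2) = qpochhammer_inf q q / qpochhammer_inf (q\<^sup>2) (q\<^sup>2)"
proof -
  have "norm (q\<^sup>2) < 1"
    using assms by (simp add: norm_power power_less_one_iff)
  then show ?thesis
    using qpochhammer_inf_split_even_odd[OF assms, of q] qpochhammer_inf_nonzero[of "q\<^sup>2" "q\<^sup>2"]
    by (simp add: power2_eq_square)
qed

lemma qpochhammer_inf_of_real:
  assumes "\<bar>q\<bar> < 1"
  shows "qpochhammer_inf (complex_of_real a) (of_real q) = of_real (qpochhammer_inf a q)"
proof (rule LIMSEQ_unique)
  show "(\<lambda>n. \<Prod>k<n. 1 - complex_of_real a * of_real q ^ k) \<longlonglongrightarrow> qpochhammer_inf (of_real a) (of_real q)"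
    by (rule qpochhammer_inf_LIMSEQ) (use assms in simp)
  have "(\<lambda>n. complex_of_real (\<Prod>k<n. 1 - a * q ^ k)) \<longlonglongrightarrow> of_real (qpochhammer_inf a q)"
    by (intro tendsto_intros qpochhammer_inf_LIMSEQ) (use assms in simp)
  then show "(\<lambda>n. \<Prod>k<n. 1 - complex_of_real a * of_real q ^ k) \<longlonglongrightarrow> of_real (qpochhammer_inf a q)"
    by simp
qed

text \<open>On a closed disc inside \<open>S\<close> the continuous function |g| has a maximum below
  1, so the factors differ from 1 by at most a geometric sequence. The partial products therefore
  converge locally uniformly, which preserves holomorphy.\<close>

lemma qpochhammer_inf_holomorphic:
  assumes f: "f holomorphic_on S" and g: "g holomorphic_on S" and S: "open S"
    and less: "\<And>z. z \<in> S \<Longrightarrow> norm (g z) < 1"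
  shows "(\<lambda>z. qpochhammer_inf (f z) (g z)) holomorphic_on S"
proof (rule holomorphic_uniform_sequence[OF S, where f = "\<lambda>n z. \<Prod>k<n. 1 - f z * g z ^ k"])
  show "(\<lambda>z. \<Prod>k<n. 1 - f z * g z ^ k) holomorphic_on S" for n
    by (intro holomorphic_intros f g)
next
  fix z assume z: "z \<in> S"
  then obtain d where d: "d > 0" "cball z d \<subseteq> S"
    using S open_contains_cball by blast
  let ?K = "cball z d"
  have cf: "continuous_on ?K f" and cg: "continuous_on ?K g"
    using d f g holomorphic_on_imp_continuous_on continuous_on_subset by blast+
  obtain w where w: "w \<in> ?K" "\<And>y. y \<in> ?K \<Longrightarrow> norm (g y) \<le> norm (g w)"
    using continuous_attains_sup[of ?K "\<lambda>z. norm (g z)"] d continuous_on_norm[OF cg] by auto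
  obtain v where v: "v \<in> ?K" "\<And>y. y \<in> ?K \<Longrightarrow> norm (f y) \<le> norm (f v)"
    using continuous_attains_sup[of ?K "\<lambda>z. norm (f z)"] d continuous_on_norm[OF cf] by auto
  have gw: "norm (g w) < 1"
    using less w d by blast
  have "uniformly_convergent_on ?K (\<lambda>N z. \<Prod>k<N. 1 - f z * g z ^ k)"
  proof (rule uniformly_convergent_on_prod')
    show "uniformly_convergent_on ?K (\<lambda>N z. \<Sum>k<N. norm ((1 - f z * g z ^ k) - 1))"
    proof (rule Weierstrass_m_test')
      show "summable (\<lambda>k. norm (f v) * norm (g w) ^ k)"
        by (intro summable_mult summable_geometric) (use gw in auto)
      show "norm (norm ((1 - f y * g y ^ k) - 1)) \<le> norm (f v) * norm (g w) ^ k" if "y \<in> ?K" for k y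
        using that v w by (auto simp: norm_mult norm_power intro!: mult_mono power_mono)
    qed
  qed (auto intro!: continuous_intros cf cg)
  then obtain l where l: "uniform_limit ?K (\<lambda>N z. \<Prod>k<N. 1 - f z * g z ^ k) l sequentially"
    by (auto simp: uniformly_convergent_on_def)
  moreover have "l y = qpochhammer_inf (f y) (g y)" if "y \<in> ?K" for y
  proof (rule LIMSEQ_unique)
    show "(\<lambda>N. \<Prod>k<N. 1 - f y * g y ^ k) \<longlonglongrightarrow> l y"
      using tendsto_uniform_limitI[OF l that] .
    show "(\<lambda>N. \<Prod>k<N. 1 - f y * g y ^ k) \<longlonglongrightarrow> qpochhammer_inf (f y) (g y)"
      by (rule qpochhammer_inf_LIMSEQ) (use less d that in blast)
  qed
  ultimately have "uniform_limit ?K (\<lambda>N z. \<Prod>k<N. 1 - f z * g z ^ k) (\<lambda>z. qpochhammer_inf (f z) (g z)) sequentially"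
    using uniform_limit_cong'[of ?K "\<lambda>N z. \<Prod>k<N. 1 - f z * g z ^ k" "\<lambda>N z. \<Prod>k<N. 1 - f z * g z ^ k"
      l "\<lambda>z. qpochhammer_inf (f z) (g z)" sequentially] by blast
  then show "\<exists>d>0. cball z d \<subseteq> S \<and>
      uniform_limit (cball z d) (\<lambda>n z. \<Prod>k<n. 1 - f z * g z ^ k) (\<lambda>z. qpochhammer_inf (f z) (g z)) sequentially"
    using d by blast
qed

section \<open>Gauss' product formulas for theta series\<close>

text \<open>Shanks' finite forms of Gauss' theta identities: the terms below telescope in \<open>n\<close>.\<close>

definition shanks_phi :: "real \<Rightarrow> nat \<Rightarrow> real" where
  "shanks_phi q n = (\<Prod>k<n. (1 - q ^ Suc k) / (1 + q ^ Suc k))"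

definition shanks_psi :: "real \<Rightarrow> nat \<Rightarrow> real" where
  "shanks_psi q n = (\<Prod>k<n. (1 - q ^ (2 * k + 2)) / (1 - q ^ (2 * k + 1)))"

lemma shanks_phi_pos:
  assumes "0 < q" "q < 1"
  shows "shanks_phi q n > 0"
  unfolding shanks_phi_def using assms
  by (intro prod_pos divide_pos_pos) (auto simp: power_Suc_less_one add_pos_pos simp del: power_Suc)

lemma shanks_psi_pos:
  assumes "0 < q" "q < 1"
  shows "shanks_psi q n > 0"
  unfolding shanks_psi_def using assms
  by (intro prod_pos divide_pos_pos) (auto simp: power_Suc_less_one simp del: power_Suc)

lemma shanks_phi_sum:
  fixes q :: real
  assumes q: "0 < q" "q < 1"
  shows "(\<Sum>s\<le>n. 2 * (-1) ^ s * (shanks_phi q n / shanks_phi q s) * q ^ (s * (n + 1)) / (1 + q ^ s))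
         = 1 + 2 * (\<Sum>s<n. (-1) ^ Suc s * q ^ (Suc s)\<^sup>2)"
proof (induction n)
  case 0
  then show ?case by (simp add: shanks_phi_def)
next
  case (Suc n)
  define P where "P = shanks_phi q"
  have pos: "P s > 0" for s
    unfolding P_def by (rule shanks_phi_pos[OF q])
  have PSuc: "P (Suc s) = P s * (1 - q * q ^ s) / (1 + q * q ^ s)" for s
    by (simp add: P_def shanks_phi_def)
  have lt: "q * q ^ s < 1" for s
    using q power_Suc_less_one[of q s] by simp
  have gt: "1 + q ^ s > 0" "1 + q * q ^ s > 0" for s
    using q by (simp_all add: add_pos_pos)
  define t where "t n s = 2 * (-1) ^ s * (P n / P s) * q ^ (s * (n + 1)) / (1 + q ^ s)" for n s
  \<comment> \<open>\<open>u\<close> is the telescoping certificate: t(n+1,s) - t(n,s) = u(s) -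
    u(s+1). Its factor 1 - q^s makes u(0) = 0, so only the upper boundary contributes.\<close>
  define u where "u s = - 2 * (-1) ^ s * (P n / P s) * ((1 - q ^ s) / (1 + q ^ s)) *
                          q ^ (s * Suc n) / (1 + q ^ Suc n)" for s
  have step: "t (Suc n) s - t n s = u s - u (Suc s)" for s
  proof -
    have "1 - q * q ^ s \<noteq> 0" "1 + q * q ^ s \<noteq> 0" "1 + q ^ s \<noteq> 0" "1 + q * q ^ n \<noteq> 0" "P n \<noteq> 0" "P s \<noteq> 0"
      using lt[of s] gt[of s] gt[of n] pos[of n] pos[of s] by auto
    then show ?thesis unfolding t_def u_def PSuc
      by (simp add: divide_simps) (simp add: algebra_simps power_add)
  qed
  have "(\<Sum>s\<le>Suc n. t (Suc n) s) = (\<Sum>s\<le>n. t n s) + (\<Sum>s\<le>n. u s - u (Suc s)) + t (Suc n) (Suc n)"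
    by (simp add: step[symmetric] sum_subtractf)
  also have "(\<Sum>s\<le>n. u s - u (Suc s)) = u 0 - u (Suc n)"
    by (induction n) simp_all
  also have "(\<Sum>s\<le>n. t n s) + (u 0 - u (Suc n)) + t (Suc n) (Suc n)
               = (\<Sum>s\<le>n. t n s) + 2 * (-1) ^ Suc n * q ^ (Suc n)\<^sup>2"
  proof -
    have "1 - q * q ^ n \<noteq> 0" "1 + q * q ^ n \<noteq> 0" "P n \<noteq> 0"
      using lt[of n] gt[of n] pos[of n] by auto
    then have "u 0 - u (Suc n) + t (Suc n) (Suc n) = 2 * (-1) ^ Suc n * q ^ (Suc n)\<^sup>2"
      unfolding t_def u_def PSuc
      by (simp add: divide_simps) (simp add: algebra_simps power_add power2_eq_square)
    then show ?thesis by simp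
  qed
  finally show ?case
    using Suc unfolding t_def P_def by simp
qed

lemma shanks_psi_sum:
  fixes q :: real
  assumes q: "0 < q" "q < 1"
  shows "(\<Sum>s<n. (shanks_psi q n / shanks_psi q s) * q ^ (s * (2 * n + 1)))
         = (\<Sum>s<2*n. q ^ (s * (s + 1) div 2))"
proof (induction n)
  case 0
  then show ?case by simp
next
  case (Suc n)
  define P where "P = shanks_psi q"
  have pos: "P s > 0" for s
    unfolding P_def by (rule shanks_psi_pos[OF q])
  have PSuc: "P (Suc s) = P s * (1 - q * q * q ^ (2 * s)) / (1 - q * q ^ (2 * s))" for s
    by (simp add: P_def shanks_psi_def)
  have lt: "q * q ^ s < 1" "q * q * q ^ s < 1" for s
    using q power_Suc_less_one[of q s] power_Suc_less_one[of q "Suc s"] by simp_all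
  define t where "t n s = (P n / P s) * q ^ (s * (2 * n + 1))" for n s
  \<comment> \<open>Here the certificate runs the other way, t(n+1,s) - t(n,s) = u(s+1) - u(s), and
    again u(0) = 0.\<close>
  define u where "u s = (P n / P s) * (1 - q ^ (2 * s)) * q ^ (s * (2 * n + 1)) / (1 - q * q ^ (2 * n))" for s
  have nz: "1 - q * q ^ s \<noteq> 0" "1 - q * q * q ^ s \<noteq> 0" "P s \<noteq> 0" for s
    using lt[of s] pos[of s] by auto
  have step: "t (Suc n) s - t n s = u (Suc s) - u s" for s
    unfolding t_def u_def PSuc
    using nz[of "2 * s"] nz(1,2)[of "2 * n"] nz(3)[of n] nz(3)[of s]
    by (simp add: divide_simps) (simp add: algebra_simps power_add power_mult power2_eq_square power3_eq_cube)
  have "(\<Sum>s<Suc n. t (Suc n) s) = (\<Sum>s<n. t n s) + (\<Sum>s<n. u (Suc s) - u s) + t (Suc n) n"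
    by (simp add: step[symmetric] sum_subtractf)
  also have "(\<Sum>s<n. u (Suc s) - u s) = u n - u 0"
    by (induction n) simp_all
  \<comment> \<open>Passing from n to n+1 adds the triangular exponents with indices 2n and
    2n+1.\<close>
  also have "(\<Sum>s<n. t n s) + (u n - u 0) + t (Suc n) n
               = (\<Sum>s<n. t n s) + (q ^ (n * (2 * n + 1)) + q ^ ((n + 1) * (2 * n + 1)))"
  proof -
    have "u n - u 0 + t (Suc n) n = q ^ (n * (2 * n + 1)) + q ^ ((n + 1) * (2 * n + 1))"
      unfolding t_def u_def PSuc
      using nz(1,2)[of "2 * n"] nz(3)[of n]
      by (simp add: divide_simps) (simp add: algebra_simps power_add power_mult power2_eq_square power3_eq_cube)
    then show ?thesis by simp
  qed
  also have "(\<Sum>s<n. t n s) = (\<Sum>s<2*n. q ^ (s * (s + 1) div 2))"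
    using Suc unfolding t_def P_def by simp
  finally show ?case
    unfolding t_def P_def by (simp add: algebra_simps)
qed

section \<open>Limits of the finite theta identities\<close>

lemma tendsto_zero_power_times_n:
  fixes q :: real
  assumes q: "0 < q" "q < 1"
  shows "(\<lambda>n. real n * q ^ n) \<longlonglongrightarrow> 0"
  using powser_times_n_limit_0[of q] q by simp

lemma shanks_phi_LIMSEQ:
  assumes q: "0 < q" "q < 1"
  shows "shanks_phi q \<longlonglongrightarrow> qpochhammer_inf q q ^ 2 / qpochhammer_inf (q\<^sup>2) (q\<^sup>2)"
proof -
  have "(\<lambda>n. (\<Prod>k<n. 1 - q * q ^ k) / (\<Prod>k<n. 1 - (- q) * q ^ k))
          \<longlonglongrightarrow> qpochhammer_inf q q / qpochhammer_inf (- q) q"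
    using q by (intro tendsto_divide qpochhammer_inf_LIMSEQ qpochhammer_inf_nonzero) auto
  also have "(\<lambda>n. (\<Prod>k<n. 1 - q * q ^ k) / (\<Prod>k<n. 1 - (- q) * q ^ k)) = shanks_phi q"
    by (simp add: fun_eq_iff shanks_phi_def prod_dividef)
  also have "qpochhammer_inf q q / qpochhammer_inf (- q) q
               = qpochhammer_inf q q ^ 2 / qpochhammer_inf (q\<^sup>2) (q\<^sup>2)"
  proof -
    have "qpochhammer_inf (q\<^sup>2) (q\<^sup>2) = qpochhammer_inf q q * qpochhammer_inf (- q) q"
      using q by (intro qpochhammer_inf_mult_minus[symmetric]) auto
    then show ?thesis
      using q qpochhammer_inf_nonzero[of q q] by (simp add: power2_eq_square)
  qed
  finally show ?thesis .
qed

lemma shanks_psi_LIMSEQ: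
  assumes q: "0 < q" "q < 1"
  shows "shanks_psi q \<longlonglongrightarrow> qpochhammer_inf (q\<^sup>2) (q\<^sup>2) ^ 2 / qpochhammer_inf q q"
proof -
  have q2: "norm (q\<^sup>2) < 1"
    using q by (simp add: power_less_one_iff)
  have "(\<lambda>n. (\<Prod>k<n. 1 - q\<^sup>2 * (q\<^sup>2) ^ k) / (\<Prod>k<n. 1 - q * (q\<^sup>2) ^ k))
          \<longlonglongrightarrow> qpochhammer_inf (q\<^sup>2) (q\<^sup>2) / qpochhammer_inf q (q\<^sup>2)"
    using q q2 by (intro tendsto_divide qpochhammer_inf_LIMSEQ qpochhammer_inf_nonzero) auto
  also have "(\<lambda>n. (\<Prod>k<n. 1 - q\<^sup>2 * (q\<^sup>2) ^ k) / (\<Prod>k<n. 1 - q * (q\<^sup>2) ^ k)) = shanks_psi q"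
    unfolding fun_eq_iff shanks_psi_def prod_dividef power_mult[symmetric]
    by (simp add: power2_eq_square mult.assoc)
  also have "qpochhammer_inf (q\<^sup>2) (q\<^sup>2) / qpochhammer_inf q (q\<^sup>2)
               = qpochhammer_inf (q\<^sup>2) (q\<^sup>2) ^ 2 / qpochhammer_inf q q"
    using q by (subst qpochhammer_inf_odd) (simp_all add: power2_eq_square)
  finally show ?thesis .
qed

text \<open>The first 2n terms of the series equal a finite sum over s < n. Its term s = 0 is the
  partial product P n; the others lie between 0 and P n q^n, because P s \<ge> 1 and the exponents
  are at least n. This squeezes the sum between P n and P n (1 + n q^n).\<close>

theorem ramanujan_psi_eq:
  fixes q :: real
  assumes q: "0 < q" "q < 1"
  shows "ramanujan_psi q = qpochhammer_inf (q\<^sup>2) (q\<^sup>2) ^ 2 / qpochhammer_inf q q"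
proof (rule LIMSEQ_unique)
  define P where "P = shanks_psi q"
  define L where "L = qpochhammer_inf (q\<^sup>2) (q\<^sup>2) ^ 2 / qpochhammer_inf q q"
  have summ: "summable (\<lambda>s. q ^ (s * (s + 1) div 2))"
  proof (rule summable_comparison_test')
    show "summable (\<lambda>s. q ^ s)"
      using q by (intro summable_geometric) auto
    have "s \<le> s * (s + 1) div 2" for s :: nat
      by (cases s) (auto simp: algebra_simps)
    then show "norm (q ^ (s * (s + 1) div 2)) \<le> q ^ s" if "s \<ge> 0" for s
      using q by (simp add: power_decreasing)
  qed
  have "(\<lambda>n. \<Sum>s<n. q ^ (s * (s + 1) div 2)) \<longlonglongrightarrow> ramanujan_psi q"
    using summable_LIMSEQ[OF summ] by (simp add: ramanujan_psi_def)
  from LIMSEQ_subseq_LIMSEQ[OF this, of "\<lambda>n. 2 * n"]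
  show "(\<lambda>n. \<Sum>s<2*n. q ^ (s * (s + 1) div 2)) \<longlonglongrightarrow> ramanujan_psi q"
    by (simp add: o_def strict_mono_def)
  have pos: "P n > 0" for n
    unfolding P_def by (rule shanks_psi_pos[OF q])
  have ge1: "P n \<ge> 1" for n
    unfolding P_def shanks_psi_def
  proof (intro prod_ge_1)
    fix k
    show "1 \<le> (1 - q ^ (2 * k + 2)) / (1 - q ^ (2 * k + 1))"
      using q power_Suc_less_one[of q "2 * k"] power_decreasing[of "2*k+1" "2*k+2" q]
      by (simp add: field_simps)
  qed
  have "(\<lambda>n. P n * (1 + real n * q ^ n)) \<longlonglongrightarrow> L * (1 + 0)"
    unfolding P_def L_def by (intro tendsto_intros shanks_psi_LIMSEQ tendsto_zero_power_times_n q)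
  then have upper: "(\<lambda>n. P n * (1 + real n * q ^ n)) \<longlonglongrightarrow> L"
    by simp
  have lower: "P \<longlonglongrightarrow> L"
    unfolding P_def L_def by (rule shanks_psi_LIMSEQ[OF q])
  have S: "(\<Sum>s<2*n. q ^ (s * (s + 1) div 2)) = (\<Sum>s<n. (P n / P s) * q ^ (s * (2 * n + 1)))" for n
    using shanks_psi_sum[OF q, of n] by (simp add: P_def)
  have "(\<lambda>n. \<Sum>s<2*n. q ^ (s * (s + 1) div 2)) \<longlonglongrightarrow> L"
  proof (rule tendsto_sandwich[OF _ _ lower upper])
    show "\<forall>\<^sub>F n in sequentially. P n \<le> (\<Sum>s<2*n. q ^ (s * (s + 1) div 2))"
    proof (rule eventually_sequentiallyI[of 1])
      fix n :: nat assume n: "1 \<le> n"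
      have "P n = (\<Sum>s\<in>{0}. (P n / P s) * q ^ (s * (2 * n + 1)))"
        by (simp add: P_def shanks_psi_def)
      also have "\<dots> \<le> (\<Sum>s<n. (P n / P s) * q ^ (s * (2 * n + 1)))"
        using n q pos by (intro sum_mono2) (auto intro!: mult_nonneg_nonneg divide_nonneg_nonneg less_imp_le)
      finally show "P n \<le> (\<Sum>s<2*n. q ^ (s * (s + 1) div 2))"
        by (simp only: S)
    qed
    show "\<forall>\<^sub>F n in sequentially. (\<Sum>s<2*n. q ^ (s * (s + 1) div 2)) \<le> P n * (1 + real n * q ^ n)"
    proof (rule always_eventually, rule allI)
      fix n :: nat
      have "(P n / P s) * q ^ (s * (2 * n + 1)) \<le> (if s = 0 then P n else 0) + P n * q ^ n" for s
      proof (cases "s = 0")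
        case True
        then show ?thesis using pos[of n] q by (simp add: P_def shanks_psi_def)
      next
        case False
        have "P n / P s \<le> P n"
          using pos[of n] ge1[of s] by (simp add: divide_le_eq)
        moreover have "n \<le> s * (2 * n + 1)" using False by (cases s) auto
        then have "q ^ (s * (2 * n + 1)) \<le> q ^ n"
          using q by (intro power_decreasing) auto
        ultimately have "(P n / P s) * q ^ (s * (2 * n + 1)) \<le> P n * q ^ n"
          using pos[of n] pos[of s] q by (intro mult_mono) auto
        then show ?thesis
          using False by simp
      qed
      then have "(\<Sum>s<n. (P n / P s) * q ^ (s * (2 * n + 1))) \<le> (\<Sum>s<n. (if s = 0 then P n else 0) + P n * q ^ n)"
        by (intro sum_mono)
      also have "\<dots> \<le> P n * (1 + real n * q ^ n)"
        using pos[of n] pos[of 0] by (simp add: sum.distrib algebra_simps)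
      finally show "(\<Sum>s<2*n. q ^ (s * (s + 1) div 2)) \<le> P n * (1 + real n * q ^ n)"
        by (simp only: S)
    qed
  qed
  then show "(\<lambda>n. \<Sum>s<2*n. q ^ (s * (s + 1) div 2)) \<longlonglongrightarrow> qpochhammer_inf (q\<^sup>2) (q\<^sup>2) ^ 2 / qpochhammer_inf q q"
    by (simp add: L_def)
qed

text \<open>The series over the integers is split into n \<ge> 0 and n < 0, each absolutely
  convergent by comparison with a geometric series. The halves agree except for the term 1 at n = 0,
  whence the factor 2.\<close>

lemma ramanujan_phi_minus_sums:
  fixes q :: real
  assumes q: "0 < q" "q < 1"
  shows "(\<lambda>n. 1 + 2 * (\<Sum>s<n. (-1) ^ Suc s * q ^ (Suc s)\<^sup>2)) \<longlonglongrightarrow> ramanujan_phi (- q)"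
proof -
  define G where "G k = (-1) ^ k * q ^ k\<^sup>2" for k :: nat
  have G: "(- q) powi ((int k)\<^sup>2) = G k" for k
  proof -
    have "(int k)\<^sup>2 = int (k\<^sup>2)" by simp
    then have "(- q) powi ((int k)\<^sup>2) = (- q) ^ (k\<^sup>2)" by (metis power_int_of_nat)
    \<comment> \<open>k^2 and k have the same parity.\<close>
    also have "\<dots> = G k"
      unfolding G_def power_minus[of q] by (cases "even k") auto
    finally show ?thesis .
  qed
  have summ: "summable (\<lambda>k. norm (G k))"
  proof (rule summable_comparison_test')
    show "summable (\<lambda>s. q ^ s)"
      using q by (intro summable_geometric) auto
    have "s \<le> s\<^sup>2" for s :: nat
      by (cases s) (auto simp: power2_eq_square)
    then show "norm (norm (G s)) \<le> q ^ s" if "s \<ge> 0" for s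
      using q by (simp add: G_def abs_mult power_abs power_decreasing)
  qed
  then have sG: "summable G" by (rule summable_norm_cancel)
  have h1: "(G has_sum suminf G) UNIV"
    by (rule norm_summable_imp_has_sum[OF summ summable_sums[OF sG]])
  have h2: "((\<lambda>k. G (Suc k)) has_sum (\<Sum>k. G (Suc k))) UNIV"
    using summ sG by (intro norm_summable_imp_has_sum summable_sums)
      (use summable_ignore_initial_segment[of _ 1] in auto)
  have inj1: "inj int" and inj2: "inj (\<lambda>k. - int (Suc k))"
    by (auto simp: inj_def)
  have r1: "((\<lambda>n. (- q) powi n\<^sup>2) has_sum suminf G) (range int)"
    unfolding has_sum_reindex[OF inj1] using h1 by (simp add: o_def G)
  have r2: "((\<lambda>n. (- q) powi n\<^sup>2) has_sum (\<Sum>k. G (Suc k))) (range (\<lambda>k. - int (Suc k)))"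
    unfolding has_sum_reindex[OF inj2] o_def power2_minus G by (rule h2)
  have "n \<in> range int \<union> range (\<lambda>k. - int (Suc k))" for n
    by (cases n rule: int_cases) auto
  then have "range int \<union> range (\<lambda>k. - int (Suc k)) = UNIV" by blast
  moreover have "range int \<inter> range (\<lambda>k. - int (Suc k)) = {}" by auto
  ultimately have "((\<lambda>n. (- q) powi n\<^sup>2) has_sum (suminf G + (\<Sum>k. G (Suc k)))) UNIV"
    using has_sum_Un_disjoint[OF r1 r2] by simp
  then have phi: "ramanujan_phi (- q) = suminf G + (\<Sum>k. G (Suc k))"
    by (simp add: ramanujan_phi_def infsumI)
  also have "\<dots> = 1 + 2 * (\<Sum>k. G (Suc k))"
    using suminf_split_head[OF sG] by (simp add: G_def)
  finally have "ramanujan_phi (- q) = 1 + 2 * (\<Sum>k. G (Suc k))" .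
  moreover have "(\<lambda>n. \<Sum>s<n. G (Suc s)) \<longlonglongrightarrow> (\<Sum>k. G (Suc k))"
    using sG by (intro summable_LIMSEQ) (simp add: summable_Suc_iff)
  then have "(\<lambda>n. 1 + 2 * (\<Sum>s<n. G (Suc s))) \<longlonglongrightarrow> 1 + 2 * (\<Sum>k. G (Suc k))"
    by (intro tendsto_intros)
  ultimately show ?thesis
    by (simp add: G_def)
qed

text \<open>The terms alternate in sign, so the finite sum is compared in absolute value with its
  term s = 0, which is P n. As P decreases, each of the n other terms is at most 2 q^n.\<close>

theorem ramanujan_phi_minus_eq:
  fixes q :: real
  assumes q: "0 < q" "q < 1"
  shows "ramanujan_phi (- q) = qpochhammer_inf q q ^ 2 / qpochhammer_inf (q\<^sup>2) (q\<^sup>2)"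
proof (rule LIMSEQ_unique[OF ramanujan_phi_minus_sums[OF q]])
  define P where "P = shanks_phi q"
  define L where "L = qpochhammer_inf q q ^ 2 / qpochhammer_inf (q\<^sup>2) (q\<^sup>2)"
  define t where "t n s = 2 * (-1) ^ s * (P n / P s) * q ^ (s * (n + 1)) / (1 + q ^ s)" for n s
  have pos: "P n > 0" for n
    unfolding P_def by (rule shanks_phi_pos[OF q])
  have "P (Suc n) \<le> P n" for n
  proof -
    have "P (Suc n) = P n * ((1 - q ^ Suc n) / (1 + q ^ Suc n))"
      by (simp add: P_def shanks_phi_def)
    also have "\<dots> \<le> P n * 1"
      using q pos[of n] by (intro mult_left_mono) (auto simp: divide_le_eq add_pos_pos)
    finally show ?thesis by simp
  qed
  then have "decseq P" by (simp add: decseq_SucI)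
  then have mono: "P n \<le> P s" if "s \<le> n" for s n
    using that by (simp add: decseq_def)
  have "(\<lambda>n. (\<Sum>s\<le>n. t n s) - P n) \<longlonglongrightarrow> 0"
  proof (rule Lim_null_comparison)
    show "(\<lambda>n. 2 * (real n * q ^ n)) \<longlonglongrightarrow> 0"
      by (intro tendsto_mult_right_zero tendsto_zero_power_times_n q)
    show "\<forall>\<^sub>F n in sequentially. norm ((\<Sum>s\<le>n. t n s) - P n) \<le> 2 * (real n * q ^ n)"
    proof (rule always_eventually, rule allI)
      fix n :: nat
      have "{..n} = insert 0 {1..n}" by auto
      then have "(\<Sum>s\<le>n. t n s) - P n = (\<Sum>s=1..n. t n s)"
        by (simp add: t_def P_def shanks_phi_def)
      also have "norm \<dots> \<le> (\<Sum>s=1..n. 2 * q ^ n)"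
      proof (rule sum_norm_le)
        fix s assume s: "s \<in> {1..n}"
        have 1: "P n / P s \<le> 1" using mono[of s n] pos[of s] s by simp
        have "n \<le> s * (n + 1)" using s by (cases s) auto
        then have 2: "q ^ (s * (n + 1)) \<le> q ^ n" using q by (intro power_decreasing) auto
        have "norm (t n s) = 2 * (P n / P s) * q ^ (s * (n + 1)) / (1 + q ^ s)"
          using q pos[of n] pos[of s] by (simp add: t_def abs_mult abs_divide power_abs)
        also have "\<dots> \<le> (2 * (P n / P s) * q ^ (s * (n + 1))) / 1"
          using q pos[of n] pos[of s] by (intro divide_left_mono) (auto intro!: add_pos_pos)
        also have "\<dots> \<le> 2 * 1 * q ^ n"
          unfolding div_by_1 using q 1 2 pos[of n] pos[of s] by (intro mult_mono) auto
        finally show "norm (t n s) \<le> 2 * q ^ n" by simp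
      qed
      finally show "norm ((\<Sum>s\<le>n. t n s) - P n) \<le> 2 * (real n * q ^ n)" by simp
    qed
  qed
  from tendsto_add[OF this shanks_phi_LIMSEQ[OF q, folded P_def L_def]]
  have "(\<lambda>n. \<Sum>s\<le>n. t n s) \<longlonglongrightarrow> L" by simp
  then show "(\<lambda>n. 1 + 2 * (\<Sum>s<n. (-1) ^ Suc s * q ^ (Suc s)\<^sup>2)) \<longlonglongrightarrow> qpochhammer_inf q q ^ 2 / qpochhammer_inf (q\<^sup>2) (q\<^sup>2)"
    unfolding t_def P_def L_def shanks_phi_sum[OF q] .
qed

section \<open>Inversion of \<open>\<eta>\<^sup>2\<close>\<close>

text \<open>With \<tau> instead of q as the variable, fractional powers q^r are unambiguous: they
  are \<open>nome (r * \<tau>)\<close>.\<close>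

definition nome :: "complex \<Rightarrow> complex" where
  "nome z = exp (2 * of_real pi * \<i> * z)"

lemma nome_add: "nome (a + b) = nome a * nome b"
  by (simp add: nome_def exp_add ring_distribs)

lemma nome_minus: "nome (- a) = inverse (nome a)"
  by (simp add: nome_def exp_minus)

lemma nome_diff: "nome (a - b) = nome a / nome b"
  by (simp add: nome_def exp_diff ring_distribs)

lemma nome_0 [simp]: "nome 0 = 1"
  by (simp add: nome_def)

lemma nome_nonzero [simp]: "nome z \<noteq> 0"
  by (simp add: nome_def)

lemma nome_of_nat_mult: "nome (of_nat n * z) = nome z ^ n"
  unfolding nome_def by (simp add: exp_of_nat_mult[symmetric] mult_ac)

lemma nome_eq_1_iff: "nome z = 1 \<longleftrightarrow> z \<in> \<int>"
proof -
  have "nome z = 1 \<longleftrightarrow> Im z = 0 \<and> (\<exists>n::int. 2 * pi * Re z = 2 * pi * of_int n)"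
    by (simp add: nome_def exp_eq_1 mult_ac)
  also have "\<dots> \<longleftrightarrow> z \<in> \<int>"
    by (simp add: complex_is_Int_iff)
  finally show ?thesis .
qed

lemma nome_of_int [simp]: "nome (of_int n) = 1" "nome (of_nat m) = 1" "nome (numeral k) = 1" "nome 1 = 1"
  by (simp_all add: nome_eq_1_iff)

lemma nome_half: "nome (1 / 2) = - 1" "nome (- (1 / 2)) = - 1"
  by (simp_all add: nome_def exp_minus)

lemma norm_nome: "norm (nome z) = exp (- 2 * pi * Im z)"
  by (simp add: nome_def)

lemma norm_nome_less_1_iff: "norm (nome z) < 1 \<longleftrightarrow> Im z > 0"
  by (simp add: norm_nome zero_less_mult_iff)

lemma nome_holomorphic [holomorphic_intros]:
  "f holomorphic_on S \<Longrightarrow> (\<lambda>z. nome (f z)) holomorphic_on S"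
  unfolding nome_def by (intro holomorphic_intros)

lemma nome_isCont [continuous_intros]:
  "isCont f z \<Longrightarrow> isCont (\<lambda>z. nome (f z)) z"
  unfolding nome_def by (intro continuous_intros)

text \<open>Up to a factor independent of \<open>z\<close> this is Jacobi's theta function
  \<theta>_1; the factor \<open>nome (- z / 2)\<close> is what makes it odd.\<close>

definition theta_product :: "complex \<Rightarrow> complex \<Rightarrow> complex" where
  "theta_product \<tau> z = nome (- z / 2) * qpochhammer_inf (nome z) (nome \<tau>) * qpochhammer_inf (nome (\<tau> - z)) (nome \<tau>)"

definition period_lattice :: "complex \<Rightarrow> complex set" where
  "period_lattice \<tau> = {of_int m + of_int n * \<tau> | m n. True}"

text \<open>Splitting off the factor k = 0 of the first product leaves an odd function of
  \<open>z\<close> times an even one; the odd one carries the simple zero at the origin.\<close>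

lemma theta_product_alt:
  assumes "Im \<tau> > 0"
  shows "theta_product \<tau> z = (nome (- z / 2) - nome (z / 2)) *
           (qpochhammer_inf (nome (\<tau> + z)) (nome \<tau>) * qpochhammer_inf (nome (\<tau> - z)) (nome \<tau>))"
proof -
  have "qpochhammer_inf (nome z) (nome \<tau>) = (1 - nome z) * qpochhammer_inf (nome (\<tau> + z)) (nome \<tau>)"
    using qpochhammer_inf_rec[of "nome \<tau>" "nome z"] assms
    by (simp add: norm_nome_less_1_iff nome_add mult.commute)
  moreover have "nome (- z / 2) * (1 - nome z) = nome (- z / 2) - nome (z / 2)"
    by (simp add: right_diff_distrib nome_add[symmetric])
  ultimately show ?thesis
    by (simp add: theta_product_def mult.assoc[symmetric])
qed

lemma theta_product_minus:
  assumes "Im \<tau> > 0"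
  shows "theta_product \<tau> (- z) = - theta_product \<tau> z"
  using assms by (simp add: theta_product_alt algebra_simps)

lemma theta_product_plus_1: "theta_product \<tau> (z + 1) = - theta_product \<tau> z"
proof -
  have "nome (- (z + 1) / 2) = - nome (- z / 2)"
  proof -
    have "- (z + 1) / 2 = - z / 2 + - (1 / 2)"
      by (simp add: add_divide_distrib diff_divide_distrib)
    then show ?thesis
      by (simp only: nome_add nome_half mult_minus_right mult_1_right)
  qed
  moreover have "nome (\<tau> - (z + 1)) = nome (\<tau> - z)"
    by (simp add: nome_diff nome_add)
  ultimately show ?thesis
    by (simp add: theta_product_def nome_add)
qed

lemma theta_product_plus_period:
  assumes "Im \<tau> > 0"
  shows "theta_product \<tau> (z + \<tau>) = - nome (- z - \<tau> / 2) * theta_product \<tau> z"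
proof -
  have less: "norm (nome \<tau>) < 1"
    using assms by (simp add: norm_nome_less_1_iff)
  have 1: "qpochhammer_inf (nome (- z)) (nome \<tau>) = (1 - nome (- z)) * qpochhammer_inf (nome (\<tau> - z)) (nome \<tau>)"
    using qpochhammer_inf_rec[OF less, of "nome (- z)"] by (simp add: nome_add[symmetric])
  have 2: "qpochhammer_inf (nome z) (nome \<tau>) = (1 - nome z) * qpochhammer_inf (nome (z + \<tau>)) (nome \<tau>)"
    using qpochhammer_inf_rec[OF less, of "nome z"] by (simp add: nome_add[symmetric])
  have 3: "nome (- (z + \<tau>) / 2) * (1 - nome (- z)) = - nome (- z - \<tau> / 2) * nome (- z / 2) * (1 - nome z)"
  proof -
    have "nome (- (z + \<tau>) / 2) = nome (- (z / 2 + \<tau> / 2))"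
         "nome (- z - \<tau> / 2) = nome (- (z / 2 + z / 2 + \<tau> / 2))"
         "nome (- z) = nome (- (z / 2 + z / 2))" "nome z = nome (z / 2 + z / 2)" "nome (- z / 2) = nome (- (z / 2))"
      by (simp_all add: add_divide_distrib diff_divide_distrib)
    then have "nome (- (z + \<tau>) / 2) = inverse (nome (z / 2) * nome (\<tau> / 2))"
         "nome (- z - \<tau> / 2) = inverse (nome (z / 2) * nome (z / 2) * nome (\<tau> / 2))"
         "nome (- z) = inverse (nome (z / 2) * nome (z / 2))" "nome z = nome (z / 2) * nome (z / 2)"
         "nome (- z / 2) = inverse (nome (z / 2))"
      by (simp_all only: nome_minus nome_add)
    then show ?thesis
      by (simp only:) (simp add: field_simps)
  qed
  let ?A = "qpochhammer_inf (nome (z + \<tau>)) (nome \<tau>)" and ?B = "qpochhammer_inf (nome (\<tau> - z)) (nome \<tau>)"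
  have "theta_product \<tau> (z + \<tau>) = (nome (- (z + \<tau>) / 2) * (1 - nome (- z))) * (?A * ?B)"
    by (simp add: theta_product_def 1 mult_ac)
  also have "\<dots> = (- nome (- z - \<tau> / 2) * nome (- z / 2) * (1 - nome z)) * (?A * ?B)"
    by (simp only: 3)
  also have "\<dots> = - nome (- z - \<tau> / 2) * theta_product \<tau> z"
    by (simp add: theta_product_def 2 mult_ac)
  finally show ?thesis .
qed

lemma theta_product_minus_period:
  assumes "Im \<tau> > 0"
  shows "theta_product \<tau> (z - \<tau>) = - nome (z - \<tau> / 2) * theta_product \<tau> z"
proof -
  have "- nome (z - \<tau> / 2) * (- nome (- (z - \<tau>) - \<tau> / 2)) = 1"
    by (simp add: nome_add[symmetric])
  then show ?thesis
    using theta_product_plus_period[OF assms, of "z - \<tau>"] by (simp add: mult.assoc[symmetric])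
qed

text \<open>A zero comes from a vanishing factor. The first product vanishes at lattice points whose
  \<tau>-coefficient is n \<le> 0, the second at those with n \<ge> 1; together they cover the
  lattice.\<close>

lemma theta_product_eq_0_iff:
  assumes "Im \<tau> > 0"
  shows "theta_product \<tau> z = 0 \<longleftrightarrow> z \<in> period_lattice \<tau>"
proof -
  have less: "norm (nome \<tau>) < 1"
    using assms by (simp add: norm_nome_less_1_iff)
  have 1: "qpochhammer_inf (nome z) (nome \<tau>) = 0 \<longleftrightarrow> (\<exists>k::nat. z + of_nat k * \<tau> \<in> \<int>)"
    by (simp add: qpochhammer_inf_eq_0_iff[OF less] nome_of_nat_mult[symmetric] nome_add[symmetric] nome_eq_1_iff)
  have 2: "qpochhammer_inf (nome (\<tau> - z)) (nome \<tau>) = 0 \<longleftrightarrow> (\<exists>k::nat. \<tau> - z + of_nat k * \<tau> \<in> \<int>)"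
    by (simp add: qpochhammer_inf_eq_0_iff[OF less] nome_of_nat_mult[symmetric] nome_add[symmetric] nome_eq_1_iff)
  show ?thesis
  proof
    assume "theta_product \<tau> z = 0"
    then consider k :: nat where "z + of_nat k * \<tau> \<in> \<int>" | k :: nat where "\<tau> - z + of_nat k * \<tau> \<in> \<int>"
      using 1 2 by (auto simp: theta_product_def)
    then show "z \<in> period_lattice \<tau>"
    proof cases
      case 1
      then obtain m where "z + of_nat k * \<tau> = of_int m" by (auto elim: Ints_cases)
      then have "z = of_int m + of_int (- int k) * \<tau>" by (simp add: algebra_simps)
      then show ?thesis unfolding period_lattice_def by blast
    next
      case 2
      then obtain m where "\<tau> - z + of_nat k * \<tau> = of_int m" by (auto elim: Ints_cases)
      then have "z = of_int (- m) + of_int (int k + 1) * \<tau>" by (simp add: algebra_simps)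
      then show ?thesis unfolding period_lattice_def by blast
    qed
  next
    assume "z \<in> period_lattice \<tau>"
    then obtain m n where z: "z = of_int m + of_int n * \<tau>"
      by (auto simp: period_lattice_def)
    show "theta_product \<tau> z = 0"
    proof (cases "n \<le> 0")
      case True
      then have "z + of_nat (nat (- n)) * \<tau> = of_int m"
        by (simp add: z)
      then have "z + of_nat (nat (- n)) * \<tau> \<in> \<int>" by simp
      then show ?thesis using 1 by (auto simp: theta_product_def)
    next
      case False
      then have "\<tau> - z + of_nat (nat (n - 1)) * \<tau> = of_int (- m)"
        by (simp add: z algebra_simps)
      then have "\<tau> - z + of_nat (nat (n - 1)) * \<tau> \<in> \<int>" by (metis Ints_of_int)
      then show ?thesis using 2 by (auto simp: theta_product_def)
    qed
  qed
qed

lemma qpochhammer_inf_nome_holomorphic: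
  assumes "f holomorphic_on S" "g holomorphic_on S" "open S" "\<And>z. z \<in> S \<Longrightarrow> Im (g z) > 0"
  shows "(\<lambda>z. qpochhammer_inf (nome (f z)) (nome (g z))) holomorphic_on S"
  by (intro qpochhammer_inf_holomorphic holomorphic_intros assms)
     (simp add: norm_nome_less_1_iff assms)

lemma theta_product_holomorphic:
  assumes "Im \<tau> > 0" "f holomorphic_on S" "open S"
  shows "(\<lambda>z. theta_product \<tau> (f z)) holomorphic_on S"
  unfolding theta_product_def
  by (intro holomorphic_intros qpochhammer_inf_nome_holomorphic assms) (use assms in auto)

lemma sin_mult_over_tendsto: "((\<lambda>z::complex. sin (c * z) / z) \<longlongrightarrow> c) (at 0)"
proof -
  have "((\<lambda>z::complex. sin (c * z)) has_field_derivative c) (at 0)"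
    by (auto intro!: derivative_eq_intros)
  then show ?thesis
    by (simp add: has_field_derivative_iff)
qed

lemma nome_diff_sin: "nome (- z / 2) - nome (z / 2) = - 2 * \<i> * sin (of_real pi * z)"
  by (simp add: nome_def sin_exp_eq field_simps)

text \<open>This is the derivative at the zero z = 0. The scaling \<open>c\<close> serves the
  quotient studied below, with c = 1/\<tau> in the numerator and c = 1 in the denominator.\<close>

lemma theta_product_over_tendsto:
  assumes "Im \<tau> > 0" "c \<noteq> 0"
  shows "((\<lambda>z. theta_product \<tau> (c * z) / z) \<longlongrightarrow> - 2 * \<i> * of_real pi * c * qpochhammer_inf (nome \<tau>) (nome \<tau>) ^ 2) (at 0)"
proof -
  have 1: "isCont (\<lambda>z. qpochhammer_inf (nome (f z)) (nome \<tau>)) 0" if "f holomorphic_on UNIV" for f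
    using holomorphic_on_imp_continuous_on[OF qpochhammer_inf_nome_holomorphic[OF that holomorphic_on_const, of \<tau>]] assms
    by (simp add: continuous_on_eq_continuous_at)
  have "((\<lambda>z. - 2 * \<i> * (sin ((of_real pi * c) * z) / z) * (qpochhammer_inf (nome (\<tau> + c * z)) (nome \<tau>) * qpochhammer_inf (nome (\<tau> - c * z)) (nome \<tau>)))
          \<longlongrightarrow> - 2 * \<i> * (of_real pi * c) * (qpochhammer_inf (nome (\<tau> + c * 0)) (nome \<tau>) * qpochhammer_inf (nome (\<tau> - c * 0)) (nome \<tau>))) (at 0)"
    by (intro tendsto_intros sin_mult_over_tendsto isContD 1 holomorphic_intros)
  moreover have "- 2 * \<i> * (sin ((of_real pi * c) * z) / z) * (qpochhammer_inf (nome (\<tau> + c * z)) (nome \<tau>) * qpochhammer_inf (nome (\<tau> - c * z)) (nome \<tau>))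
      = theta_product \<tau> (c * z) / z" for z
    unfolding theta_product_alt[OF assms(1)] nome_diff_sin by (simp add: mult_ac)
  ultimately show ?thesis
    by (simp only:) (simp add: power2_eq_square mult_ac)
qed

section \<open>Lattice-periodic functions\<close>

lemma period_lattice_add_iff:
  assumes "w \<in> period_lattice \<tau>"
  shows "z + w \<in> period_lattice \<tau> \<longleftrightarrow> z \<in> period_lattice \<tau>"
proof -
  have *: "a + b \<in> period_lattice \<tau>" if ab: "a \<in> period_lattice \<tau>" "b \<in> period_lattice \<tau>" for a b
  proof -
    obtain m n m' n' where "a = of_int m + of_int n * \<tau>" "b = of_int m' + of_int n' * \<tau>"
      using ab by (auto simp: period_lattice_def)
    then have "a + b = of_int (m + m') + of_int (n + n') * \<tau>" by (simp add: algebra_simps)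
    then show ?thesis unfolding period_lattice_def by blast
  qed
  have "- w \<in> period_lattice \<tau>"
  proof -
    obtain m n where "w = of_int m + of_int n * \<tau>"
      using assms by (auto simp: period_lattice_def)
    then have "- w = of_int (- m) + of_int (- n) * \<tau>" by (simp add: algebra_simps)
    then show ?thesis unfolding period_lattice_def by blast
  qed
  then show ?thesis
    using *[of "z + w" "- w"] *[of z w] assms by auto
qed

lemma period_lattice_periods: "1 \<in> period_lattice \<tau>" "\<tau> \<in> period_lattice \<tau>" "0 \<in> period_lattice \<tau>"
proof -
  have "1 = of_int 1 + of_int 0 * \<tau>" "\<tau> = of_int 0 + of_int 1 * \<tau>" "0 = of_int 0 + of_int 0 * \<tau>" by auto
  then show "1 \<in> period_lattice \<tau>" "\<tau> \<in> period_lattice \<tau>" "0 \<in> period_lattice \<tau>"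
    unfolding period_lattice_def by blast+
qed

lemma periodic_period_lattice:
  fixes R :: "complex \<Rightarrow> 'a"
  assumes p1: "\<And>z. R (z + 1) = R z" and p2: "\<And>z. R (z + \<tau>) = R z"
    and w: "w \<in> period_lattice \<tau>"
  shows "R (z + w) = R z"
proof -
  have per: "R (z + of_int m * u) = R z" if "\<And>z. R (z + u) = R z" for z u and m :: int
  proof (induction m rule: int_induct[of _ 0])
    case base
    then show ?case by simp
  next
    case (step1 i)
    then show ?case using that[of "z + of_int i * u"] by (simp add: algebra_simps)
  next
    case (step2 i)
    then show ?case using that[of "z + of_int (i - 1) * u"] by (simp add: algebra_simps)
  qed
  obtain m n where "w = of_int m + of_int n * \<tau>"
    using w by (auto simp: period_lattice_def)
  then show ?thesis
    using per[of 1 "z + of_int n * \<tau>" m] per[of \<tau> z n] p1 p2 by (simp add: algebra_simps)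
qed

lemma period_lattice_reduce:
  assumes "Im \<tau> > 0"
  obtains w where "w \<in> period_lattice \<tau>" "norm (z - w) \<le> 1 + norm \<tau>"
proof
  define t where "t = Im z / Im \<tau>"
  define s where "s = Re z - t * Re \<tau>"
  let ?w = "of_int \<lfloor>s\<rfloor> + of_int \<lfloor>t\<rfloor> * \<tau>"
  show "?w \<in> period_lattice \<tau>"
    unfolding period_lattice_def by blast
  have "z = of_real s + of_real t * \<tau>"
    using assms by (simp add: complex_eq_iff s_def t_def)
  then have "z - ?w = of_real (frac s) + of_real (frac t) * \<tau>"
    by (simp add: frac_def algebra_simps)
  also have "norm \<dots> \<le> frac s + frac t * norm \<tau>"
    using norm_triangle_ineq[of "of_real (frac s)" "of_real (frac t) * \<tau>"]
    by (simp add: norm_mult frac_ge_0)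
  also have "\<dots> \<le> 1 + 1 * norm \<tau>"
    by (intro add_mono mult_right_mono) (auto simp: frac_lt_1 less_imp_le)
  finally show "norm (z - ?w) \<le> 1 + norm \<tau>" by simp
qed

text \<open>As functions of \<open>z\<close>, both sides have the same zeros and the same quasi-periods.\<close>

lemma theta_product_inversion:
  assumes \<tau>: "Im \<tau> > 0" and z: "z \<notin> period_lattice \<tau>"
  shows "theta_product (- 1 / \<tau>) (z / \<tau>) * nome (- z\<^sup>2 / (2 * \<tau>)) =
          qpochhammer_inf (nome (- 1 / \<tau>)) (nome (- 1 / \<tau>)) ^ 2 / (\<tau> * qpochhammer_inf (nome \<tau>) (nome \<tau>) ^ 2) * theta_product \<tau> z"
proof -
  define \<tau>' where "\<tau>' = - 1 / \<tau>"
  have \<tau>': "Im \<tau>' > 0"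
    using \<tau> by (auto simp: \<tau>'_def Im_divide intro!: divide_pos_pos sum_power2_gt_zero_iff[THEN iffD2])
  have nz: "\<tau> \<noteq> 0" using \<tau> by auto
  define C where "C = qpochhammer_inf (nome \<tau>') (nome \<tau>') ^ 2 / (\<tau> * qpochhammer_inf (nome \<tau>) (nome \<tau>) ^ 2)"
  define f where "f z = theta_product \<tau>' (z / \<tau>) * nome (- z\<^sup>2 / (2 * \<tau>))" for z
  \<comment> \<open>\<open>C\<close> is the limit of the quotient at the origin, where both theta
    products have simple zeros; assigning it at all lattice points fills the removable
    singularities.\<close>
  define R where "R z = (if z \<in> period_lattice \<tau> then C else f z / theta_product \<tau> z)" for z
  have P_nz: "qpochhammer_inf (nome \<tau>) (nome \<tau>) \<noteq> 0"
    using \<tau> by (intro qpochhammer_inf_nonzero) (simp_all add: norm_nome_less_1_iff)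
  have f1: "f (z + 1) = - f z" for z
  proof -
    have "(z + 1) / \<tau> = z / \<tau> - \<tau>'" by (simp add: \<tau>'_def add_divide_distrib)
    then have "theta_product \<tau>' ((z + 1) / \<tau>) = - nome (z / \<tau> - \<tau>' / 2) * theta_product \<tau>' (z / \<tau>)"
      using theta_product_minus_period[OF \<tau>'] by simp
    \<comment> \<open>The Gaussian factor is chosen so that its change under translation cancels the
      quasi-period factor of the theta product at \<open>z / \<tau>\<close>.\<close>
    moreover have "nome (z / \<tau> - \<tau>' / 2) * nome (- (z + 1)\<^sup>2 / (2 * \<tau>)) = nome (- z\<^sup>2 / (2 * \<tau>))"
      unfolding nome_add[symmetric]
      by (rule arg_cong[of _ _ nome]) (use nz in \<open>simp add: \<tau>'_def field_simps power2_eq_square\<close>)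
    ultimately show ?thesis by (simp add: f_def mult_ac)
  qed
  have f2: "f (z + \<tau>) = - nome (- z - \<tau> / 2) * f z" for z
  proof -
    have "(z + \<tau>) / \<tau> = z / \<tau> + 1" using nz by (simp add: add_divide_distrib)
    then have "theta_product \<tau>' ((z + \<tau>) / \<tau>) = - theta_product \<tau>' (z / \<tau>)"
      by (simp add: theta_product_plus_1)
    moreover have "nome (- (z + \<tau>)\<^sup>2 / (2 * \<tau>)) = nome (- z - \<tau> / 2) * nome (- z\<^sup>2 / (2 * \<tau>))"
      unfolding nome_add[symmetric]
      by (rule arg_cong[of _ _ nome]) (use nz in \<open>simp add: field_simps power2_eq_square\<close>)
    ultimately show ?thesis by (simp add: f_def mult_ac)
  qed
  have R1: "R (z + 1) = R z" for z
    using period_lattice_add_iff[OF period_lattice_periods(1), of z \<tau>]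
    by (simp add: R_def f1 theta_product_plus_1)
  have R2: "R (z + \<tau>) = R z" for z
    using period_lattice_add_iff[OF period_lattice_periods(2), of z \<tau>]
    by (simp add: R_def f2 theta_product_plus_period[OF \<tau>])
  have per: "R (z + w) = R z" if "w \<in> period_lattice \<tau>" for z w
    by (rule periodic_period_lattice[OF R1 R2 that])
  have op: "open (- period_lattice \<tau>)"
  proof -
    have "continuous_on UNIV (theta_product \<tau>)"
      using theta_product_holomorphic[OF \<tau> holomorphic_on_ident open_UNIV] by (rule holomorphic_on_imp_continuous_on)
    then have "open (theta_product \<tau> -` (- {0}))"
      by (intro open_vimage) auto
    moreover have "theta_product \<tau> -` (- {0}) = - period_lattice \<tau>"
      using theta_product_eq_0_iff[OF \<tau>] by auto
    ultimately show ?thesis by simp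
  qed
  have hol: "R holomorphic_on - period_lattice \<tau>"
  proof -
    have "(\<lambda>z. f z / theta_product \<tau> z) holomorphic_on - period_lattice \<tau>"
      unfolding f_def using op nz
      by (intro holomorphic_intros theta_product_holomorphic \<tau> \<tau>') (auto simp: theta_product_eq_0_iff[OF \<tau>])
    then show ?thesis
      by (rule holomorphic_transform) (auto simp: R_def)
  qed
  have ev: "\<forall>\<^sub>F z in at 0. theta_product \<tau> z \<noteq> 0"
  proof -
    have "\<forall>\<^sub>F z in at 0. theta_product \<tau> (1 * z) / z \<noteq> 0"
      using P_nz by (intro tendsto_imp_eventually_ne[OF theta_product_over_tendsto[OF \<tau>]]) auto
    then show ?thesis by (rule eventually_mono) auto
  qed
  have R0: "(R \<longlongrightarrow> R 0) (at 0)"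
  proof -
    have "((\<lambda>z. (theta_product \<tau>' ((1 / \<tau>) * z) / z) * nome (- z\<^sup>2 / (2 * \<tau>)) / (theta_product \<tau> (1 * z) / z)) \<longlongrightarrow>
            (- 2 * \<i> * of_real pi * (1 / \<tau>) * qpochhammer_inf (nome \<tau>') (nome \<tau>') ^ 2) * nome (- 0\<^sup>2 / (2 * \<tau>)) /
            (- 2 * \<i> * of_real pi * 1 * qpochhammer_inf (nome \<tau>) (nome \<tau>) ^ 2)) (at 0)"
      using nz P_nz by (intro tendsto_intros theta_product_over_tendsto \<tau> \<tau>' isContD[OF nome_isCont] continuous_intros) auto
    also have "(- 2 * \<i> * of_real pi * (1 / \<tau>) * qpochhammer_inf (nome \<tau>') (nome \<tau>') ^ 2) * nome (- 0\<^sup>2 / (2 * \<tau>)) /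
            (- 2 * \<i> * of_real pi * 1 * qpochhammer_inf (nome \<tau>) (nome \<tau>) ^ 2) = R 0"
      using nz P_nz by (simp add: R_def period_lattice_periods C_def)
    finally show ?thesis
    proof (rule Lim_transform_eventually)
      show "\<forall>\<^sub>F z in at 0. (theta_product \<tau>' ((1 / \<tau>) * z) / z) * nome (- z\<^sup>2 / (2 * \<tau>)) / (theta_product \<tau> (1 * z) / z) = R z"
        using ev
        by eventually_elim (auto simp: R_def f_def theta_product_eq_0_iff[OF \<tau>] period_lattice_periods field_simps)
    qed
  qed
  obtain e where e: "e > 0" "\<And>z. z \<noteq> 0 \<Longrightarrow> norm z < e \<Longrightarrow> theta_product \<tau> z \<noteq> 0"
    using ev by (auto simp: eventually_at dist_norm)
  have "R holomorphic_on ball 0 e"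
  proof (rule no_isolated_singularity'[where K = "{0}"])
    show "R holomorphic_on ball 0 e - {0}"
      by (rule holomorphic_on_subset[OF hol]) (use e in \<open>auto simp: theta_product_eq_0_iff[OF \<tau>, symmetric]\<close>)
    show "(R \<longlongrightarrow> R z) (at z within ball 0 e)" if "z \<in> {0}" for z
      using R0 that by (auto intro: tendsto_within_subset)
  qed auto
  then have "R field_differentiable at 0"
    using e(1) by (simp add: holomorphic_on_imp_differentiable_at)
  \<comment> \<open>Translation by a period carries differentiability from 0 to every lattice
    point.\<close>
  then have lat: "R field_differentiable at w" if "w \<in> period_lattice \<tau>" for w
  proof -
    have "- w \<in> period_lattice \<tau>"
      using period_lattice_add_iff[OF that, of "- w"] by (simp add: period_lattice_periods)
    then have "R = R \<circ> (\<lambda>z. z - w)"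
      using per[of "- w"] by (simp add: fun_eq_iff)
    moreover have "(R \<circ> (\<lambda>z. z - w)) field_differentiable at w"
    proof (rule field_differentiable_compose)
      show "R field_differentiable at (w - w)"
        using \<open>R field_differentiable at 0\<close> by simp
    qed (intro derivative_intros)
    ultimately show ?thesis by simp
  qed
  have entire: "R holomorphic_on UNIV"
    using op lat hol unfolding holomorphic_on_open[OF open_UNIV] holomorphic_on_def
    by (metis ComplI UNIV_I at_within_open field_differentiable_def)
  have "bounded (range R)"
  proof -
    have "compact (R ` cball 0 (1 + norm \<tau>))"
      by (intro compact_continuous_image holomorphic_on_imp_continuous_on[OF holomorphic_on_subset[OF entire]]) auto
    moreover have "range R \<subseteq> R ` cball 0 (1 + norm \<tau>)"
    proof safe
      fix z
      obtain w where w: "w \<in> period_lattice \<tau>" "norm (z - w) \<le> 1 + norm \<tau>"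
        using period_lattice_reduce[OF \<tau>] by blast
      then have "R z = R (z - w)" using per[OF w(1), of "z - w"] by simp
      then show "R z \<in> R ` cball 0 (1 + norm \<tau>)" using w(2) by auto
    qed
    ultimately show ?thesis
      using bounded_subset compact_imp_bounded by blast
  qed
  then obtain c where "R z = c" for z
    using Liouville_theorem[OF entire] by (auto simp: constant_on_def)
  then have "R z = C"
    using period_lattice_periods(3) by (metis R_def)
  then show ?thesis
    using z theta_product_eq_0_iff[OF \<tau>, of z] by (simp add: R_def f_def C_def \<tau>'_def field_simps)
qed

text \<open>Weber's relation f f_1 f_2 = \<surd>2 without its constant and its power of q, where q =
  s^2. Multiplying by (q^2;q^2) reduces it to the splitting of (q;q) into even and odd
  factors.\<close>

lemma qpochhammer_inf_weber_product:
  fixes s :: complex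
  assumes "norm s < 1"
  shows "qpochhammer_inf (- s\<^sup>2) (s\<^sup>2) * qpochhammer_inf s (s\<^sup>2) * qpochhammer_inf (- s) (s\<^sup>2) = 1"
proof -
  define q where "q = s\<^sup>2"
  have q: "norm q < 1"
    using assms by (simp add: q_def norm_power power_less_one_iff)
  have q2: "norm (q\<^sup>2) < 1"
    using q by (simp add: norm_power power_less_one_iff)
  have nz: "qpochhammer_inf q q \<noteq> 0" "qpochhammer_inf (q\<^sup>2) (q\<^sup>2) \<noteq> 0"
    using qpochhammer_inf_nonzero q q2 by blast+
  have "qpochhammer_inf q q * qpochhammer_inf (- q) q = qpochhammer_inf (q\<^sup>2) (q\<^sup>2)"
    by (rule qpochhammer_inf_mult_minus[OF q])
  moreover have "qpochhammer_inf s q * qpochhammer_inf (- s) q = qpochhammer_inf q (q\<^sup>2)"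
    using qpochhammer_inf_mult_minus[OF q, of s] by (simp add: q_def)
  moreover have "qpochhammer_inf q q = qpochhammer_inf q (q\<^sup>2) * qpochhammer_inf (q\<^sup>2) (q\<^sup>2)"
    using qpochhammer_inf_split_even_odd[OF q, of q] by (simp add: power2_eq_square)
  ultimately have "qpochhammer_inf (q\<^sup>2) (q\<^sup>2) * (qpochhammer_inf (- q) q * (qpochhammer_inf s q * qpochhammer_inf (- s) q))
      = qpochhammer_inf (q\<^sup>2) (q\<^sup>2) * 1"
    by (simp add: mult_ac)
  then show ?thesis
    using nz(2) unfolding q_def mult_cancel_left by (simp add: mult.assoc)
qed

lemma nome_quarter: "nome (- (1 / 4)) = - \<i>"
proof -
  have "nome (- (1 / 4)) = cis (- (pi / 2))"
    by (simp add: nome_def cis_conv_exp mult_ac)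
  then show ?thesis by (simp add: complex_eq_iff)
qed

text \<open>At a half-period the two infinite products coincide up to their first factor, so the
  values are squares of Weber products times powers of \<open>nome\<close>; by Weber's relation only
  an exponential survives. Such an explicit value is what determines the constant of the inversion
  formula.\<close>

lemma theta_product_half_periods:
  assumes "Im \<tau> > 0"
  shows "theta_product \<tau> (1 / 2) * theta_product \<tau> (\<tau> / 2) * theta_product \<tau> ((1 + \<tau>) / 2) = - 2 * nome (- \<tau> / 2)"
proof -
  define s where "s = nome (\<tau> / 2)"
  have s: "norm s < 1" unfolding s_def using assms by (simp add: norm_nome_less_1_iff)
  have q: "nome \<tau> = s\<^sup>2" by (simp add: s_def power2_eq_square nome_add[symmetric])
  have less: "norm (s\<^sup>2) < 1"
    using s by (simp add: norm_power power_less_one_iff)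
  have ms: "nome (1 / 2 + x) = - nome x" "nome (x - 1 / 2) = - nome x" for x
    by (simp_all add: nome_add nome_diff nome_half)
  have 1: "theta_product \<tau> (1 / 2) = - 2 * \<i> * qpochhammer_inf (- s\<^sup>2) (s\<^sup>2) ^ 2"
    using qpochhammer_inf_rec[OF less, of "- 1"] nome_quarter
    by (simp add: theta_product_def q nome_half ms power2_eq_square)
  have 2: "theta_product \<tau> (\<tau> / 2) = nome (- \<tau> / 4) * qpochhammer_inf s (s\<^sup>2) ^ 2"
    by (simp add: theta_product_def q s_def[symmetric] power2_eq_square)
  have 3: "theta_product \<tau> ((1 + \<tau>) / 2) = nome (- (1 + \<tau>) / 4) * qpochhammer_inf (- s) (s\<^sup>2) ^ 2"
  proof -
    have "nome ((1 + \<tau>) / 2) = - s" "nome (\<tau> - (1 + \<tau>) / 2) = - s"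
      using ms[of "\<tau> / 2"] by (simp_all add: s_def add_divide_distrib)
    moreover have "- ((1 + \<tau>) / 2) / 2 = - (1 + \<tau>) / 4" by (simp add: field_simps)
    ultimately show ?thesis by (simp only: theta_product_def q power2_eq_square mult.assoc)
  qed
  have 4: "nome (- \<tau> / 4) * nome (- (1 + \<tau>) / 4) = - \<i> * nome (- \<tau> / 2)"
  proof -
    have "- \<tau> / 4 + - (1 + \<tau>) / 4 = - (1 / 4) + - \<tau> / 2" by (simp add: field_simps)
    then show ?thesis by (metis nome_add nome_quarter)
  qed
  have "theta_product \<tau> (1 / 2) * theta_product \<tau> (\<tau> / 2) * theta_product \<tau> ((1 + \<tau>) / 2)
     = - 2 * \<i> * (nome (- \<tau> / 4) * nome (- (1 + \<tau>) / 4)) *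
       (qpochhammer_inf (- s\<^sup>2) (s\<^sup>2) * qpochhammer_inf s (s\<^sup>2) * qpochhammer_inf (- s) (s\<^sup>2)) ^ 2"
    unfolding 1 2 3 by (simp only: power_mult_distrib mult_ac)
  also have "\<dots> = - 2 * nome (- \<tau> / 2)"
    unfolding qpochhammer_inf_weber_product[OF s] 4 by simp
  finally show ?thesis .
qed

definition eta_sq :: "complex \<Rightarrow> complex" where
  "eta_sq \<tau> = nome (\<tau> / 12) * qpochhammer_inf (nome \<tau>) (nome \<tau>) ^ 2"

lemma eta_sq_nonzero: "Im \<tau> > 0 \<Longrightarrow> eta_sq \<tau> \<noteq> 0"
  by (simp add: eta_sq_def qpochhammer_inf_nonzero norm_nome_less_1_iff)

lemma eta_sq_holomorphic:
  assumes "f holomorphic_on S" "open S" "\<And>z. z \<in> S \<Longrightarrow> Im (f z) > 0"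
  shows "(\<lambda>z. eta_sq (f z)) holomorphic_on S"
  unfolding eta_sq_def by (intro holomorphic_intros qpochhammer_inf_nome_holomorphic assms) auto

lemma Im_minus_inverse_pos:
  assumes "Im \<tau> > 0"
  shows "Im (- 1 / \<tau>) > 0"
  using assms by (auto simp: Im_divide intro!: divide_pos_pos sum_power2_gt_zero_iff[THEN iffD2])

text \<open>The inversion of the theta product has the same constant C for all z. Dividing by \<tau>
  permutes the three half-periods up to sign and lattice translation, so multiplying the three
  instances isolates C^3. Only a cube is obtained in this way; the cube root is fixed
  afterwards.\<close>

lemma eta_sq_inversion_cubed:
  assumes \<tau>: "Im \<tau> > 0"
  shows "(eta_sq (- 1 / \<tau>) / (\<tau> * eta_sq \<tau>)) ^ 3 = \<i>"
proof -
  define \<tau>' where "\<tau>' = - 1 / \<tau>"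
  have \<tau>': "Im \<tau>' > 0"
    using Im_minus_inverse_pos[OF \<tau>] by (simp add: \<tau>'_def)
  have nz: "\<tau> \<noteq> 0" using \<tau> by auto
  define C where "C = qpochhammer_inf (nome \<tau>') (nome \<tau>') ^ 2 / (\<tau> * qpochhammer_inf (nome \<tau>) (nome \<tau>) ^ 2)"
  have inv: "theta_product \<tau>' (z / \<tau>) * nome (- z\<^sup>2 / (2 * \<tau>)) = C * theta_product \<tau> z" if "z \<notin> period_lattice \<tau>" for z
    using theta_product_inversion[OF \<tau> that] by (simp add: C_def \<tau>'_def)
  have nlat: "z \<notin> period_lattice \<tau>" if "theta_product \<tau> z \<noteq> 0" for z
    using that theta_product_eq_0_iff[OF \<tau>] by blast
  have "theta_product \<tau> (1 / 2) * theta_product \<tau> (\<tau> / 2) * theta_product \<tau> ((1 + \<tau>) / 2) \<noteq> 0"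
    unfolding theta_product_half_periods[OF \<tau>] by simp
  then have nl: "1 / 2 \<notin> period_lattice \<tau>" "\<tau> / 2 \<notin> period_lattice \<tau>" "(1 + \<tau>) / 2 \<notin> period_lattice \<tau>"
    by (auto intro!: nlat)
  have 1: "theta_product \<tau>' ((1 / 2) / \<tau>) = - theta_product \<tau>' (\<tau>' / 2)"
    using theta_product_minus[OF \<tau>', of "\<tau>' / 2"] by (simp add: \<tau>'_def mult.commute)
  have 2: "theta_product \<tau>' ((\<tau> / 2) / \<tau>) = theta_product \<tau>' (1 / 2)"
    using nz by simp
  have 3: "theta_product \<tau>' (((1 + \<tau>) / 2) / \<tau>) = theta_product \<tau>' ((1 + \<tau>') / 2)"
  proof -
    have "((1 + \<tau>) / 2) / \<tau> = (1 + \<tau>') / 2 - \<tau>'" "(1 + \<tau>') / 2 - \<tau>' / 2 = 1 / 2"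
      using nz by (simp_all add: \<tau>'_def field_simps)
    then show ?thesis
      using theta_product_minus_period[OF \<tau>', of "(1 + \<tau>') / 2"] by (simp only: nome_half) simp
  qed
  define N where "N = nome (- (1 / 2)\<^sup>2 / (2 * \<tau>)) * nome (- (\<tau> / 2)\<^sup>2 / (2 * \<tau>)) * nome (- ((1 + \<tau>) / 2)\<^sup>2 / (2 * \<tau>))"
  have "C ^ 3 * (theta_product \<tau> (1 / 2) * theta_product \<tau> (\<tau> / 2) * theta_product \<tau> ((1 + \<tau>) / 2))
      = (C * theta_product \<tau> (1 / 2)) * (C * theta_product \<tau> (\<tau> / 2)) * (C * theta_product \<tau> ((1 + \<tau>) / 2))"
    by (simp add: power3_eq_cube mult_ac)
  also have "\<dots> = - (theta_product \<tau>' (1 / 2) * theta_product \<tau>' (\<tau>' / 2) * theta_product \<tau>' ((1 + \<tau>') / 2)) * N"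
    unfolding inv[OF nl(1), symmetric] inv[OF nl(2), symmetric] inv[OF nl(3), symmetric] 1 2 3 N_def
    by (simp add: mult_ac)
  finally have eq: "C ^ 3 * (- 2 * nome (- \<tau> / 2)) = - (- 2 * nome (- \<tau>' / 2)) * N"
    unfolding theta_product_half_periods[OF \<tau>] theta_product_half_periods[OF \<tau>'] .
  have C3: "C ^ 3 = - (nome (- \<tau>' / 2) * N / nome (- \<tau> / 2))"
  proof -
    have "c = - (y * n / x)" if "c * (- 2 * x) = - (- 2 * y) * n" "x \<noteq> 0" for c x y n :: complex
    proof -
      have "c * x = - (y * n)"
        using arg_cong[OF that(1), of "\<lambda>t. - t / 2"] by simp
      then have "c = - (y * n) / x"
        using that(2) by (metis nonzero_mult_div_cancel_right)
      then show ?thesis by simp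
    qed
    from this[OF eq nome_nonzero] show ?thesis .
  qed
  have "eta_sq \<tau>' / (\<tau> * eta_sq \<tau>) = nome (\<tau>' / 12 - \<tau> / 12) * C"
    unfolding nome_diff by (simp add: eta_sq_def C_def)
  then have "(eta_sq \<tau>' / (\<tau> * eta_sq \<tau>)) ^ 3 = nome (\<tau>' / 12 - \<tau> / 12) ^ 3 * C ^ 3"
    by (simp add: power_mult_distrib)
  also have "\<dots> = - nome (of_nat 3 * (\<tau>' / 12 - \<tau> / 12) + ((- \<tau>' / 2 + (- (1 / 2)\<^sup>2 / (2 * \<tau>) + - (\<tau> / 2)\<^sup>2 / (2 * \<tau>) + - ((1 + \<tau>) / 2)\<^sup>2 / (2 * \<tau>))) - - \<tau> / 2))"
    unfolding C3 N_def by (simp only: nome_add nome_diff nome_of_nat_mult mult_minus_right times_divide_eq_right)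
  \<comment> \<open>All terms in \<tau> and 1/\<tau> cancel; the remaining -1/4 is the cross term of
    the square of (1 + \<tau>)/2.\<close>
  also have "of_nat 3 * (\<tau>' / 12 - \<tau> / 12) + ((- \<tau>' / 2 + (- (1 / 2)\<^sup>2 / (2 * \<tau>) + - (\<tau> / 2)\<^sup>2 / (2 * \<tau>) + - ((1 + \<tau>) / 2)\<^sup>2 / (2 * \<tau>))) - - \<tau> / 2) = - (1 / 4)"
    using nz by (simp add: \<tau>'_def field_simps power2_eq_square)
  finally show ?thesis
    by (simp add: nome_quarter \<tau>'_def)
qed

text \<open>The quotient \<open>\<rho>\<close> is continuous on a connected set and takes only
  values with cube \<i>, hence is constant; at \<i>, the fixed point of the inversion, it equals
  1/\<i>.\<close>

theorem eta_sq_inversion: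
  assumes \<tau>: "Im \<tau> > 0"
  shows "eta_sq (- 1 / \<tau>) = - \<i> * \<tau> * eta_sq \<tau>"
proof -
  define \<rho> where "\<rho> \<tau> = eta_sq (- 1 / \<tau>) / (\<tau> * eta_sq \<tau>)" for \<tau>
  define H where "H = {z. Im z > 0}"
  have opH: "open H" unfolding H_def by (rule open_halfspace_Im_gt)
  have "\<rho> holomorphic_on H"
    unfolding \<rho>_def
    by (intro holomorphic_intros eta_sq_holomorphic opH)
       (use Im_minus_inverse_pos eta_sq_nonzero in \<open>auto simp: H_def\<close>)
  then have "continuous_on H \<rho>" by (rule holomorphic_on_imp_continuous_on)
  moreover have "connected H"
    unfolding H_def by (intro convex_connected convex_halfspace_Im_gt)
  moreover have "finite (\<rho> ` H)"
  proof (rule finite_subset)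
    show "\<rho> ` H \<subseteq> {z. z ^ 3 = \<i>}"
      using eta_sq_inversion_cubed by (auto simp: \<rho>_def H_def)
    show "finite {z::complex. z ^ 3 = \<i>}"
      by (rule finite_nth_roots) simp
  qed
  ultimately have "\<rho> constant_on H"
    by (intro continuous_finite_range_constant)
  moreover have "\<i> \<in> H" "\<tau> \<in> H" using \<tau> by (auto simp: H_def)
  ultimately have "\<rho> \<tau> = \<rho> \<i>"
    by (auto simp: constant_on_def)
  also have "\<rho> \<i> = - \<i>"
    using eta_sq_nonzero[of \<i>] by (simp add: \<rho>_def)
  finally show ?thesis
    using \<tau> eta_sq_nonzero[OF \<tau>] by (cases "\<tau> = 0") (auto simp: \<rho>_def field_simps)
qed

section \<open>The multiplier of \<open>\<eta>\<^sup>2\<close>\<close>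

text \<open>Modulo 12 this is a closed form of the homomorphism from SL_2(Z) onto its abelianization
  Z/12, with T sent to 1 and S to -3. Being an integer polynomial, it depends only on the residues
  of the entries.\<close>

definition eta_exponent :: "int \<Rightarrow> int \<Rightarrow> int \<Rightarrow> int \<Rightarrow> int" where
  "eta_exponent a b c d = (1 - c\<^sup>2) * (b * d + 3 * (c - 1) * d + c + 3) + c * (a + d - 3)"

lemma eta_exponent_cong:
  assumes "[a = a'] (mod m)" "[b = b'] (mod m)" "[c = c'] (mod m)" "[d = d'] (mod m)"
  shows "[eta_exponent a b c d = eta_exponent a' b' c' d'] (mod m)"
  unfolding eta_exponent_def by (intro cong_add cong_mult cong_diff cong_pow assms cong_refl)

lemma int_residues:
  fixes x :: int
  shows "\<exists>r\<in>{0,1,2}. [x = r] (mod 3)" "\<exists>r\<in>{0,1,2,3}. [x = r] (mod 4)"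
proof -
  have "x mod 3 \<in> {0,1,2}" by (simp, arith)
  then show "\<exists>r\<in>{0,1,2}. [x = r] (mod 3)" by (intro bexI[of _ "x mod 3"]) auto
  have "x mod 4 \<in> {0,1,2,3}" by (simp, arith)
  then show "\<exists>r\<in>{0,1,2,3}. [x = r] (mod 4)" by (intro bexI[of _ "x mod 4"]) auto
qed

lemma cong_12I: "[x = y] (mod 3) \<Longrightarrow> [x = y] (mod 4) \<Longrightarrow> [x = y] (mod (12::int))"
  using coprime_cong_mult[of x y 3 4] by (simp add: coprime_iff_gcd_eq_1 gcd_non_0_int)

lemma eta_exponent_S_residues:
  "\<forall>a\<in>{0,1,2}. \<forall>b\<in>{0,1,2}. \<forall>c\<in>{0,1,2}. \<forall>d\<in>{0,1,2}. [a * d - b * c = 1] (mod 3) \<longrightarrow>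
     [eta_exponent b (- a) d (- c) = eta_exponent a b c d - 3] (mod 3)"
  "\<forall>a\<in>{0,1,2,3}. \<forall>b\<in>{0,1,2,3}. \<forall>c\<in>{0,1,2,3}. \<forall>d\<in>{0,1,2,3}. [a * d - b * c = 1] (mod 4) \<longrightarrow>
     [eta_exponent b (- a) d (- c) = eta_exponent a b c d - 3] (mod 4)"
  by (simp_all add: eta_exponent_def cong_def)

text \<open>Right multiplication by S = (0, -1; 1, 0). Both sides are polynomials in the entries, so
  by the Chinese remainder theorem a finite check over the residues modulo 3 and modulo 4
  suffices.\<close>

lemma eta_exponent_S:
  assumes det: "a * d - b * c = 1"
  shows "[eta_exponent b (- a) d (- c) = eta_exponent a b c d - 3] (mod 12)"
proof -
  have *: "[eta_exponent b (- a) d (- c) = eta_exponent a b c d - 3] (mod m)"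
    if R: "\<And>x. \<exists>r\<in>R. [x = r] (mod m)"
      and all: "\<forall>a\<in>R. \<forall>b\<in>R. \<forall>c\<in>R. \<forall>d\<in>R. [a * d - b * c = 1] (mod m) \<longrightarrow>
         [eta_exponent b (- a) d (- c) = eta_exponent a b c d - 3] (mod m)" for R m
  proof -
    obtain a' b' c' d' where r: "a' \<in> R" "b' \<in> R" "c' \<in> R" "d' \<in> R"
      "[a = a'] (mod m)" "[b = b'] (mod m)" "[c = c'] (mod m)" "[d = d'] (mod m)"
      using R by meson
    have "[a * d - b * c = a' * d' - b' * c'] (mod m)"
      by (intro cong_diff cong_mult r)
    then have "[a' * d' - b' * c' = 1] (mod m)"
      using det by (metis cong_sym)
    then have "[eta_exponent b' (- a') d' (- c') = eta_exponent a' b' c' d' - 3] (mod m)"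
      using all r by blast
    moreover have "[eta_exponent b (- a) d (- c) = eta_exponent b' (- a') d' (- c')] (mod m)"
      using r by (intro eta_exponent_cong) (simp_all add: cong_minus_minus_iff)
    moreover have "[eta_exponent a b c d - 3 = eta_exponent a' b' c' d' - 3] (mod m)"
      by (intro cong_diff eta_exponent_cong r cong_refl)
    ultimately show ?thesis
      by (meson cong_sym cong_trans)
  qed
  show ?thesis
    using cong_12I *[OF int_residues(1) eta_exponent_S_residues(1)] *[OF int_residues(2) eta_exponent_S_residues(2)] by blast
qed

text \<open>Right multiplication by the n-th power of T. The two sides differ by (1 - c^2) c X plus
  a multiple of the determinant condition; 3 divides c - c^3, and the factor 4 depends on the parity
  of c.\<close>

lemma eta_exponent_T:
  assumes det: "a * d - b * c = 1"
  shows "[eta_exponent a (b + n * a) c (d + n * c) = eta_exponent a b c d + n] (mod 12)"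
proof -
  define X where "X = 2 * n * b + n\<^sup>2 * a + 3 * n * (c - 1)"
  have "eta_exponent a (b + n * a) c (d + n * c) - (eta_exponent a b c d + n)
      = (1 - c\<^sup>2) * c * X + (1 - c\<^sup>2) * n * (a * d - b * c - 1)"
    by (simp add: eta_exponent_def X_def algebra_simps power2_eq_square)
  then have eq: "eta_exponent a (b + n * a) c (d + n * c) - (eta_exponent a b c d + n) = (1 - c\<^sup>2) * c * X"
    using det by simp
  have "\<forall>c\<in>{0,1,2}. [(1 - c\<^sup>2) * c = (0::int)] (mod 3)"
    by (simp add: cong_def)
  moreover obtain c' where "c' \<in> {0,1,2}" "[c = c'] (mod 3)"
    using int_residues(1) by blast
  moreover from this have "[(1 - c\<^sup>2) * c = (1 - c'\<^sup>2) * c'] (mod 3)"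
    by (intro cong_mult cong_diff cong_pow cong_refl)
  ultimately have 3: "3 dvd (1 - c\<^sup>2) * c"
    by (metis cong_0_iff cong_trans)
  have 4: "4 dvd (1 - c\<^sup>2) * c * X"
  proof (cases "even c")
    case True
    \<comment> \<open>For even c, one factor 2 comes from c and the other from X, which is even
      because a is odd.\<close>
    have "odd (a * d - b * c)" using det by simp
    then have "odd a" using True by simp
    then have "even X" using True by (auto simp: X_def)
    then obtain u v where "c = 2 * u" "X = 2 * v" using True by (auto elim!: evenE)
    then show ?thesis by (auto simp: dvd_def intro!: exI[of _ "(1 - c\<^sup>2) * u * v"])
  next
    case False
    then obtain u where "c = 2 * u + 1" by (auto elim: oddE)
    then have "(1 - c\<^sup>2) * c * X = 4 * (- (u\<^sup>2 + u) * c * X)"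
      by (simp add: power2_eq_square algebra_simps)
    then show ?thesis by (metis dvd_triv_left)
  qed
  have "12 dvd (1 - c\<^sup>2) * c * X"
    using cong_12I[of "(1 - c\<^sup>2) * c * X" 0] 3 4 by (simp add: cong_0_iff)
  then show ?thesis
    unfolding cong_iff_dvd_diff eq .
qed

text \<open>The multiplier of \<open>\<eta>\<^sup>2\<close> is a character of \<open>SL\<^sub>2(\<int>)\<close> given by an exponent modulo 12; all that matters
  later is that it depends on the matrix modulo 12 only, where \<open>13 \<equiv> 1\<close>.\<close>

definition eta_law :: "int \<Rightarrow> int \<Rightarrow> int \<Rightarrow> int \<Rightarrow> bool" where
  "eta_law a b c d \<longleftrightarrow> (\<forall>\<tau>. Im \<tau> > 0 \<longrightarrow>
     eta_sq ((of_int a * \<tau> + of_int b) / (of_int c * \<tau> + of_int d)) =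
       nome (of_int (eta_exponent a b c d) / 12) * (of_int c * \<tau> + of_int d) * eta_sq \<tau>)"

lemma nome_twelfth_cong:
  assumes "[x = y] (mod 12)"
  shows "nome (of_int x / 12) = nome (of_int y / 12)"
proof -
  obtain k where "x = y + 12 * k"
    using assms by (metis cong_iff_lin cong_sym)
  then have "nome (of_int x / 12) = nome (of_int y / 12 + of_int k)"
    by (simp add: field_simps)
  then show ?thesis by (simp add: nome_add)
qed

lemma eta_sq_plus_int: "eta_sq (\<tau> + of_int n) = nome (of_int n / 12) * eta_sq \<tau>"
  by (simp add: eta_sq_def nome_add add_divide_distrib)

lemma eta_law_T:
  assumes law: "eta_law a b c d" and det: "a * d - b * c = 1"
  shows "eta_law a (b + n * a) c (d + n * c)"
  unfolding eta_law_def
proof (intro allI impI)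
  fix \<tau> :: complex assume "Im \<tau> > 0"
  then have "Im (\<tau> + of_int n) > 0" by simp
  with law have "eta_sq ((of_int a * (\<tau> + of_int n) + of_int b) / (of_int c * (\<tau> + of_int n) + of_int d)) =
       nome (of_int (eta_exponent a b c d) / 12) * (of_int c * (\<tau> + of_int n) + of_int d) * eta_sq (\<tau> + of_int n)"
    unfolding eta_law_def by blast
  also have "nome (of_int (eta_exponent a b c d) / 12) * (of_int c * (\<tau> + of_int n) + of_int d) * eta_sq (\<tau> + of_int n)
      = nome (of_int (eta_exponent a b c d) / 12 + of_int n / 12) * (of_int c * (\<tau> + of_int n) + of_int d) * eta_sq \<tau>"
    by (simp add: eta_sq_plus_int nome_add)
  also have "of_int (eta_exponent a b c d) / 12 + of_int n / 12 = (of_int (eta_exponent a b c d + n) / 12 :: complex)"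
    by (simp add: add_divide_distrib)
  also have "nome (of_int (eta_exponent a b c d + n) / 12) = nome (of_int (eta_exponent a (b + n * a) c (d + n * c)) / 12)"
    by (rule nome_twelfth_cong[OF cong_sym[OF eta_exponent_T[OF det]]])
  finally show "eta_sq ((of_int a * \<tau> + of_int (b + n * a)) / (of_int c * \<tau> + of_int (d + n * c))) =
       nome (of_int (eta_exponent a (b + n * a) c (d + n * c)) / 12) * (of_int c * \<tau> + of_int (d + n * c)) * eta_sq \<tau>"
    by (simp add: algebra_simps)
qed

lemma eta_law_S:
  assumes law: "eta_law a b c d" and det: "a * d - b * c = 1"
  shows "eta_law b (- a) d (- c)"
  unfolding eta_law_def
proof (intro allI impI)
  fix \<tau> :: complex assume \<tau>: "Im \<tau> > 0"
  then have nz: "\<tau> \<noteq> 0" by auto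
  have "Im (- 1 / \<tau>) > 0" by (rule Im_minus_inverse_pos[OF \<tau>])
  with law have "eta_sq ((of_int a * (- 1 / \<tau>) + of_int b) / (of_int c * (- 1 / \<tau>) + of_int d)) =
       nome (of_int (eta_exponent a b c d) / 12) * (of_int c * (- 1 / \<tau>) + of_int d) * eta_sq (- 1 / \<tau>)"
    unfolding eta_law_def by blast
  also have "(of_int a * (- 1 / \<tau>) + of_int b) / (of_int c * (- 1 / \<tau>) + of_int d)
      = (\<tau> * (of_int a * (- 1 / \<tau>) + of_int b)) / (\<tau> * (of_int c * (- 1 / \<tau>) + of_int d))"
    using nz by simp
  also have "\<tau> * (of_int a * (- 1 / \<tau>) + of_int b) = of_int b * \<tau> + of_int (- a)"
    using nz by (simp add: field_simps)
  also have "\<tau> * (of_int c * (- 1 / \<tau>) + of_int d) = of_int d * \<tau> + of_int (- c)"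
    using nz by (simp add: field_simps)
  also have "nome (of_int (eta_exponent a b c d) / 12) * (of_int c * (- 1 / \<tau>) + of_int d) * eta_sq (- 1 / \<tau>)
      = (nome (of_int (eta_exponent a b c d) / 12) * - \<i>) * (\<tau> * (of_int c * (- 1 / \<tau>) + of_int d)) * eta_sq \<tau>"
    unfolding eta_sq_inversion[OF \<tau>] by (simp only: mult_ac)
  also have "nome (of_int (eta_exponent a b c d) / 12) * - \<i> = nome (of_int (eta_exponent a b c d - 3) / 12)"
  proof -
    have "of_int (eta_exponent a b c d - 3) / 12 = of_int (eta_exponent a b c d) / 12 + - (1 / 4 :: complex)"
      by (simp add: field_simps)
    then show ?thesis by (simp only: nome_add nome_quarter)
  qed
  also have "\<tau> * (of_int c * (- 1 / \<tau>) + of_int d) = of_int d * \<tau> + of_int (- c)"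
    using nz by (simp add: field_simps)
  also have "nome (of_int (eta_exponent a b c d - 3) / 12) = nome (of_int (eta_exponent b (- a) d (- c)) / 12)"
    by (rule nome_twelfth_cong[OF cong_sym[OF eta_exponent_S[OF det]]])
  finally show "eta_sq ((of_int b * \<tau> + of_int (- a)) / (of_int d * \<tau> + of_int (- c))) =
       nome (of_int (eta_exponent b (- a) d (- c)) / 12) * (of_int d * \<tau> + of_int (- c)) * eta_sq \<tau>" .
qed

text \<open>Euclid's algorithm on the bottom row: a power of T reduces d modulo c and S exchanges
  the two entries up to sign, so |c| decreases until the matrix is a translation up to sign.\<close>

theorem eta_sq_modular:
  assumes "a * d - b * c = 1"
  shows "eta_law a b c d"
  using assms
proof (induction "nat \<bar>c\<bar>" arbitrary: a b c d rule: less_induct)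
  case less
  show ?case
  proof (cases "c = 0")
    case True
    then have "a * d = 1" using less.prems by simp
    then consider "a = 1" "d = 1" | "a = - 1" "d = - 1"
      by (auto simp: zmult_eq_1_iff)
    then show ?thesis
    proof cases
      case 1
      have "eta_law 1 0 0 1"
        by (simp add: eta_law_def eta_exponent_def)
      from eta_law_T[OF this, of b] show ?thesis using 1 True by simp
    next
      case 2
      \<comment> \<open>For minus the identity the exponent is 6, and \<open>nome (1 / 2)\<close> =
        -1 cancels the factor c\<tau> + d = -1.\<close>
      have "eta_law (- 1) 0 0 (- 1)"
        by (simp add: eta_law_def eta_exponent_def nome_half)
      from eta_law_T[OF this, of "- b"] show ?thesis using 2 True by simp
    qed
  next
    case False
    define n where "n = d div c"
    define b' where "b' = b - n * a"
    define d' where "d' = d - n * c"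
    have "d' = d mod c" by (simp add: d'_def n_def minus_div_mult_eq_mod)
    then have "\<bar>d'\<bar> < \<bar>c\<bar>" using False by (simp add: abs_mod_less)
    have det: "a * d' - b' * c = 1"
      using less.prems by (simp add: b'_def d'_def algebra_simps)
    have "eta_law b' (- a) d' (- c)"
      by (rule less.hyps) (use \<open>\<bar>d'\<bar> < \<bar>c\<bar>\<close> det in \<open>auto simp: algebra_simps\<close>)
    \<comment> \<open>The induction hypothesis concerns the reduced matrix times S. As S^4 = 1,
      three more multiplications by S give back the reduced matrix.\<close>
    then have "eta_law (- a) (- b') (- c) (- d')"
      by (rule eta_law_S) (use det in \<open>simp add: algebra_simps\<close>)
    then have "eta_law (- b') (- (- a)) (- d') (- (- c))"
      by (rule eta_law_S) (use det in \<open>simp add: algebra_simps\<close>)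
    then have "eta_law (- (- a)) (- (- b')) (- (- c)) (- (- d'))"
      by (rule eta_law_S) (use det in \<open>simp add: algebra_simps\<close>)
    then have "eta_law a b' c d'" by simp
    from eta_law_T[OF this det, of n] show ?thesis
      by (simp add: b'_def d'_def)
  qed
qed

section \<open>Functions invariant under the Atkin--Lehner extension of \<open>\<Gamma>\<^sub>0(26)\<close>\<close>

abbreviation upper_half_plane :: "complex set" where
  "upper_half_plane \<equiv> {\<tau>. Im \<tau> > 0}"

lemma open_upper_half_plane [simp, intro]: "open upper_half_plane"
  by (rule open_halfspace_Im_gt)

lemma connected_upper_half_plane: "connected upper_half_plane"
  by (intro convex_connected convex_halfspace_Im_gt)

text \<open>The determinant is arbitrary because the Atkin--Lehner matrices have determinant 2, 13
  or 26.\<close>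

lemma Im_moebius:
  fixes a b c d :: int
  shows "Im ((of_int a * \<tau> + of_int b) / (of_int c * \<tau> + of_int d))
           = of_int (a * d - b * c) * Im \<tau> / (norm (of_int c * \<tau> + of_int d :: complex))\<^sup>2"
  unfolding Im_divide cmod_power2 by (simp add: algebra_simps)

lemma moebius_denominator_nonzero:
  fixes c d :: int
  assumes "Im \<tau> > 0" "c \<noteq> 0 \<or> d \<noteq> 0"
  shows "of_int c * \<tau> + of_int d \<noteq> 0"
  using assms by (auto simp: complex_eq_iff)

text \<open>A quantitative substitute for the fundamental domain of SL_2(Z). With y = Im \<tau> < 1,
  Dirichlet's theorem for Re \<tau> and denominators up to about 1/\<surd>y gives coprime h, k such
  that |k\<tau> - h|^2 is at most y + 4y, the summands coming from the real and the imaginary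
  part.\<close>

lemma exists_coprime_pair_large_Im:
  assumes "Im \<tau> > 0"
  obtains C D :: int where "coprime C D" "Im \<tau> / (norm (of_int C * \<tau> + of_int D :: complex))\<^sup>2 \<ge> 1 / 5"
proof (cases "Im \<tau> \<ge> 1")
  case True
  show ?thesis by (rule that[of 0 1]) (use True in auto)
next
  case False
  define y where "y = Im \<tau>"
  have y: "0 < y" "y < 1" using assms False by (auto simp: y_def)
  define N where "N = nat \<lceil>1 / sqrt y\<rceil>"
  have N1: "1 / sqrt y \<le> real N" unfolding N_def by linarith
  have "1 / sqrt y \<ge> 1" using y by simp
  then have N2: "real N \<le> 2 / sqrt y" unfolding N_def by linarith
  have "N > 0" using N1 y by (cases "N = 0") auto
  obtain h k where hk: "coprime h k" "0 < k" "k \<le> int N" "\<bar>of_int k * Re \<tau> - of_int h\<bar> < 1 / N"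
    using Dirichlet_approx_coprime[OF \<open>N > 0\<close>] by blast
  have "(norm (of_int k * \<tau> + of_int (- h) :: complex))\<^sup>2 = (of_int k * Re \<tau> - of_int h)\<^sup>2 + (of_int k * y)\<^sup>2"
    by (simp add: cmod_power2 y_def)
  also have "(of_int k * Re \<tau> - of_int h)\<^sup>2 \<le> (1 / N)\<^sup>2"
    using hk(4) by (simp add: abs_le_square_iff[symmetric])
  also have "(1 / N)\<^sup>2 \<le> (sqrt y)\<^sup>2"
    using N1 y \<open>N > 0\<close> by (intro power_mono) (auto simp: field_simps)
  also have "(of_int k * y)\<^sup>2 \<le> (2 / sqrt y * y)\<^sup>2"
  proof (intro power_mono mult_right_mono)
    have "real_of_int k \<le> real N" using hk by linarith
    then show "real_of_int k \<le> 2 / sqrt y" using N2 by linarith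
  qed (use hk y in auto)
  also have "(2 / sqrt y * y)\<^sup>2 = 4 * y"
    using y by (simp add: power_mult_distrib power_divide power2_eq_square)
  finally have "(norm (of_int k * \<tau> + of_int (- h) :: complex))\<^sup>2 \<le> 5 * y"
    using y by simp
  moreover have "(norm (of_int k * \<tau> + of_int (- h) :: complex))\<^sup>2 > 0"
    using moebius_denominator_nonzero[OF assms, of k "- h"] hk by simp
  ultimately show ?thesis
    using hk by (intro that[of k "- h"]) (auto simp: y_def coprime_commute field_simps)
qed

text \<open>A Hauptmodul of Gamma_0(13), a group of genus 0.\<close>

definition h13 :: "complex \<Rightarrow> complex" where
  "h13 \<tau> = eta_sq (13 * \<tau>) / eta_sq \<tau>"

lemma h13_nonzero: "Im \<tau> > 0 \<Longrightarrow> h13 \<tau> \<noteq> 0"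
  by (simp add: h13_def eta_sq_nonzero)

lemma h13_holomorphic:
  assumes "f holomorphic_on S" "open S" "\<And>z. z \<in> S \<Longrightarrow> Im (f z) > 0"
  shows "(\<lambda>z. h13 (f z)) holomorphic_on S"
  unfolding h13_def
  by (intro holomorphic_intros eta_sq_holomorphic assms) (use assms in \<open>auto simp: eta_sq_nonzero\<close>)

lemma h13_Gamma0:
  assumes det: "a * d - 13 * b * c = 1" and \<tau>: "Im \<tau> > 0"
  shows "h13 ((of_int a * \<tau> + of_int b) / (of_int (13 * c) * \<tau> + of_int d)) = h13 \<tau>"
proof -
  let ?g = "(of_int a * \<tau> + of_int b) / (of_int (13 * c) * \<tau> + of_int d)"
  let ?j = "of_int (13 * c) * \<tau> + of_int d"
  have "13 * c \<noteq> 0 \<or> d \<noteq> 0" using det by auto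
  then have nz: "?j \<noteq> 0" by (rule moebius_denominator_nonzero[OF \<tau>])
  have "eta_law a b (13 * c) d"
    by (rule eta_sq_modular) (use det in simp)
  then have 1: "eta_sq ?g = nome (of_int (eta_exponent a b (13 * c) d) / 12) * ?j * eta_sq \<tau>"
    using \<tau> unfolding eta_law_def by blast
  \<comment> \<open>Conjugation by \<tau> -> 13\<tau> yields this matrix: it sends 13\<tau> to 13
    times \<open>?g\<close>, with the same denominator.\<close>
  have "eta_law a (13 * b) c d"
    by (rule eta_sq_modular) (use det in simp)
  then have "eta_sq ((of_int a * (13 * \<tau>) + of_int (13 * b)) / (of_int c * (13 * \<tau>) + of_int d))
      = nome (of_int (eta_exponent a (13 * b) c d) / 12) * (of_int c * (13 * \<tau>) + of_int d) * eta_sq (13 * \<tau>)"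
    using \<tau> unfolding eta_law_def by simp
  also have "(of_int a * (13 * \<tau>) + of_int (13 * b)) / (of_int c * (13 * \<tau>) + of_int d) = 13 * ?g"
    by (simp add: algebra_simps)
  also have "of_int c * (13 * \<tau>) + of_int d = ?j"
    by simp
  also have "nome (of_int (eta_exponent a (13 * b) c d) / 12) = nome (of_int (eta_exponent a b (13 * c) d) / 12)"
    by (intro nome_twelfth_cong eta_exponent_cong) (simp_all add: cong_iff_dvd_diff)
  finally show ?thesis
    unfolding h13_def 1 using nz by simp
qed

lemma h13_Fricke:
  assumes \<tau>: "Im \<tau> > 0"
  shows "h13 (- 1 / (13 * \<tau>)) = 1 / (13 * h13 \<tau>)"
proof -
  have "eta_sq (13 * (- 1 / (13 * \<tau>))) = - \<i> * \<tau> * eta_sq \<tau>"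
    using eta_sq_inversion[OF \<tau>] by simp
  moreover have "eta_sq (- 1 / (13 * \<tau>)) = - \<i> * (13 * \<tau>) * eta_sq (13 * \<tau>)"
    using eta_sq_inversion[of "13 * \<tau>"] \<tau> by simp
  ultimately show ?thesis
    using \<tau> by (auto simp: h13_def)
qed

text \<open>Such a transformation of determinant 13 is an element of Gamma_0(13) applied after
  \<tau> -> -1/(13\<tau>), so both previous laws combine.\<close>

lemma h13_Atkin_Lehner:
  assumes det: "13 * a * d - b * c = 1" and \<tau>: "Im \<tau> > 0"
  shows "h13 ((of_int (13 * a) * \<tau> + of_int b) / (of_int (13 * c) * \<tau> + of_int (13 * d))) = 1 / (13 * h13 \<tau>)"
proof -
  define \<sigma> where "\<sigma> = - 1 / (13 * \<tau>)"
  have nz: "\<tau> \<noteq> 0" using \<tau> by auto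
  have \<sigma>: "Im \<sigma> > 0"
    unfolding \<sigma>_def by (rule Im_minus_inverse_pos) (use \<tau> in simp)
  have "h13 ((of_int (- b) * \<sigma> + of_int a) / (of_int (13 * (- d)) * \<sigma> + of_int c)) = h13 \<sigma>"
    by (rule h13_Gamma0[OF _ \<sigma>]) (use det in \<open>simp add: algebra_simps\<close>)
  also have "(of_int (- b) * \<sigma> + of_int a) / (of_int (13 * (- d)) * \<sigma> + of_int c)
      = (13 * \<tau> * (of_int (- b) * \<sigma> + of_int a)) / (13 * \<tau> * (of_int (13 * (- d)) * \<sigma> + of_int c))"
    using nz by simp
  also have "13 * \<tau> * (of_int (- b) * \<sigma> + of_int a) = of_int (13 * a) * \<tau> + of_int b"
    using nz by (simp add: \<sigma>_def field_simps)
  also have "13 * \<tau> * (of_int (13 * (- d)) * \<sigma> + of_int c) = of_int (13 * c) * \<tau> + of_int (13 * d)"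
    using nz by (simp add: \<sigma>_def field_simps)
  finally show ?thesis
    using h13_Fricke[OF \<tau>] by (simp add: \<sigma>_def)
qed

text \<open>Invariance under \<open>\<Gamma>\<^sub>0(26)\<close> and the Atkin--Lehner involution \<open>W\<^sub>13\<close>.\<close>

definition invariant_26_13 :: "(complex \<Rightarrow> complex) \<Rightarrow> bool" where
  "invariant_26_13 F \<longleftrightarrow>
     (\<forall>a b c d \<tau>. a * d - 26 * b * c = 1 \<longrightarrow> Im \<tau> > 0 \<longrightarrow>
        F ((of_int a * \<tau> + of_int b) / (of_int (26 * c) * \<tau> + of_int d)) = F \<tau>) \<and>
     (\<forall>a b c d \<tau>. 13 * a * d - 2 * b * c = 1 \<longrightarrow> Im \<tau> > 0 \<longrightarrow>
        F ((of_int (13 * a) * \<tau> + of_int b) / (of_int (26 * c) * \<tau> + of_int (13 * d))) = F \<tau>)"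

lemma invariant_26_13_Gamma0:
  assumes "invariant_26_13 F" "a * d - 26 * b * c = 1" "Im \<tau> > 0"
  shows "F ((of_int a * \<tau> + of_int b) / (of_int (26 * c) * \<tau> + of_int d)) = F \<tau>"
  using assms unfolding invariant_26_13_def by blast

lemma invariant_26_13_AL:
  assumes "invariant_26_13 F" "13 * a * d - 2 * b * c = 1" "Im \<tau> > 0"
  shows "F ((of_int (13 * a) * \<tau> + of_int b) / (of_int (26 * c) * \<tau> + of_int (13 * d))) = F \<tau>"
  using assms unfolding invariant_26_13_def by blast

lemma moebius_Fricke:
  fixes a b c d :: int
  assumes \<tau>: "Im \<tau> > 0"
  shows "(of_int a * (- 1 / (26 * \<tau>)) + of_int b) / (of_int c * (- 1 / (26 * \<tau>)) + of_int d)
       = (of_int (26 * b) * \<tau> - of_int a) / (of_int (26 * d) * \<tau> - of_int c)"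
proof -
  have nz: "26 * \<tau> \<noteq> 0" using \<tau> by auto
  have "(of_int a * (- 1 / (26 * \<tau>)) + of_int b) / (of_int c * (- 1 / (26 * \<tau>)) + of_int d)
      = (26 * \<tau> * (of_int a * (- 1 / (26 * \<tau>)) + of_int b)) / (26 * \<tau> * (of_int c * (- 1 / (26 * \<tau>)) + of_int d))"
    using nz by simp
  also have "26 * \<tau> * (of_int a * (- 1 / (26 * \<tau>)) + of_int b) = of_int (26 * b) * \<tau> - of_int a"
    using nz by (simp add: field_simps)
  also have "26 * \<tau> * (of_int c * (- 1 / (26 * \<tau>)) + of_int d) = of_int (26 * d) * \<tau> - of_int c"
    using nz by (simp add: field_simps)
  finally show ?thesis .
qed

text \<open>The cusps of \<open>\<Gamma>\<^sub>0(26)\<close> are permuted transitively by the Atkin--Lehner involutions, so every orbit of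
  the extended group comes close to the cusp at infinity.\<close>

lemma exists_equivalent_large_Im:
  assumes F: "invariant_26_13 F" and Fricke: "\<And>\<tau>. Im \<tau> > 0 \<Longrightarrow> F (- 1 / (26 * \<tau>)) = F \<tau>"
    and \<tau>: "Im \<tau> > 0"
  obtains \<tau>' where "Im \<tau>' \<ge> 1 / 130" "F \<tau>' = F \<tau>"
proof -
  note result = that
  obtain C D :: int where CD: "coprime C D" "Im \<tau> / (norm (of_int C * \<tau> + of_int D :: complex))\<^sup>2 \<ge> 1 / 5"
    using exists_coprime_pair_large_Im[OF \<tau>] .
  define N where "N = (norm (of_int C * \<tau> + of_int D :: complex))\<^sup>2"
  have bound: "Im \<tau> / N \<ge> 1 / 5" using CD(2) by (simp add: N_def)
  define \<sigma> where "\<sigma> = - 1 / (26 * \<tau>)"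
  have \<sigma>: "Im \<sigma> > 0"
    unfolding \<sigma>_def by (rule Im_minus_inverse_pos) (use \<tau> in simp)
  have F\<sigma>: "F \<sigma> = F \<tau>" using Fricke[OF \<tau>] by (simp add: \<sigma>_def)
  \<comment> \<open>\<open>e\<close> is the determinant of a matrix with bottom row (e C, e D). The
    imaginary part gains e from the determinant and loses e^2 from the denominator; the worst case e
    = 26 turns 1/5 into 1/130.\<close>
  have *: thesis if "F ((of_int a * \<tau> + of_int b) / (of_int (e * C) * \<tau> + of_int (e * D))) = F \<tau>"
     "a * (e * D) - b * (e * C) = e" "e > 0" "e \<le> 26" for a b e :: int
  proof (rule result[OF _ that(1)])
    have "of_int (e * C) * \<tau> + of_int (e * D) = of_int e * (of_int C * \<tau> + of_int D :: complex)"
      by (simp add: algebra_simps)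
    then have "(norm (of_int (e * C) * \<tau> + of_int (e * D) :: complex))\<^sup>2 = (of_int e)\<^sup>2 * N"
      by (simp add: N_def norm_mult power_mult_distrib)
    then have "Im ((of_int a * \<tau> + of_int b) / (of_int (e * C) * \<tau> + of_int (e * D))) = of_int e * Im \<tau> / ((of_int e)\<^sup>2 * N)"
      unfolding Im_moebius that(2) by simp
    also have "\<dots> = (Im \<tau> / N) / of_int e"
      using that(3) by (simp add: power2_eq_square)
    also have "\<dots> \<ge> (1 / 5) / of_int e"
      using bound that(3) by (intro divide_right_mono) auto
    also have "(1 / 5) / real_of_int e \<ge> (1 / 5) / 26"
      using that(3,4) by (intro divide_left_mono) auto
    finally show "1 / 130 \<le> Im ((of_int a * \<tau> + of_int b) / (of_int (e * C) * \<tau> + of_int (e * D)))"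
      by simp
  qed
  have solve: "\<exists>x y. x * u - y * v = 1" if "coprime u v" for u v :: int
    using bezout_int[of u v] that by (metis coprime_imp_gcd_eq_1 diff_minus_eq_add mult_minus_left)
  have "prime (13 :: int)" by simp
  then have c13: "coprime C 13" if "\<not> 13 dvd C"
    using prime_imp_coprime[of 13 C] that by (simp add: coprime_commute)
  \<comment> \<open>The gcd of C and 26 selects the operator: e = 1, 2, 13, 26 in the four cases.
    For e = 2 and e = 26 the matrix arises by applying one of determinant 13 or 1 to the Fricke
    image \<open>\<sigma>\<close>.\<close>
  consider "2 dvd C" "13 dvd C" | "\<not> 2 dvd C" "13 dvd C" | "2 dvd C" "\<not> 13 dvd C" | "\<not> 2 dvd C" "\<not> 13 dvd C"
    by blast
  then show thesis
  proof cases
    case 1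
    then have "26 dvd C" by presburger
    then obtain c where c: "C = 26 * c" by blast
    obtain a b where ab: "a * D - b * C = 1" using solve[of D C] CD by (auto simp: coprime_commute)
    show thesis
      by (rule *[of a b 1]) (use invariant_26_13_Gamma0[OF F _ \<tau>, of a D b c] ab c in auto)
  next
    case 2
    then obtain c where c: "C = 13 * c" by blast
    have "coprime (2 * D) C"
      using CD 2 by (simp add: coprime_commute prime_imp_coprime)
    then obtain a b where ab: "a * (2 * D) - b * C = 1" using solve by blast
    have "F ((of_int (13 * (- b)) * \<sigma> + of_int a) / (of_int (26 * (- D)) * \<sigma> + of_int (13 * c))) = F \<tau>"
      using invariant_26_13_AL[OF F _ \<sigma>, of "- b" c a "- D"] F\<sigma> ab c by simp
    also have "(of_int (13 * (- b)) * \<sigma> + of_int a) / (of_int (26 * (- D)) * \<sigma> + of_int (13 * c))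
        = (of_int (26 * a) * \<tau> - of_int (13 * (- b))) / (of_int (26 * (13 * c)) * \<tau> - of_int (26 * (- D)))"
      unfolding \<sigma>_def by (rule moebius_Fricke[OF \<tau>])
    \<comment> \<open>The composite of W_13 and the Fricke involution is W_2 up to a common factor
      13 of all entries.\<close>
    also have "\<dots> = (13 * (of_int (2 * a) * \<tau> + of_int b)) / (13 * (of_int (2 * C) * \<tau> + of_int (2 * D)))"
      by (simp add: c algebra_simps)
    also have "\<dots> = (of_int (2 * a) * \<tau> + of_int b) / (of_int (2 * C) * \<tau> + of_int (2 * D))"
      by (rule mult_divide_mult_cancel_left) simp
    finally show thesis
      by (rule *) (use ab in auto)
  next
    case 3
    then obtain c where c: "C = 2 * c" by blast
    have "coprime (13 * D) C"
      using CD 3 c13 by (simp add: coprime_commute)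
    then obtain a b where ab: "a * (13 * D) - b * C = 1" using solve by blast
    show thesis
      by (rule *[of "13 * a" b 13]) (use invariant_26_13_AL[OF F _ \<tau>, of a D b c] ab c in auto)
  next
    case 4
    have "coprime C (2 * 13 * D)"
      unfolding coprime_mult_right_iff using CD 4 c13 by simp
    then have "coprime (26 * D) C" by (simp add: coprime_commute)
    then obtain a b where ab: "a * (26 * D) - b * C = 1" using solve by blast
    have "F ((of_int (- b) * \<sigma> + of_int a) / (of_int (26 * (- D)) * \<sigma> + of_int C)) = F \<tau>"
      using invariant_26_13_Gamma0[OF F _ \<sigma>, of "- b" C a "- D"] F\<sigma> ab by simp
    also have "(of_int (- b) * \<sigma> + of_int a) / (of_int (26 * (- D)) * \<sigma> + of_int C)
        = (of_int (26 * a) * \<tau> - of_int (- b)) / (of_int (26 * C) * \<tau> - of_int (26 * (- D)))"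
      unfolding \<sigma>_def by (rule moebius_Fricke[OF \<tau>])
    also have "\<dots> = (of_int (26 * a) * \<tau> + of_int b) / (of_int (26 * C) * \<tau> + of_int (26 * D))"
      by simp
    finally show thesis
      by (rule *) (use ab in auto)
  qed
qed

text \<open>Periodicity and the decay at the cusp make \<open>|F|\<close> attain its supremum, since every orbit meets
  the half-plane \<open>Im \<tau> \<ge> 1/130\<close>.\<close>

lemma invariant_vanishing:
  assumes hol: "F holomorphic_on upper_half_plane"
    and F: "invariant_26_13 F" and Fricke: "\<And>\<tau>. Im \<tau> > 0 \<Longrightarrow> F (- 1 / (26 * \<tau>)) = F \<tau>"
    and lim: "(F \<longlongrightarrow> 0) (filtercomap Im at_top)"
    and \<tau>: "Im \<tau> > 0"
  shows "F \<tau> = 0"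
proof (rule ccontr)
  assume nz: "F \<tau> \<noteq> 0"
  have "\<forall>\<^sub>F z in filtercomap Im at_top. dist (F z) 0 < norm (F \<tau>)"
    using tendstoD[OF lim, of "norm (F \<tau>)"] nz by simp
  then obtain Y where Y: "\<And>z. Im z \<ge> Y \<Longrightarrow> norm (F z) < norm (F \<tau>)"
    by (auto simp: eventually_filtercomap eventually_at_top_linorder)
  have period: "F (z + of_int n) = F z" if "Im z > 0" for z n
    using invariant_26_13_Gamma0[OF F _ that, of 1 1 n 0] by simp
  define K where "K = cbox (Complex 0 (1 / 130)) (Complex 1 (max 1 Y))"
  have K: "K = {z. 0 \<le> Re z \<and> Re z \<le> 1 \<and> 1 / 130 \<le> Im z \<and> Im z \<le> max 1 Y}"
    by (auto simp: K_def in_cbox_complex_iff)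
  \<comment> \<open>Only points with |F| at least |F \<tau>| need to be moved: the choice of
    \<open>Y\<close> bounds their height, an integer translation their real part, so that they land
    in the compact \<open>K\<close>.\<close>
  have reach: "\<exists>w\<in>K. F w = F z" if z: "Im z > 0" "norm (F z) \<ge> norm (F \<tau>)" for z
  proof -
    obtain z' where z': "Im z' \<ge> 1 / 130" "F z' = F z"
      using exists_equivalent_large_Im[OF F Fricke z(1)] by blast
    define w where "w = z' + of_int (- \<lfloor>Re z'\<rfloor>)"
    have Fw: "F w = F z"
      unfolding w_def using period[of z' "- \<lfloor>Re z'\<rfloor>"] z' by simp
    then have "Im w < Y" using Y[of w] z(2) by (cases "Im w \<ge> Y") auto
    moreover have "0 \<le> Re w" "Re w \<le> 1" "Im w \<ge> 1 / 130"
      using z' by (simp_all add: w_def) linarith+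
    ultimately show ?thesis using Fw by (intro bexI[of _ w]) (auto simp: K)
  qed
  have "K \<noteq> {}" using reach[OF \<tau>] by auto
  moreover have "K \<subseteq> upper_half_plane" by (auto simp: K)
  then have "continuous_on K (\<lambda>z. norm (F z))"
    by (intro continuous_on_norm holomorphic_on_imp_continuous_on holomorphic_on_subset[OF hol])
  ultimately obtain \<xi> where \<xi>: "\<xi> \<in> K" "\<And>z. z \<in> K \<Longrightarrow> norm (F z) \<le> norm (F \<xi>)"
    using continuous_attains_sup[of K "\<lambda>z. norm (F z)"] by (auto simp: K_def)
  have big: "norm (F \<tau>) \<le> norm (F \<xi>)"
    using reach[OF \<tau>] \<xi> by force
  \<comment> \<open>The remaining points have smaller modulus than F \<tau> anyway, so \<xi> is a
    global maximum inside an open set.\<close>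
  have "norm (F z) \<le> norm (F \<xi>)" if "Im z > 0" for z
    using reach[OF that] \<xi> big by (cases "norm (F z) \<ge> norm (F \<tau>)") force+
  then have "F constant_on upper_half_plane"
    using \<xi> by (intro maximum_modulus_principle[OF hol open_upper_half_plane connected_upper_half_plane
          open_upper_half_plane order_refl, of \<xi>]) (auto simp: K)
  moreover define z where "z = Complex 0 (max 1 Y)"
  moreover have "Im z > 0" "Im z \<ge> Y" by (auto simp: z_def)
  ultimately have "F z = F \<tau>" using \<tau> by (auto simp: constant_on_def)
  then show False using Y[of z] \<open>Im z \<ge> Y\<close> by simp
qed

text \<open>The Fricke involution normalizes the group: conjugation takes (a, b; 26c, d) to (d, -c;
  -26b, a) and likewise permutes the W_13 matrices.\<close>

lemma invariant_26_13_compose_Fricke: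
  assumes F: "invariant_26_13 F"
  shows "invariant_26_13 (\<lambda>\<tau>. F (- 1 / (26 * \<tau>)))"
  unfolding invariant_26_13_def
proof (intro conjI allI impI)
  fix a b c d :: int and \<tau> :: complex
  assume \<tau>: "Im \<tau> > 0"
  define \<sigma> where "\<sigma> = - 1 / (26 * \<tau>)"
  have \<sigma>: "Im \<sigma> > 0"
    unfolding \<sigma>_def by (rule Im_minus_inverse_pos) (use \<tau> in simp)
  have *: "- 1 / (26 * ((of_int a' * \<tau> + of_int b') / (of_int (26 * c') * \<tau> + of_int d')))
      = (of_int d' * \<sigma> + of_int (- c')) / (of_int (26 * (- b')) * \<sigma> + of_int a')" for a' b' c' d' :: int
  proof -
    have "(of_int d' * \<sigma> + of_int (- c')) / (of_int (26 * (- b')) * \<sigma> + of_int a')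
       = (of_int (26 * (- c')) * \<tau> - of_int d') / (of_int (26 * a') * \<tau> - of_int (26 * (- b')))"
      unfolding \<sigma>_def by (rule moebius_Fricke[OF \<tau>])
    also have "\<dots> = (- (of_int (26 * c') * \<tau> + of_int d')) / (26 * (of_int a' * \<tau> + of_int b'))"
      by (simp add: algebra_simps)
    also have "\<dots> = - 1 / (26 * ((of_int a' * \<tau> + of_int b') / (of_int (26 * c') * \<tau> + of_int d')))"
      by simp
    finally show ?thesis by simp
  qed
  {
    assume "a * d - 26 * b * c = 1"
    then have "F ((of_int d * \<sigma> + of_int (- c)) / (of_int (26 * (- b)) * \<sigma> + of_int a)) = F \<sigma>"
      by (intro invariant_26_13_Gamma0[OF F _ \<sigma>]) (simp add: mult_ac)
    then show "F (- 1 / (26 * ((of_int a * \<tau> + of_int b) / (of_int (26 * c) * \<tau> + of_int d)))) = F (- 1 / (26 * \<tau>))"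
      unfolding * \<sigma>_def .
  next
    assume "13 * a * d - 2 * b * c = 1"
    then have "F ((of_int (13 * d) * \<sigma> + of_int (- c)) / (of_int (26 * (- b)) * \<sigma> + of_int (13 * a))) = F \<sigma>"
      by (intro invariant_26_13_AL[OF F _ \<sigma>]) (simp add: mult_ac)
    then show "F (- 1 / (26 * ((of_int (13 * a) * \<tau> + of_int b) / (of_int (26 * c) * \<tau> + of_int (13 * d))))) = F (- 1 / (26 * \<tau>))"
      unfolding * \<sigma>_def .
  }
qed

section \<open>The action of the level 26 group on \<open>h13\<close> at \<tau> and 2\<tau>\<close>

lemma h13_26:
  assumes "Im \<tau> > 0"
  shows "a * d - 26 * b * c = 1 \<Longrightarrow> h13 ((of_int a * \<tau> + of_int b) / (of_int (26 * c) * \<tau> + of_int d)) = h13 \<tau>"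
    and "13 * a * d - 2 * b * c = 1 \<Longrightarrow> h13 ((of_int (13 * a) * \<tau> + of_int b) / (of_int (26 * c) * \<tau> + of_int (13 * d))) = 1 / (13 * h13 \<tau>)"
  using h13_Gamma0[of a d b "2 * c" \<tau>] h13_Atkin_Lehner[of a d b "2 * c" \<tau>] assms by (simp_all add: mult_ac)

text \<open>\<tau> -> 2\<tau> conjugates (a, b; 26c, d) to (a, 2b; 13c, d), to which the level 13
  laws apply.\<close>

lemma h13_26_double:
  assumes "Im \<tau> > 0"
  shows "a * d - 26 * b * c = 1 \<Longrightarrow> h13 (2 * ((of_int a * \<tau> + of_int b) / (of_int (26 * c) * \<tau> + of_int d))) = h13 (2 * \<tau>)"
    and "13 * a * d - 2 * b * c = 1 \<Longrightarrow> h13 (2 * ((of_int (13 * a) * \<tau> + of_int b) / (of_int (26 * c) * \<tau> + of_int (13 * d)))) = 1 / (13 * h13 (2 * \<tau>))"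
  using h13_Gamma0[of a d "2 * b" c "2 * \<tau>"] h13_Atkin_Lehner[of a d "2 * b" c "2 * \<tau>"] assms
  by (simp_all add: algebra_simps)

section \<open>The modular functions \<open>L\<^sup>2\<close> and \<open>S L\<close>\<close>

text \<open>Splitting by parity leaves (-q;q^2), which is (q^2;q^4)/(q;q^2), and both of these are
  quotients of Euler products. This is the product side of \<eta>(\<tau> + 1/2) being
  \<eta>(2\<tau>)^3/(\<eta>(\<tau>) \<eta>(4\<tau>)) up to a root of unity.\<close>

lemma qpochhammer_inf_minus_eq:
  fixes q :: "'a :: {banach, real_normed_field}"
  assumes q: "norm q < 1"
  shows "qpochhammer_inf (- q) (- q) =
    qpochhammer_inf (q\<^sup>2) (q\<^sup>2) ^ 3 / (qpochhammer_inf q q * qpochhammer_inf (q ^ 4) (q ^ 4))"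
proof -
  have q2: "norm (q\<^sup>2) < 1" and q4: "norm (q ^ 4) < 1"
    using q by (simp_all add: norm_power power_less_one_iff)
  have nz: "qpochhammer_inf q q \<noteq> 0" "qpochhammer_inf (q\<^sup>2) (q\<^sup>2) \<noteq> 0" "qpochhammer_inf (q ^ 4) (q ^ 4) \<noteq> 0"
    using qpochhammer_inf_nonzero q q2 q4 by blast+
  have "qpochhammer_inf (- q) (- q) = qpochhammer_inf (- q) (q\<^sup>2) * qpochhammer_inf (q\<^sup>2) (q\<^sup>2)"
    using qpochhammer_inf_split_even_odd[of "- q" "- q"] q by (simp add: power2_eq_square)
  moreover have "qpochhammer_inf q (q\<^sup>2) * qpochhammer_inf (- q) (q\<^sup>2) = qpochhammer_inf (q\<^sup>2) (q ^ 4)"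
    using qpochhammer_inf_mult_minus[OF q2, of q] by simp
  moreover have "qpochhammer_inf (q\<^sup>2) (q ^ 4) = qpochhammer_inf (q\<^sup>2) (q\<^sup>2) / qpochhammer_inf (q ^ 4) (q ^ 4)"
    using qpochhammer_inf_odd[OF q2] by simp
  moreover have "qpochhammer_inf q (q\<^sup>2) = qpochhammer_inf q q / qpochhammer_inf (q\<^sup>2) (q\<^sup>2)"
    by (rule qpochhammer_inf_odd[OF q])
  moreover have "m * r = r ^ 3 / (p * t)" if "(p / r) * m = r / t" "p \<noteq> 0" "r \<noteq> 0" "t \<noteq> 0" for p r m t :: 'a
    using that by (simp add: field_simps power3_eq_cube)
  ultimately show ?thesis
    using nz by metis
qed

lemma eta_sq_half_shift:
  assumes \<tau>: "Im \<tau> > 0"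
  shows "eta_sq (\<tau> + 1 / 2) = nome (1 / 24) * (eta_sq (2 * \<tau>) ^ 3 / (eta_sq \<tau> * eta_sq (4 * \<tau>)))"
proof -
  define q where "q = nome \<tau>"
  have q: "norm q < 1" using \<tau> by (simp add: q_def norm_nome_less_1_iff)
  have n: "nome (\<tau> + 1 / 2) = - q" "nome (2 * \<tau>) = q\<^sup>2" "nome (4 * \<tau>) = q ^ 4"
    using nome_of_nat_mult[of 2 \<tau>] nome_of_nat_mult[of 4 \<tau>] by (simp_all add: q_def nome_add nome_half)
  define s where "s = nome (\<tau> / 12)"
  have "nome (2 * \<tau> / 12) = s\<^sup>2" "nome (4 * \<tau> / 12) = s ^ 4"
    using nome_of_nat_mult[of 2 "\<tau> / 12"] nome_of_nat_mult[of 4 "\<tau> / 12"] by (simp_all add: s_def)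
  moreover have "nome ((\<tau> + 1 / 2) / 12) = nome (1 / 24) * s"
    by (simp add: s_def nome_add add_divide_distrib)
  ultimately have "eta_sq (\<tau> + 1 / 2) = nome (1 / 24) * s * qpochhammer_inf (- q) (- q) ^ 2"
      "eta_sq (2 * \<tau>) = s\<^sup>2 * qpochhammer_inf (q\<^sup>2) (q\<^sup>2) ^ 2" "eta_sq \<tau> = s * qpochhammer_inf q q ^ 2"
      "eta_sq (4 * \<tau>) = s ^ 4 * qpochhammer_inf (q ^ 4) (q ^ 4) ^ 2"
    unfolding eta_sq_def n by (simp_all add: q_def s_def)
  moreover have "s \<noteq> 0" by (simp add: s_def)
  moreover have "n * s * (y ^ 3 / (x * z)) ^ 2 = n * ((s\<^sup>2 * y ^ 2) ^ 3 / ((s * x ^ 2) * (s ^ 4 * z ^ 2)))" for n x y z :: complex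
  proof -
    have "(s\<^sup>2 * y ^ 2) ^ 3 / ((s * x ^ 2) * (s ^ 4 * z ^ 2)) = (s ^ 5 * (s * y ^ 6)) / (s ^ 5 * (x ^ 2 * z ^ 2))"
      by (simp add: power_mult_distrib eval_nat_numeral mult_ac)
    also have "\<dots> = (s * y ^ 6) / (x ^ 2 * z ^ 2)"
      using \<open>s \<noteq> 0\<close> by simp
    finally show ?thesis by (simp add: power_divide power_mult_distrib)
  qed
  ultimately show ?thesis
    unfolding qpochhammer_inf_minus_eq[OF q] by simp
qed

text \<open>The factors \<open>nome (1 / 24)\<close> cancel, but 13 (\<tau> + 1/2) exceeds 13\<tau>
  + 1/2 by 6, and translation by 6 multiplies \<eta>^2 by -1; hence the sign.\<close>

lemma h13_half_shift:
  assumes \<tau>: "Im \<tau> > 0"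
  shows "h13 (\<tau> + 1 / 2) = - (h13 (2 * \<tau>) ^ 3 / (h13 \<tau> * h13 (4 * \<tau>)))"
proof -
  have "eta_sq (13 * (\<tau> + 1 / 2)) = eta_sq ((13 * \<tau> + 1 / 2) + of_int 6)"
    by (simp add: algebra_simps)
  also have "\<dots> = nome (1 / 2) * eta_sq (13 * \<tau> + 1 / 2)"
    by (simp only: eta_sq_plus_int) simp
  also have "\<dots> = - (nome (1 / 24) * (eta_sq (2 * (13 * \<tau>)) ^ 3 / (eta_sq (13 * \<tau>) * eta_sq (4 * (13 * \<tau>)))))"
    using eta_sq_half_shift[of "13 * \<tau>"] \<tau> by (simp add: nome_half)
  finally have "h13 (\<tau> + 1 / 2) = - (nome (1 / 24) * (eta_sq (2 * (13 * \<tau>)) ^ 3 / (eta_sq (13 * \<tau>) * eta_sq (4 * (13 * \<tau>)))))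
     / (nome (1 / 24) * (eta_sq (2 * \<tau>) ^ 3 / (eta_sq \<tau> * eta_sq (4 * \<tau>))))"
    unfolding h13_def eta_sq_half_shift[OF \<tau>] by simp
  also have "\<dots> = - (h13 (2 * \<tau>) ^ 3 / (h13 \<tau> * h13 (4 * \<tau>)))"
    by (simp add: h13_def power_divide mult_ac)
  finally show ?thesis .
qed

text \<open>For even c the matrix lies in Gamma_0(52), of index 2 in Gamma_0(26). For odd c also d
  is odd, and after cancelling 2 the point 4 (g \<tau>) is the image of \<tau> + 1/2 under an
  element of Gamma_0(13).\<close>

lemma h13_26_quadruple:
  assumes \<tau>: "Im \<tau> > 0" and det: "a * d - 26 * b * c = 1"
  shows "h13 (4 * ((of_int a * \<tau> + of_int b) / (of_int (26 * c) * \<tau> + of_int d))) \<in> {h13 (4 * \<tau>), h13 (\<tau> + 1 / 2)}"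
proof (cases "even c")
  case True
  then obtain c' where c: "c = 2 * c'" by (elim evenE)
  have "h13 ((of_int a * (4 * \<tau>) + of_int (4 * b)) / (of_int (13 * c') * (4 * \<tau>) + of_int d)) = h13 (4 * \<tau>)"
    by (rule h13_Gamma0) (use det \<tau> c in auto)
  also have "(of_int a * (4 * \<tau>) + of_int (4 * b)) / (of_int (13 * c') * (4 * \<tau>) + of_int d)
      = 4 * ((of_int a * \<tau> + of_int b) / (of_int (26 * c) * \<tau> + of_int d))"
    by (simp add: c algebra_simps)
  finally show ?thesis by simp
next
  case False
  have "odd (a * d - 26 * b * c)" using det by simp
  then have "odd d" by simp
  then have "even (d - 13 * c)" using False by simp
  then obtain e where e: "d - 13 * c = 2 * e" by (elim evenE)
  then have d: "d = 13 * c + 2 * e" by simp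
  have "h13 ((of_int (2 * a) * (\<tau> + 1 / 2) + of_int (2 * b - a)) / (of_int (13 * c) * (\<tau> + 1 / 2) + of_int e)) = h13 (\<tau> + 1 / 2)"
    by (rule h13_Gamma0) (use det \<tau> d in \<open>auto simp: algebra_simps\<close>)
  also have "(of_int (2 * a) * (\<tau> + 1 / 2) + of_int (2 * b - a)) / (of_int (13 * c) * (\<tau> + 1 / 2) + of_int e)
      = (2 * (of_int (2 * a) * (\<tau> + 1 / 2) + of_int (2 * b - a))) / (2 * (of_int (13 * c) * (\<tau> + 1 / 2) + of_int e))"
    by (rule mult_divide_mult_cancel_left[symmetric]) simp
  also have "\<dots> = 4 * ((of_int a * \<tau> + of_int b) / (of_int (26 * c) * \<tau> + of_int d))"
    by (simp add: d algebra_simps)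
  finally show ?thesis by simp
qed

lemma h13_26_quadruple_AL:
  assumes \<tau>: "Im \<tau> > 0" and det: "13 * a * d - 2 * b * c = 1"
  shows "h13 (4 * ((of_int (13 * a) * \<tau> + of_int b) / (of_int (26 * c) * \<tau> + of_int (13 * d))))
           \<in> {1 / (13 * h13 (4 * \<tau>)), 1 / (13 * h13 (\<tau> + 1 / 2))}"
proof (cases "even c")
  case True
  then obtain c' where c: "c = 2 * c'" by (elim evenE)
  have "h13 ((of_int (13 * a) * (4 * \<tau>) + of_int (4 * b)) / (of_int (13 * c') * (4 * \<tau>) + of_int (13 * d))) = 1 / (13 * h13 (4 * \<tau>))"
    by (rule h13_Atkin_Lehner) (use det \<tau> c in auto)
  also have "(of_int (13 * a) * (4 * \<tau>) + of_int (4 * b)) / (of_int (13 * c') * (4 * \<tau>) + of_int (13 * d))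
      = 4 * ((of_int (13 * a) * \<tau> + of_int b) / (of_int (26 * c) * \<tau> + of_int (13 * d)))"
    by (simp add: c algebra_simps)
  finally show ?thesis by simp
next
  case False
  have "odd (13 * a * d - 2 * b * c)" using det by simp
  then have "odd d" by simp
  then have "even (d - c)" using False by simp
  then obtain e where e: "d - c = 2 * e" by (elim evenE)
  then have d: "d = c + 2 * e" by simp
  have "h13 ((of_int (13 * (2 * a)) * (\<tau> + 1 / 2) + of_int (2 * b - 13 * a)) / (of_int (13 * c) * (\<tau> + 1 / 2) + of_int (13 * e))) = 1 / (13 * h13 (\<tau> + 1 / 2))"
    by (rule h13_Atkin_Lehner) (use det \<tau> d in \<open>auto simp: algebra_simps\<close>)
  also have "(of_int (13 * (2 * a)) * (\<tau> + 1 / 2) + of_int (2 * b - 13 * a)) / (of_int (13 * c) * (\<tau> + 1 / 2) + of_int (13 * e))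
      = (2 * (of_int (13 * (2 * a)) * (\<tau> + 1 / 2) + of_int (2 * b - 13 * a))) / (2 * (of_int (13 * c) * (\<tau> + 1 / 2) + of_int (13 * e)))"
    by (rule mult_divide_mult_cancel_left[symmetric]) simp
  also have "\<dots> = 4 * ((of_int (13 * a) * \<tau> + of_int b) / (of_int (26 * c) * \<tau> + of_int (13 * d)))"
    by (simp add: d algebra_simps)
  finally show ?thesis by simp
qed

text \<open>With \<open>h, k, l\<close> the values of \<open>h13\<close> at \<open>\<tau>, 2\<tau>, 4\<tau>\<close>, the quantities \<open>L\<^sup>2\<close> and \<open>S L\<close> of the theorem
  are \<open>lambda_form h k\<close> and \<open>sigma_form h k l\<close>.\<close>

definition lambda_form :: "'a \<Rightarrow> 'a \<Rightarrow> 'a :: field" where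
  "lambda_form h k = h / k + k / h - 2"

definition sigma_form :: "'a \<Rightarrow> 'a \<Rightarrow> 'a \<Rightarrow> 'a :: field" where
  "sigma_form h k l = k / l + l / k - k\<^sup>2 / (l * h) - l * h / k\<^sup>2"

definition lambda_sq :: "complex \<Rightarrow> complex" where
  "lambda_sq \<tau> = lambda_form (h13 \<tau>) (h13 (2 * \<tau>))"

definition sigma_lambda :: "complex \<Rightarrow> complex" where
  "sigma_lambda \<tau> = sigma_form (h13 \<tau>) (h13 (2 * \<tau>)) (h13 (4 * \<tau>))"

lemma lambda_form_inverse:
  fixes h k :: complex
  assumes "h \<noteq> 0" "k \<noteq> 0"
  shows "lambda_form (1 / (13 * h)) (1 / (13 * k)) = lambda_form h k"
  using assms by (simp add: lambda_form_def field_simps)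

lemma sigma_form_inverse:
  fixes h k l :: complex
  assumes "h \<noteq> 0" "k \<noteq> 0" "l \<noteq> 0"
  shows "sigma_form (1 / (13 * h)) (1 / (13 * k)) (1 / (13 * l)) = sigma_form h k l"
proof -
  have "1 / (13 * k) / (1 / (13 * l)) = l / k" "1 / (13 * l) / (1 / (13 * k)) = k / l"
    "(1 / (13 * k))\<^sup>2 / (1 / (13 * l) * (1 / (13 * h))) = l * h / k\<^sup>2"
    "1 / (13 * l) * (1 / (13 * h)) / (1 / (13 * k))\<^sup>2 = k\<^sup>2 / (l * h)"
    using assms by (simp_all add: power2_eq_square)
  then show ?thesis
    unfolding sigma_form_def by simp
qed

text \<open>As a function of l the form is \<alpha> l + \<beta>/l with \<alpha> = 1/k - h/k^2 and
  \<beta> = k - k^2/h = - \<alpha> k^3/h, so replacing l by - k^3/(h l) swaps its two summands. This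
  is the exchange of h13(4\<tau>) and h13(\<tau> + 1/2).\<close>

lemma sigma_form_conjugate:
  fixes h k l :: complex
  assumes "h \<noteq> 0" "k \<noteq> 0" "l \<noteq> 0"
  shows "sigma_form h k (- (k ^ 3 / (h * l))) = sigma_form h k l"
  using assms by (simp add: sigma_form_def field_simps power2_eq_square power3_eq_cube)

lemma sigma_form_half_shift:
  assumes "Im \<tau> > 0" "l \<in> {h13 (4 * \<tau>), h13 (\<tau> + 1 / 2)}"
  shows "sigma_form (h13 \<tau>) (h13 (2 * \<tau>)) l = sigma_lambda \<tau>"
  using assms h13_nonzero[of \<tau>] h13_nonzero[of "2 * \<tau>"] h13_nonzero[of "4 * \<tau>"]
  by (auto simp: sigma_lambda_def h13_half_shift sigma_form_conjugate)

lemma lambda_sq_invariant: "invariant_26_13 lambda_sq"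
  unfolding invariant_26_13_def
  using h13_26 h13_26_double lambda_form_inverse[OF h13_nonzero h13_nonzero]
  by (simp add: lambda_sq_def)

lemma sigma_lambda_invariant: "invariant_26_13 sigma_lambda"
  unfolding invariant_26_13_def
proof (intro conjI allI impI)
  fix a b c d :: int and \<tau> :: complex
  assume \<tau>: "Im \<tau> > 0"
  {
    assume det: "a * d - 26 * b * c = 1"
    show "sigma_lambda ((of_int a * \<tau> + of_int b) / (of_int (26 * c) * \<tau> + of_int d)) = sigma_lambda \<tau>"
      unfolding sigma_lambda_def[of "_ / _"] h13_26(1)[OF \<tau> det] h13_26_double(1)[OF \<tau> det]
      by (rule sigma_form_half_shift[OF \<tau> h13_26_quadruple[OF \<tau> det]])
  next
    assume det: "13 * a * d - 2 * b * c = 1"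
    define g where "g = (of_int (13 * a) * \<tau> + of_int b) / (of_int (26 * c) * \<tau> + of_int (13 * d))"
    obtain l where l: "l \<in> {h13 (4 * \<tau>), h13 (\<tau> + 1 / 2)}" "h13 (4 * g) = 1 / (13 * l)"
      using h13_26_quadruple_AL[OF \<tau> det] by (auto simp: g_def)
    have "sigma_lambda g = sigma_form (1 / (13 * h13 \<tau>)) (1 / (13 * h13 (2 * \<tau>))) (1 / (13 * l))"
      unfolding sigma_lambda_def l(2) using h13_26(2)[OF \<tau> det] h13_26_double(2)[OF \<tau> det] by (simp add: g_def)
    also have "\<dots> = sigma_form (h13 \<tau>) (h13 (2 * \<tau>)) l"
      using \<tau> l by (intro sigma_form_inverse) (auto simp: h13_nonzero)
    also have "\<dots> = sigma_lambda \<tau>"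
      by (rule sigma_form_half_shift[OF \<tau> l(1)])
    finally show "sigma_lambda ((of_int (13 * a) * \<tau> + of_int b) / (of_int (26 * c) * \<tau> + of_int (13 * d))) = sigma_lambda \<tau>"
      by (simp add: g_def)
  }
qed

lemma h13_Fricke_26:
  assumes \<tau>: "Im \<tau> > 0"
  shows "h13 (- 1 / (26 * \<tau>)) = 1 / (13 * h13 (2 * \<tau>))"
    and "h13 (2 * (- 1 / (26 * \<tau>))) = 1 / (13 * h13 \<tau>)"
    and "h13 (4 * (- 1 / (26 * \<tau>))) = 1 / (13 * h13 (\<tau> / 2))"
proof -
  have "- 1 / (26 * \<tau>) = - 1 / (13 * (2 * \<tau>))" "2 * (- 1 / (26 * \<tau>)) = - 1 / (13 * \<tau>)"
    "4 * (- 1 / (26 * \<tau>)) = - 1 / (13 * (\<tau> / 2))"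
    by simp_all
  then show "h13 (- 1 / (26 * \<tau>)) = 1 / (13 * h13 (2 * \<tau>))"
    and "h13 (2 * (- 1 / (26 * \<tau>))) = 1 / (13 * h13 \<tau>)"
    and "h13 (4 * (- 1 / (26 * \<tau>))) = 1 / (13 * h13 (\<tau> / 2))"
    using h13_Fricke[of "2 * \<tau>"] h13_Fricke[of \<tau>] h13_Fricke[of "\<tau> / 2"] \<tau> by (simp_all only:) simp_all
qed

lemma lambda_sq_Fricke:
  assumes \<tau>: "Im \<tau> > 0"
  shows "lambda_sq (- 1 / (26 * \<tau>)) = lambda_sq \<tau>"
  unfolding lambda_sq_def h13_Fricke_26[OF \<tau>]
  using \<tau> by (subst lambda_form_inverse) (auto simp: h13_nonzero lambda_form_def)

text \<open>The involution exchanges h and k up to inversion but turns h13(4\<tau>) into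
  h13(\<tau>/2), so the image is a different function, to be expanded in
  \<open>nome (\<tau> / 2)\<close>.\<close>

lemma sigma_lambda_Fricke:
  assumes \<tau>: "Im \<tau> > 0"
  shows "sigma_lambda (- 1 / (26 * \<tau>)) = sigma_form (h13 (2 * \<tau>)) (h13 \<tau>) (h13 (\<tau> / 2))"
  unfolding sigma_lambda_def h13_Fricke_26[OF \<tau>]
  using \<tau> by (intro sigma_form_inverse) (auto simp: h13_nonzero)

section \<open>Taylor coefficients at the cusp\<close>

text \<open>Six explicit coefficients with remainder O(x^6) suffice, because every denominator below
  is at most x^5 times a unit.\<close>

definition jet :: "(complex \<Rightarrow> complex) \<Rightarrow> complex \<Rightarrow> complex \<Rightarrow> complex \<Rightarrow> complex \<Rightarrow> complex \<Rightarrow> complex \<Rightarrow> bool" where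
  "jet f a0 a1 a2 a3 a4 a5 \<longleftrightarrow>
     (\<lambda>x. f x - (a0 + a1 * x + a2 * x ^ 2 + a3 * x ^ 3 + a4 * x ^ 4 + a5 * x ^ 5)) \<in> O[at 0](\<lambda>x. x ^ 6)"

text \<open>Separates structure from arithmetic: the closure rules produce coefficients as
  unevaluated expressions, which are compared with the stated numbers afterwards.\<close>

lemma jet_eqI:
  "jet f a0 a1 a2 a3 a4 a5 \<Longrightarrow> a0 = b0 \<Longrightarrow> a1 = b1 \<Longrightarrow> a2 = b2 \<Longrightarrow> a3 = b3 \<Longrightarrow> a4 = b4 \<Longrightarrow> a5 = b5 \<Longrightarrow>
     jet f b0 b1 b2 b3 b4 b5"
  by simp

lemma jet_cong:
  assumes "\<forall>\<^sub>F x in at 0. f x = g x" "jet g a0 a1 a2 a3 a4 a5"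
  shows "jet f a0 a1 a2 a3 a4 a5"
  using assms(2) unfolding jet_def
  by (rule landau_o.big.in_cong[THEN iffD1, rotated]) (use assms(1) in \<open>auto elim: eventually_mono\<close>)

lemma jet_const: "jet (\<lambda>x. c) c 0 0 0 0 0"
  by (simp add: jet_def)

lemma jet_monom:
  "jet (\<lambda>x. x ^ k) (if k = 0 then 1 else 0) (if k = 1 then 1 else 0) (if k = 2 then 1 else 0)
     (if k = 3 then 1 else 0) (if k = 4 then 1 else 0) (if k = 5 then 1 else 0)"
proof (cases "k < 6")
  case True
  then have "k \<in> {0,1,2,3,4,5}" by auto
  then show ?thesis by (auto simp: jet_def)
next
  case False
  then obtain n where k: "k = n + 6" by (metis add.commute le_Suc_ex not_less)
  have "((\<lambda>x::complex. x ^ n) \<longlongrightarrow> 0 ^ n) (at 0)" by (intro tendsto_intros)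
  then have "(\<lambda>x::complex. x ^ n) \<in> O[at 0](\<lambda>_. 1)"
    by (intro bigoI_tendsto[of _ _ "0 ^ n"]) auto
  from landau_o.big.mult[OF this landau_o.big_refl[of "\<lambda>x. x ^ 6"]] show ?thesis
    using False by (simp add: jet_def k power_add)
qed

lemma jet_ident: "jet (\<lambda>x. x) 0 1 0 0 0 0"
  using jet_monom[of 1] by simp

lemma jet_add:
  assumes "jet f a0 a1 a2 a3 a4 a5" "jet g b0 b1 b2 b3 b4 b5"
  shows "jet (\<lambda>x. f x + g x) (a0 + b0) (a1 + b1) (a2 + b2) (a3 + b3) (a4 + b4) (a5 + b5)"
  using sum_in_bigo(1)[OF assms[unfolded jet_def]] by (simp add: jet_def algebra_simps)

lemma jet_diff:
  assumes "jet f a0 a1 a2 a3 a4 a5" "jet g b0 b1 b2 b3 b4 b5"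
  shows "jet (\<lambda>x. f x - g x) (a0 - b0) (a1 - b1) (a2 - b2) (a3 - b3) (a4 - b4) (a5 - b5)"
  using sum_in_bigo(2)[OF assms[unfolded jet_def]] by (simp add: jet_def algebra_simps)

lemma bigo_1_at_0:
  fixes f :: "complex \<Rightarrow> complex"
  assumes "isCont f 0"
  shows "f \<in> O[at 0](\<lambda>_. 1)"
  using assms by (intro bigoI_tendsto[of _ _ "f 0"]) (auto simp: isCont_def)

lemma jet_mult:
  assumes f: "jet f a0 a1 a2 a3 a4 a5" and g: "jet g b0 b1 b2 b3 b4 b5"
  shows "jet (\<lambda>x. f x * g x) (a0 * b0) (a0 * b1 + a1 * b0) (a0 * b2 + a1 * b1 + a2 * b0)
     (a0 * b3 + a1 * b2 + a2 * b1 + a3 * b0) (a0 * b4 + a1 * b3 + a2 * b2 + a3 * b1 + a4 * b0)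
     (a0 * b5 + a1 * b4 + a2 * b3 + a3 * b2 + a4 * b1 + a5 * b0)"
proof -
  define A where "A x = a0 + a1 * x + a2 * x ^ 2 + a3 * x ^ 3 + a4 * x ^ 4 + a5 * x ^ 5" for x
  define B where "B x = b0 + b1 * x + b2 * x ^ 2 + b3 * x ^ 3 + b4 * x ^ 4 + b5 * x ^ 5" for x
  \<comment> \<open>\<open>R x * x ^ 6\<close> gathers the terms of degree 6 to 10 in the product of
    the two polynomials.\<close>
  define R where "R x = a1 * b5 + a2 * b4 + a3 * b3 + a4 * b2 + a5 * b1 + (a2 * b5 + a3 * b4 + a4 * b3 + a5 * b2) * x
     + (a3 * b5 + a4 * b4 + a5 * b3) * x ^ 2 + (a4 * b5 + a5 * b4) * x ^ 3 + a5 * b5 * x ^ 4" for x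
  have f': "(\<lambda>x. f x - A x) \<in> O[at 0](\<lambda>x. x ^ 6)" and g': "(\<lambda>x. g x - B x) \<in> O[at 0](\<lambda>x. x ^ 6)"
    using f g by (simp_all add: jet_def A_def B_def)
  have A: "A \<in> O[at 0](\<lambda>_. 1)" by (rule bigo_1_at_0) (simp add: A_def[abs_def])
  have B: "B \<in> O[at 0](\<lambda>_. 1)" by (rule bigo_1_at_0) (simp add: B_def[abs_def])
  have R: "R \<in> O[at 0](\<lambda>_. 1)" by (rule bigo_1_at_0) (simp add: R_def[abs_def])
  have x6: "(\<lambda>x::complex. x ^ 6) \<in> O[at 0](\<lambda>_. 1)"
    by (intro bigo_1_at_0) simp
  have "(\<lambda>x. (f x - A x) * (g x - B x)) \<in> O[at 0](\<lambda>x. x ^ 6)"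
    using landau_o.big.mult[OF f' landau_o.big_trans[OF g' x6]] by simp
  moreover have "(\<lambda>x. A x * (g x - B x)) \<in> O[at 0](\<lambda>x. x ^ 6)"
    using landau_o.big.mult[OF A g'] by simp
  moreover have "(\<lambda>x. (f x - A x) * B x) \<in> O[at 0](\<lambda>x. x ^ 6)"
    using landau_o.big.mult[OF f' B] by simp
  moreover have "(\<lambda>x. R x * x ^ 6) \<in> O[at 0](\<lambda>x. x ^ 6)"
    using landau_o.big.mult[OF R landau_o.big_refl[of "\<lambda>x. x ^ 6"]] by simp
  ultimately have "(\<lambda>x. (f x - A x) * (g x - B x) + A x * (g x - B x) + (f x - A x) * B x + R x * x ^ 6) \<in> O[at 0](\<lambda>x. x ^ 6)"
    by (intro sum_in_bigo)
  also have "(\<lambda>x. (f x - A x) * (g x - B x) + A x * (g x - B x) + (f x - A x) * B x + R x * x ^ 6)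
     = (\<lambda>x. f x * g x - (A x * B x - R x * x ^ 6))"
    by (simp add: fun_eq_iff algebra_simps)
  also have "(\<lambda>x. A x * B x - R x * x ^ 6) = (\<lambda>x. (a0 * b0) + (a0 * b1 + a1 * b0) * x + (a0 * b2 + a1 * b1 + a2 * b0) * x ^ 2
     + (a0 * b3 + a1 * b2 + a2 * b1 + a3 * b0) * x ^ 3 + (a0 * b4 + a1 * b3 + a2 * b2 + a3 * b1 + a4 * b0) * x ^ 4
     + (a0 * b5 + a1 * b4 + a2 * b3 + a3 * b2 + a4 * b1 + a5 * b0) * x ^ 5)"
    by (simp add: fun_eq_iff A_def B_def R_def algebra_simps eval_nat_numeral)
  finally show ?thesis
    by (simp add: jet_def fun_eq_iff)
qed

text \<open>Meant for the product with base q^13, whose expansion is 1 to the order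
  considered.\<close>

lemma jet_inverse_one:
  assumes "jet f 1 0 0 0 0 0"
  shows "jet (\<lambda>x. 1 / f x) 1 0 0 0 0 0"
proof -
  have f: "(\<lambda>x. f x - 1) \<in> O[at 0](\<lambda>x. x ^ 6)"
    using assms by (simp add: jet_def)
  have "(\<lambda>x::complex. x ^ 6) \<in> o[at 0](\<lambda>_. 1)"
    by (rule smalloI_tendsto) (auto intro!: tendsto_eq_intros)
  with f have "(\<lambda>x. f x - 1) \<in> o[at 0](\<lambda>_. 1)"
    by (rule landau_o.big_small_trans)
  then have "((\<lambda>x. f x - 1) \<longlongrightarrow> 0) (at 0)"
    using smalloD_tendsto by fastforce
  then have lim: "(f \<longlongrightarrow> 1) (at 0)"
    using tendsto_add[of "\<lambda>x. f x - 1" 0 "at 0" "\<lambda>_. 1" 1] by simp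
  then have nz: "\<forall>\<^sub>F x in at 0. f x \<noteq> 0"
    by (rule tendsto_imp_eventually_ne) simp
  have "((\<lambda>x. - (1 / f x)) \<longlongrightarrow> - (1 / 1)) (at 0)"
    by (intro tendsto_intros lim) simp
  then have "(\<lambda>x. - (1 / f x)) \<in> O[at 0](\<lambda>_. 1)"
    by (intro bigoI_tendsto[of _ _ "- 1"]) auto
  from landau_o.big.mult[OF this f] have "(\<lambda>x. - (1 / f x) * (f x - 1)) \<in> O[at 0](\<lambda>x. x ^ 6)"
    by simp
  also have "?this \<longleftrightarrow> (\<lambda>x. 1 / f x - 1) \<in> O[at 0](\<lambda>x. x ^ 6)"
    by (rule landau_o.big.in_cong) (use nz in \<open>auto elim!: eventually_mono simp: field_simps\<close>)
  finally show ?thesis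
    by (simp add: jet_def)
qed

text \<open>The product of the 1 + |w| |x|^k is at most exp (2 |w|). With a power of x for w, the
  bound shows that the tail of an Euler product does not affect low coefficients.\<close>

lemma norm_qpochhammer_inf_minus_one_le:
  fixes w x :: complex
  assumes "norm x \<le> 1 / 2" "norm w \<le> 1 / 2"
  shows "norm (qpochhammer_inf w x - 1) \<le> 4 * norm w"
proof (rule LIMSEQ_le_const2)
  have x: "norm x < 1" using assms by simp
  show "(\<lambda>n. norm ((\<Prod>k<n. 1 - w * x ^ k) - 1)) \<longlonglongrightarrow> norm (qpochhammer_inf w x - 1)"
    by (intro tendsto_intros qpochhammer_inf_LIMSEQ x)
  have "norm ((\<Prod>k<n. 1 - w * x ^ k) - 1) \<le> 4 * norm w" for n
  proof -
    have "norm ((\<Prod>k<n. 1 + - (w * x ^ k)) - 1) \<le> (\<Prod>k<n. 1 + norm (- (w * x ^ k))) - 1"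
      by (rule norm_prod_minus1_le_prod_minus1)
    also have "(\<Prod>k<n. 1 + norm (- (w * x ^ k))) \<le> exp (\<Sum>k<n. norm (- (w * x ^ k)))"
      by (rule prod_le_exp_sum) auto
    also have "(\<Sum>k<n. norm (- (w * x ^ k))) \<le> (\<Sum>k<n. norm w * (1 / 2) ^ k)"
      using assms by (intro sum_mono) (auto simp: norm_mult norm_power intro!: mult_left_mono power_mono)
    also have "\<dots> \<le> 2 * norm w"
    proof -
      have "(\<Sum>k<n. (1 / 2 :: real) ^ k) \<le> 2"
        by (simp add: sum_gp_strict)
      from mult_left_mono[OF this norm_ge_zero[of w]] show ?thesis
        by (simp add: sum_distrib_left)
    qed
    also have "exp (2 * norm w) \<le> 1 + 2 * norm w + (2 * norm w)\<^sup>2"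
      using assms by (intro exp_bound) auto
    also have "\<dots> \<le> 1 + 4 * norm w"
      using assms mult_left_mono[of "norm w" "1 / 2" "norm w"] by (simp add: power2_eq_square)
    finally show ?thesis by simp
  qed
  then show "\<exists>N. \<forall>n\<ge>N. norm ((\<Prod>k<n. 1 - w * x ^ k) - 1) \<le> 4 * norm w" by blast
qed

lemma eventually_norm_less_at_0: "e > 0 \<Longrightarrow> \<forall>\<^sub>F x::complex in at 0. norm x < e"
  using eventually_at_ball[of e "0::complex" UNIV] by simp

lemma jet_qpochhammer_inf:
  assumes "m \<ge> 6" "n \<ge> 1"
  shows "jet (\<lambda>x. qpochhammer_inf (x ^ m) (x ^ n)) 1 0 0 0 0 0"
proof -
  have "\<forall>\<^sub>F x::complex in at 0. norm (qpochhammer_inf (x ^ m) (x ^ n) - 1) \<le> 4 * norm (x ^ 6)"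
    using eventually_norm_less_at_0[of "1 / 2", OF half_gt_zero[OF zero_less_one]]
  proof eventually_elim
    case (elim x)
    have pw: "norm x ^ k \<le> norm x ^ 1" if "k \<ge> 1" for k
      using elim that by (intro power_decreasing) auto
    have "norm (qpochhammer_inf (x ^ m) (x ^ n) - 1) \<le> 4 * norm (x ^ m)"
      using pw[of m] pw[of n] elim assms by (intro norm_qpochhammer_inf_minus_one_le) (auto simp: norm_power)
    also have "norm (x ^ m) \<le> norm (x ^ 6)"
      using elim assms by (auto simp: norm_power intro!: power_decreasing)
    finally show ?case by simp
  qed
  then have "(\<lambda>x::complex. qpochhammer_inf (x ^ m) (x ^ n) - 1) \<in> O[at 0](\<lambda>x. x ^ 6)"
    by (rule bigoI)
  then show ?thesis by (simp add: jet_def)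
qed

text \<open>\<open>h13\<close> equals q divided by this. The reciprocal is the convenient form,
  since its denominator is 1 + O(q^13).\<close>

definition euler_ratio :: "complex \<Rightarrow> complex" where
  "euler_ratio q = (qpochhammer_inf q q / qpochhammer_inf (q ^ 13) (q ^ 13)) ^ 2"

lemma jet_euler_ratio_power:
  assumes P: "jet (\<lambda>x. qpochhammer_inf (x ^ n) (x ^ n)) a0 a1 a2 a3 a4 a5" and n: "n \<ge> 1"
    and sq: "c0 = a0 * a0" "c1 = 2 * a0 * a1" "c2 = 2 * a0 * a2 + a1 * a1" "c3 = 2 * a0 * a3 + 2 * a1 * a2"
      "c4 = 2 * a0 * a4 + 2 * a1 * a3 + a2 * a2" "c5 = 2 * a0 * a5 + 2 * a1 * a4 + 2 * a2 * a3"
  shows "jet (\<lambda>x. euler_ratio (x ^ n)) c0 c1 c2 c3 c4 c5"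
proof -
  have "jet (\<lambda>x. 1 / qpochhammer_inf (x ^ (n * 13)) (x ^ (n * 13))) 1 0 0 0 0 0"
    using n by (intro jet_inverse_one jet_qpochhammer_inf) auto
  from jet_mult[OF P this] have "jet (\<lambda>x. qpochhammer_inf (x ^ n) (x ^ n) / qpochhammer_inf (x ^ (n * 13)) (x ^ (n * 13))) a0 a1 a2 a3 a4 a5"
    by simp
  from jet_mult[OF this this] show ?thesis
    unfolding sq by (simp add: euler_ratio_def power2_eq_square power_mult algebra_simps)
qed

lemmas jet_intros = jet_add jet_diff jet_mult jet_monom jet_ident jet_const

lemma jet_euler_ratio:
  "jet euler_ratio 1 (- 2) (- 1) 2 1 2"
  "jet (\<lambda>x. euler_ratio (x ^ 2)) 1 0 (- 2) 0 (- 1) 0"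
  "jet (\<lambda>x. euler_ratio (x ^ 4)) 1 0 0 0 (- 2) 0"
  "jet (\<lambda>x. euler_ratio (x ^ 8)) 1 0 0 0 0 0"
proof -
  \<comment> \<open>The coefficients 1 - x - x^2 + x^5 are those of Euler's pentagonal number
    theorem; here they come from five factors and a tail 1 + O(x^6).\<close>
  have 1: "jet (\<lambda>x. qpochhammer_inf (x ^ 1) (x ^ 1)) 1 (- 1) (- 1) 0 0 1"
  proof (rule jet_cong)
    show "\<forall>\<^sub>F x::complex in at 0. qpochhammer_inf (x ^ 1) (x ^ 1)
        = ((1 - x) * (1 - x ^ 2)) * ((1 - x ^ 3) * ((1 - x ^ 4) * (1 - x ^ 5))) * qpochhammer_inf (x ^ 6) (x ^ 1)"
      using eventually_norm_less_at_0[of 1, OF zero_less_one]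
    proof eventually_elim
      case (elim x)
      have "qpochhammer_inf (x ^ k) x = (1 - x ^ k) * qpochhammer_inf (x ^ Suc k) x" for k
        using qpochhammer_inf_rec[OF elim, of "x ^ k"] by (simp add: mult.commute)
      from this[of 1] this[of 2] this[of 3] this[of 4] this[of 5] show ?case
        by (simp add: eval_nat_numeral mult_ac)
    qed
    show "jet (\<lambda>x. ((1 - x) * (1 - x ^ 2)) * ((1 - x ^ 3) * ((1 - x ^ 4) * (1 - x ^ 5))) * qpochhammer_inf (x ^ 6) (x ^ 1)) 1 (- 1) (- 1) 0 0 1"
      by (rule jet_eqI, (rule jet_intros jet_qpochhammer_inf order_refl)+, simp_all)
  qed
  show "jet euler_ratio 1 (- 2) (- 1) 2 1 2"
    using jet_euler_ratio_power[OF 1] by simp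
  have "jet (\<lambda>x. qpochhammer_inf (x ^ 2) (x ^ 2)) 1 0 (- 1) 0 (- 1) 0"
  proof (rule jet_cong)
    show "\<forall>\<^sub>F x::complex in at 0. qpochhammer_inf (x ^ 2) (x ^ 2) = (1 - x ^ 2) * (1 - x ^ 4) * qpochhammer_inf (x ^ 6) (x ^ 2)"
      using eventually_norm_less_at_0[of 1, OF zero_less_one]
    proof eventually_elim
      case (elim x)
      then have "norm (x ^ 2) < 1" by (simp add: norm_power power_less_one_iff)
      from qpochhammer_inf_rec[OF this, of "x ^ 2"] qpochhammer_inf_rec[OF this, of "x ^ 4"] show ?case
        by (simp add: eval_nat_numeral mult_ac)
    qed
    show "jet (\<lambda>x. (1 - x ^ 2) * (1 - x ^ 4) * qpochhammer_inf (x ^ 6) (x ^ 2)) 1 0 (- 1) 0 (- 1) 0"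
      by (rule jet_eqI, (rule jet_intros jet_qpochhammer_inf order_refl)+, simp_all)
  qed
  from jet_euler_ratio_power[OF this] show "jet (\<lambda>x. euler_ratio (x ^ 2)) 1 0 (- 2) 0 (- 1) 0"
    by simp
  have "jet (\<lambda>x. qpochhammer_inf (x ^ 4) (x ^ 4)) 1 0 0 0 (- 1) 0"
  proof (rule jet_cong)
    show "\<forall>\<^sub>F x::complex in at 0. qpochhammer_inf (x ^ 4) (x ^ 4) = (1 - x ^ 4) * qpochhammer_inf (x ^ 8) (x ^ 4)"
      using eventually_norm_less_at_0[of 1, OF zero_less_one]
    proof eventually_elim
      case (elim x)
      then have "norm (x ^ 4) < 1" by (simp add: norm_power power_less_one_iff)
      from qpochhammer_inf_rec[OF this, of "x ^ 4"] show ?case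
        by (simp add: eval_nat_numeral mult_ac)
    qed
    show "jet (\<lambda>x. (1 - x ^ 4) * qpochhammer_inf (x ^ 8) (x ^ 4)) 1 0 0 0 (- 1) 0"
      by (rule jet_eqI, (rule jet_intros jet_qpochhammer_inf order_refl)+, simp_all)
  qed
  from jet_euler_ratio_power[OF this] show "jet (\<lambda>x. euler_ratio (x ^ 4)) 1 0 0 0 (- 2) 0"
    by simp
  have "jet (\<lambda>x. qpochhammer_inf (x ^ 8) (x ^ 8)) 1 0 0 0 0 0"
    by (rule jet_qpochhammer_inf) simp_all
  from jet_euler_ratio_power[OF this] show "jet (\<lambda>x. euler_ratio (x ^ 8)) 1 0 0 0 0 0"
    by simp
qed

section \<open>Expansions at the cusp and decay of the relations\<close>

lemma h13_nome:
  assumes "Im \<tau> > 0"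
  shows "h13 \<tau> = nome \<tau> / euler_ratio (nome \<tau>)"
proof -
  have "nome (13 * \<tau>) = nome \<tau> ^ 13"
    using nome_of_nat_mult[of 13 \<tau>] by simp
  moreover have "nome (13 * \<tau> / 12) = nome \<tau> * nome (\<tau> / 12)"
    by (simp add: nome_add[symmetric])
  ultimately show ?thesis
    by (simp add: h13_def eta_sq_def euler_ratio_def power_divide)
qed

lemma euler_ratio_nonzero:
  assumes "norm q < 1"
  shows "euler_ratio q \<noteq> 0"
proof -
  have "norm (q ^ 13) < 1" using assms by (simp add: norm_power power_less_one_iff)
  then show ?thesis
    using assms by (simp add: euler_ratio_def qpochhammer_inf_nonzero)
qed

lemma filterlim_nome_at_0:
  assumes "c > 0"
  shows "filterlim (\<lambda>\<tau>. nome (of_real c * \<tau>)) (at 0) (filtercomap Im at_top)"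
proof (rule filterlim_atI)
  have "((\<lambda>y. exp (- (2 * pi * c) * y)) \<longlongrightarrow> 0) at_top"
    using assms by (intro filterlim_compose[OF exp_at_bot] filterlim_tendsto_neg_mult_at_bot[OF tendsto_const _ filterlim_ident]) simp
  then have "((\<lambda>\<tau>. exp (- (2 * pi * c) * Im \<tau>)) \<longlongrightarrow> 0) (filtercomap Im at_top)"
    by (rule filterlim_compose) (rule filterlim_filtercomap)
  then have "((\<lambda>\<tau>. norm (nome (of_real c * \<tau>))) \<longlongrightarrow> 0) (filtercomap Im at_top)"
    by (simp add: norm_nome mult_ac)
  then show "((\<lambda>\<tau>. nome (of_real c * \<tau>)) \<longlongrightarrow> 0) (filtercomap Im at_top)"
    by (rule tendsto_norm_zero_cancel)
qed simp

lemma jet_quotient_tendsto_0: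
  assumes N: "jet N 0 0 0 0 0 0" and D: "jet D 1 d1 d2 d3 d4 d5" and "k \<le> 5"
  shows "((\<lambda>x. N x / (x ^ k * D x)) \<longlongrightarrow> 0) (at 0)"
proof -
  have "N \<in> O[at 0](\<lambda>x. x ^ 6)"
    using N by (simp add: jet_def)
  also have "(\<lambda>x::complex. x ^ 6) \<in> o[at 0](\<lambda>x. x ^ k)"
  proof (rule smalloI_tendsto)
    have "((\<lambda>x::complex. x ^ (6 - k)) \<longlongrightarrow> 0 ^ (6 - k)) (at 0)"
      by (intro tendsto_intros)
    then have "((\<lambda>x::complex. x ^ (6 - k)) \<longlongrightarrow> 0) (at 0)"
      using assms(3) by (simp add: power_0_left)
    then show "((\<lambda>x::complex. x ^ 6 / x ^ k) \<longlongrightarrow> 0) (at 0)"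
      by (rule Lim_transform_eventually)
         (use assms(3) in \<open>auto simp: eventually_at_filter power_diff\<close>)
    show "\<forall>\<^sub>F x::complex in at 0. x ^ k \<noteq> 0"
      by (rule eventually_mono[OF eventually_neq_at_within[of 0]]) simp
  qed
  finally have "N \<in> o[at 0](\<lambda>x. x ^ k)" .
  then have 1: "((\<lambda>x. N x / x ^ k) \<longlongrightarrow> 0) (at 0)"
    by (rule smalloD_tendsto)
  have "(\<lambda>x. D x - (1 + d1 * x + d2 * x ^ 2 + d3 * x ^ 3 + d4 * x ^ 4 + d5 * x ^ 5)) \<in> O[at 0](\<lambda>x. x ^ 6)"
    using D by (simp add: jet_def)
  also have "(\<lambda>x::complex. x ^ 6) \<in> o[at 0](\<lambda>_. 1)"
    by (rule smalloI_tendsto) (auto intro!: tendsto_eq_intros)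
  finally have "((\<lambda>x. D x - (1 + d1 * x + d2 * x ^ 2 + d3 * x ^ 3 + d4 * x ^ 4 + d5 * x ^ 5)) \<longlongrightarrow> 0) (at 0)"
    using smalloD_tendsto by fastforce
  moreover have "((\<lambda>x. 1 + d1 * x + d2 * x ^ 2 + d3 * x ^ 3 + d4 * x ^ 4 + d5 * x ^ 5) \<longlongrightarrow> 1) (at 0)"
    by (auto intro!: tendsto_eq_intros)
  ultimately have "(D \<longlongrightarrow> 1) (at 0)"
    using tendsto_add by fastforce
  from tendsto_divide[OF 1 this] show ?thesis by simp
qed

lemma lambda_form_euler:
  fixes q a b :: complex
  assumes "q \<noteq> 0" "a \<noteq> 0" "b \<noteq> 0"
  shows "lambda_form (q / a) (q ^ 2 / b) = (b * b + q ^ 2 * (a * a) - 2 * (q * (a * b))) / (q * (a * b))"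
  using assms by (simp add: lambda_form_def field_simps power2_eq_square)

text \<open>The term 169 h k is the Fricke image of 1/(h k). As 1/(h k) has a triple and M a simple
  pole in q, the four coefficients of the cubic are determined by cancelling the powers q^-3 to
  q^0.\<close>

definition level13_relation :: "complex \<Rightarrow> complex" where
  "level13_relation \<tau> = 1 / (h13 \<tau> * h13 (2 * \<tau>)) + 169 * (h13 \<tau> * h13 (2 * \<tau>))
     - (lambda_sq \<tau> ^ 3 - 2 * lambda_sq \<tau> ^ 2 - 15 * lambda_sq \<tau> + 10)"

lemma level13_relation_at_cusp: "(level13_relation \<longlongrightarrow> 0) (filtercomap Im at_top)"
proof -
  define a where "a = euler_ratio"
  define b where "b x = euler_ratio (x ^ 2)" for x
  define m where "m x = b x * b x + x ^ 2 * (a x * a x) - 2 * (x * (a x * b x))" for x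
  define c where "c x = a x * b x" for x
  \<comment> \<open>\<open>N\<close> is the relation multiplied by q^3 (a b)^3, a polynomial in q, a
    and b.\<close>
  define N where "N x = c x * c x * (c x * c x) + 169 * (x ^ 6 * (c x * c x))
     - (m x * (m x * m x) - 2 * (x * (m x * m x * c x)) - 15 * (x ^ 2 * (m x * (c x * c x))) + 10 * (x ^ 3 * (c x * (c x * c x))))" for x
  have a: "jet a 1 (- 2) (- 1) 2 1 2" and b: "jet b 1 0 (- 2) 0 (- 1) 0"
    using jet_euler_ratio(1,2) by (simp_all add: a_def b_def[abs_def])
  have c: "jet c 1 (- 2) (- 3) 6 2 0"
    unfolding c_def[abs_def] by (rule jet_eqI, (rule jet_intros a b)+, simp_all)
  have m: "jet m 1 (- 2) 1 2 (- 8) 4"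
    unfolding m_def[abs_def] by (rule jet_eqI, (rule jet_intros a b)+, simp_all)
  have N: "jet N 0 0 0 0 0 0"
    unfolding N_def[abs_def] by (rule jet_eqI, (rule jet_intros c m)+, simp_all)
  have c3: "jet (\<lambda>x. c x * (c x * c x)) 1 (- 6) 3 46 (- 75) (- 114)"
    by (rule jet_eqI, (rule jet_intros c)+, simp_all)
  have "filterlim nome (at 0) (filtercomap Im at_top)"
    using filterlim_nome_at_0[of 1] by simp
  from filterlim_compose[OF jet_quotient_tendsto_0[OF N c3, of 3] this]
  have "((\<lambda>\<tau>. N (nome \<tau>) / (nome \<tau> ^ 3 * (c (nome \<tau>) * (c (nome \<tau>) * c (nome \<tau>))))) \<longlongrightarrow> 0) (filtercomap Im at_top)"
    by simp
  then show ?thesis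
  proof (rule Lim_transform_eventually)
    have "\<forall>\<^sub>F \<tau> in filtercomap Im at_top. Im \<tau> > 0"
      by (rule eventually_filtercomapI[OF eventually_gt_at_top])
    then show "\<forall>\<^sub>F \<tau> in filtercomap Im at_top.
       N (nome \<tau>) / (nome \<tau> ^ 3 * (c (nome \<tau>) * (c (nome \<tau>) * c (nome \<tau>)))) = level13_relation \<tau>"
    proof eventually_elim
      case (elim \<tau>)
      define q where "q = nome \<tau>"
      have q: "norm q < 1" "norm (q ^ 2) < 1" "q \<noteq> 0"
        using elim by (simp_all add: q_def norm_nome_less_1_iff norm_power power_less_one_iff)
      have nz: "a q \<noteq> 0" "b q \<noteq> 0" "c q \<noteq> 0"
        using euler_ratio_nonzero q by (simp_all add: a_def b_def c_def)
      have h: "h13 \<tau> = q / a q" "h13 (2 * \<tau>) = q ^ 2 / b q"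
        using h13_nome[of \<tau>] h13_nome[of "2 * \<tau>"] nome_of_nat_mult[of 2 \<tau>] elim
        by (simp_all add: q_def a_def b_def)
      have l: "lambda_sq \<tau> = m q / (q * c q)"
        unfolding lambda_sq_def h using lambda_form_euler[OF q(3) nz(1,2)] by (simp add: m_def c_def)
      have p: "h13 \<tau> * h13 (2 * \<tau>) = q ^ 3 / c q"
        unfolding h c_def by (simp add: eval_nat_numeral)
      have "level13_relation \<tau> = c q / q ^ 3 + 169 * (q ^ 3 / c q)
          - ((m q / (q * c q)) ^ 3 - 2 * (m q / (q * c q)) ^ 2 - 15 * (m q / (q * c q)) + 10)"
        unfolding level13_relation_def l p by simp
      also have "\<dots> = N q / (q ^ 3 * (c q * (c q * c q)))"
        using q nz unfolding N_def by (simp add: field_simps eval_nat_numeral)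
      finally show ?case by (simp add: q_def)
    qed
  qed
qed

text \<open>With x = exp (\<pi>i\<tau>), the letters e, a, b, c stand for \<open>euler_ratio\<close>
  at x, x^2, x^4, x^8; these are S L and its Fricke image.\<close>

lemma sigma_lambda_cusp:
  fixes x a b c e :: complex
  assumes "x \<noteq> 0" "a \<noteq> 0" "b \<noteq> 0" "c \<noteq> 0" "e \<noteq> 0"
  shows "sigma_form (x ^ 2 / a) (x ^ 4 / b) (x ^ 8 / c)
      = (a * b * (c * c) + x ^ 8 * (a * b * (b * b)) - x ^ 2 * (c * c * (a * a)) - x ^ 6 * (b * b * (b * b))) / (x ^ 4 * (a * (b * b) * c))"
    and "sigma_form (x ^ 4 / b) (x ^ 2 / a) (x / e)
      = (x ^ 2 * (a * b * (e * e)) + a * a * (a * b) - e * e * (b * b) - x ^ 2 * (a * a * (a * a))) / (x * (a * a * b * e))"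
  using assms by (simp_all add: sigma_form_def field_simps eval_nat_numeral)

text \<open>\<open>sigma_lambda\<close> begins with q^-2 and its Fricke image with 4, so sum and
  product have double poles and are matched by quadratics in \<open>lambda_sq\<close>. The product
  has denominator x^5 and thus uses the full order of the jets.\<close>

lemma sigma_relations_at_cusp:
  "((\<lambda>\<tau>. sigma_lambda \<tau> + sigma_lambda (- 1 / (26 * \<tau>)) - (lambda_sq \<tau> ^ 2 - lambda_sq \<tau>)) \<longlongrightarrow> 0) (filtercomap Im at_top)"
  "((\<lambda>\<tau>. sigma_lambda \<tau> * sigma_lambda (- 1 / (26 * \<tau>)) - (4 * lambda_sq \<tau> ^ 2 + 4 * lambda_sq \<tau>)) \<longlongrightarrow> 0) (filtercomap Im at_top)"
proof -
  define e where "e = euler_ratio"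
  define a where "a x = euler_ratio (x ^ 2)" for x
  define b where "b x = euler_ratio (x ^ 4)" for x
  define c where "c x = euler_ratio (x ^ 8)" for x
  define m where "m x = b x * b x + x ^ 4 * (a x * a x) - 2 * (x ^ 2 * (a x * b x))" for x
  define A where "A x = a x * b x * (c x * c x) + x ^ 8 * (a x * b x * (b x * b x)) - x ^ 2 * (c x * c x * (a x * a x)) - x ^ 6 * (b x * b x * (b x * b x))" for x
  define B where "B x = x ^ 2 * (a x * b x * (e x * e x)) + a x * a x * (a x * b x) - e x * e x * (b x * b x) - x ^ 2 * (a x * a x * (a x * a x))" for x
  define N where "N x = a x * e x * A x + x ^ 3 * (b x * c x * B x) - (m x * m x * (c x * e x) - x ^ 2 * (a x * b x * (c x * e x) * m x))" for x
  define N' where "N' x = A x * B x - (4 * (x * (a x * b x * (c x * e x) * (m x * m x))) + 4 * (x ^ 3 * (a x * b x * (a x * b x) * (c x * e x) * m x)))" for x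
  have j: "jet e 1 (- 2) (- 1) 2 1 2" "jet a 1 0 (- 2) 0 (- 1) 0" "jet b 1 0 0 0 (- 2) 0" "jet c 1 0 0 0 0 0"
    using jet_euler_ratio by (simp_all add: e_def a_def[abs_def] b_def[abs_def] c_def[abs_def])
  have m: "jet m 1 0 (- 2) 0 1 0"
    unfolding m_def[abs_def] by (rule jet_eqI, (rule jet_intros j)+, simp_all)
  have A: "jet A 1 0 (- 3) 0 1 0"
    unfolding A_def[abs_def] by (rule jet_eqI, (rule jet_intros j)+, simp_all)
  \<comment> \<open>The numerator of the Fricke image vanishes at x = 0, which cancels the apparent
    pole and leaves the limit 4.\<close>
  have B: "jet B 0 4 (- 8) (- 12) 24 4"
    unfolding B_def[abs_def] by (rule jet_eqI, (rule jet_intros j)+, simp_all)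
  have N: "jet N 0 0 0 0 0 0"
    unfolding N_def[abs_def] by (rule jet_eqI, (rule jet_intros j m A B)+, simp_all)
  have N': "jet N' 0 0 0 0 0 0"
    unfolding N'_def[abs_def] by (rule jet_eqI, (rule jet_intros j m A B)+, simp_all)
  have D: "jet (\<lambda>x. a x * a x * (b x * b x) * (c x * e x)) 1 (- 2) (- 5) 10 3 (- 2)"
    by (rule jet_eqI, (rule jet_intros j)+, simp_all)
  have D': "jet (\<lambda>x. a x * a x * a x * (b x * b x * b x) * (c x * e x)) 1 (- 2) (- 7) 14 10 (- 16)"
    by (rule jet_eqI, (rule jet_intros j)+, simp_all)
  have lim: "filterlim (\<lambda>\<tau>. nome (\<tau> / 2)) (at 0) (filtercomap Im at_top)"
    using filterlim_nome_at_0[of "1 / 2"] by simp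
  have ev: "\<forall>\<^sub>F \<tau> in filtercomap Im at_top. Im \<tau> > 0"
    by (rule eventually_filtercomapI[OF eventually_gt_at_top])
  have eq: "nome (\<tau> / 2) \<noteq> 0" "a (nome (\<tau> / 2)) \<noteq> 0" "b (nome (\<tau> / 2)) \<noteq> 0" "c (nome (\<tau> / 2)) \<noteq> 0" "e (nome (\<tau> / 2)) \<noteq> 0"
     "lambda_sq \<tau> = m (nome (\<tau> / 2)) / (nome (\<tau> / 2) ^ 2 * (a (nome (\<tau> / 2)) * b (nome (\<tau> / 2))))"
     "sigma_lambda \<tau> = A (nome (\<tau> / 2)) / (nome (\<tau> / 2) ^ 4 * (a (nome (\<tau> / 2)) * (b (nome (\<tau> / 2)) * b (nome (\<tau> / 2))) * c (nome (\<tau> / 2))))"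
     "sigma_lambda (- 1 / (26 * \<tau>)) = B (nome (\<tau> / 2)) / (nome (\<tau> / 2) * (a (nome (\<tau> / 2)) * a (nome (\<tau> / 2)) * b (nome (\<tau> / 2)) * e (nome (\<tau> / 2))))"
    if \<tau>: "Im \<tau> > 0" for \<tau>
  proof -
    define x where "x = nome (\<tau> / 2)"
    have x: "norm x < 1" "x \<noteq> 0"
      using \<tau> by (simp_all add: x_def norm_nome_less_1_iff)
    have p: "norm (x ^ n) < 1" if "n > 0" for n
      using x that by (simp add: norm_power power_less_one_iff)
    have nz: "a x \<noteq> 0" "b x \<noteq> 0" "c x \<noteq> 0" "e x \<noteq> 0"
      using euler_ratio_nonzero p x by (simp_all add: a_def b_def c_def e_def)
    have "nome \<tau> = x ^ 2" "nome (2 * \<tau>) = x ^ 4" "nome (4 * \<tau>) = x ^ 8"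
      using nome_of_nat_mult[of 2 "\<tau> / 2"] nome_of_nat_mult[of 4 "\<tau> / 2"] nome_of_nat_mult[of 8 "\<tau> / 2"]
      by (simp_all add: x_def)
    then have h: "h13 \<tau> = x ^ 2 / a x" "h13 (2 * \<tau>) = x ^ 4 / b x" "h13 (4 * \<tau>) = x ^ 8 / c x" "h13 (\<tau> / 2) = x / e x"
      using h13_nome[of \<tau>] h13_nome[of "2 * \<tau>"] h13_nome[of "4 * \<tau>"] h13_nome[of "\<tau> / 2"] \<tau>
      by (simp_all add: a_def b_def c_def e_def x_def)
    have "lambda_sq \<tau> = m x / (x ^ 2 * (a x * b x))"
      unfolding lambda_sq_def h using lambda_form_euler[of "x ^ 2" "a x" "b x"] x nz by (simp add: m_def)
    moreover have "sigma_lambda \<tau> = A x / (x ^ 4 * (a x * (b x * b x) * c x))"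
      unfolding sigma_lambda_def h A_def by (rule sigma_lambda_cusp(1)[OF x(2) nz])
    moreover have "sigma_lambda (- 1 / (26 * \<tau>)) = B x / (x * (a x * a x * b x * e x))"
      unfolding sigma_lambda_Fricke[OF \<tau>] h B_def by (rule sigma_lambda_cusp(2)[OF x(2) nz])
    ultimately show "nome (\<tau> / 2) \<noteq> 0" "a (nome (\<tau> / 2)) \<noteq> 0" "b (nome (\<tau> / 2)) \<noteq> 0" "c (nome (\<tau> / 2)) \<noteq> 0" "e (nome (\<tau> / 2)) \<noteq> 0"
     "lambda_sq \<tau> = m (nome (\<tau> / 2)) / (nome (\<tau> / 2) ^ 2 * (a (nome (\<tau> / 2)) * b (nome (\<tau> / 2))))"
     "sigma_lambda \<tau> = A (nome (\<tau> / 2)) / (nome (\<tau> / 2) ^ 4 * (a (nome (\<tau> / 2)) * (b (nome (\<tau> / 2)) * b (nome (\<tau> / 2))) * c (nome (\<tau> / 2))))"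
     "sigma_lambda (- 1 / (26 * \<tau>)) = B (nome (\<tau> / 2)) / (nome (\<tau> / 2) * (a (nome (\<tau> / 2)) * a (nome (\<tau> / 2)) * b (nome (\<tau> / 2)) * e (nome (\<tau> / 2))))"
      using x nz by (simp_all add: x_def)
  qed
  have alg: "A x / (x ^ 4 * (a x * (b x * b x) * c x)) + B x / (x * (a x * a x * b x * e x)) -
        ((m x / (x ^ 2 * (a x * b x))) ^ 2 - m x / (x ^ 2 * (a x * b x)))
      = N x / (x ^ 4 * (a x * a x * (b x * b x) * (c x * e x)))"
    "A x / (x ^ 4 * (a x * (b x * b x) * c x)) * (B x / (x * (a x * a x * b x * e x))) -
        (4 * (m x / (x ^ 2 * (a x * b x))) ^ 2 + 4 * (m x / (x ^ 2 * (a x * b x))))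
      = N' x / (x ^ 5 * (a x * a x * a x * (b x * b x * b x) * (c x * e x)))"
    if "x \<noteq> 0" "a x \<noteq> 0" "b x \<noteq> 0" "c x \<noteq> 0" "e x \<noteq> 0" for x
    using that unfolding N_def N'_def by (simp_all add: field_simps eval_nat_numeral)
  show "((\<lambda>\<tau>. sigma_lambda \<tau> + sigma_lambda (- 1 / (26 * \<tau>)) - (lambda_sq \<tau> ^ 2 - lambda_sq \<tau>)) \<longlongrightarrow> 0) (filtercomap Im at_top)"
    using filterlim_compose[OF jet_quotient_tendsto_0[OF N D, of 4] lim, simplified]
    by (rule Lim_transform_eventually)
       (rule eventually_mono[OF ev], simp only: eq(6-8), rule alg(1)[symmetric], (erule eq)+)
  show "((\<lambda>\<tau>. sigma_lambda \<tau> * sigma_lambda (- 1 / (26 * \<tau>)) - (4 * lambda_sq \<tau> ^ 2 + 4 * lambda_sq \<tau>)) \<longlongrightarrow> 0) (filtercomap Im at_top)"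
    using filterlim_compose[OF jet_quotient_tendsto_0[OF N' D', of 5] lim, simplified]
    by (rule Lim_transform_eventually)
       (rule eventually_mono[OF ev], simp only: eq(6-8), rule alg(2)[symmetric], (erule eq)+)
qed

section \<open>Vanishing of the relations on the whole half-plane\<close>

theorem level13_relation_eq_0:
  assumes "Im \<tau> > 0"
  shows "level13_relation \<tau> = 0"
proof (rule invariant_vanishing[OF _ _ _ level13_relation_at_cusp assms])
  show "level13_relation holomorphic_on upper_half_plane"
    unfolding level13_relation_def[abs_def] lambda_sq_def lambda_form_def
    by (intro holomorphic_intros h13_holomorphic open_upper_half_plane) (auto simp: h13_nonzero)
  \<comment> \<open>W_13 and the Fricke involution both invert h and k up to the factor 13, the
    latter also exchanging them; this swaps the two summands.\<close>
  have prod: "1 / (1 / (13 * h) * (1 / (13 * k))) + 169 * (1 / (13 * h) * (1 / (13 * k))) = 1 / (h * k) + 169 * (h * k)" for h k :: complex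
    by simp
  show "invariant_26_13 level13_relation"
    unfolding invariant_26_13_def
    by (auto simp only: level13_relation_def prod h13_26 h13_26_double
          invariant_26_13_Gamma0[OF lambda_sq_invariant] invariant_26_13_AL[OF lambda_sq_invariant])
  show "level13_relation (- 1 / (26 * \<tau>)) = level13_relation \<tau>" if "Im \<tau> > 0" for \<tau>
    unfolding level13_relation_def h13_Fricke_26[OF that] lambda_sq_Fricke[OF that] prod by (simp add: mult.commute)
qed

text \<open>\<open>sigma_lambda\<close> and its Fricke image are the two roots of this quadratic.
  Their sum and product are Fricke-invariant, so the vanishing criterion applies to these.\<close>

theorem sigma_relations:
  assumes "Im \<tau> > 0"
  shows "sigma_lambda \<tau> ^ 2 - (lambda_sq \<tau> ^ 2 - lambda_sq \<tau>) * sigma_lambda \<tau> + 4 * lambda_sq \<tau> ^ 2 + 4 * lambda_sq \<tau> = 0"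
proof -
  define B where "B \<tau> = sigma_lambda (- 1 / (26 * \<tau>))" for \<tau>
  have invB: "invariant_26_13 B"
    unfolding B_def[abs_def] by (rule invariant_26_13_compose_Fricke[OF sigma_lambda_invariant])
  have swap: "sigma_lambda (- 1 / (26 * \<tau>)) = B \<tau>" "B (- 1 / (26 * \<tau>)) = sigma_lambda \<tau>" if "Im \<tau> > 0" for \<tau>
    using that by (auto simp: B_def)
  have hol: "sigma_lambda holomorphic_on upper_half_plane" "lambda_sq holomorphic_on upper_half_plane"
    unfolding sigma_lambda_def[abs_def] sigma_form_def lambda_sq_def[abs_def] lambda_form_def
    by (intro holomorphic_intros h13_holomorphic open_upper_half_plane; auto simp: h13_nonzero)+
  have "(\<lambda>\<tau>. sigma_form (h13 (2 * \<tau>)) (h13 \<tau>) (h13 (\<tau> / 2))) holomorphic_on upper_half_plane"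
    unfolding sigma_form_def
    by (intro holomorphic_intros h13_holomorphic open_upper_half_plane) (auto simp: h13_nonzero)
  then have holB: "B holomorphic_on upper_half_plane"
    by (rule holomorphic_transform) (simp only: B_def mem_Collect_eq sigma_lambda_Fricke)
  note inv = invariant_26_13_Gamma0[OF lambda_sq_invariant] invariant_26_13_AL[OF lambda_sq_invariant]
    invariant_26_13_Gamma0[OF sigma_lambda_invariant] invariant_26_13_AL[OF sigma_lambda_invariant]
    invariant_26_13_Gamma0[OF invB] invariant_26_13_AL[OF invB]
  have "sigma_lambda \<tau> + B \<tau> - (lambda_sq \<tau> ^ 2 - lambda_sq \<tau>) = 0"
  proof (rule invariant_vanishing[OF _ _ _ sigma_relations_at_cusp(1)[folded B_def] assms])
    show "(\<lambda>\<tau>. sigma_lambda \<tau> + B \<tau> - (lambda_sq \<tau> ^ 2 - lambda_sq \<tau>)) holomorphic_on upper_half_plane"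
      by (intro holomorphic_intros hol holB)
    show "invariant_26_13 (\<lambda>\<tau>. sigma_lambda \<tau> + B \<tau> - (lambda_sq \<tau> ^ 2 - lambda_sq \<tau>))"
      unfolding invariant_26_13_def by (auto simp only: inv)
  qed (simp only: swap lambda_sq_Fricke add.commute)
  moreover have "sigma_lambda \<tau> * B \<tau> - (4 * lambda_sq \<tau> ^ 2 + 4 * lambda_sq \<tau>) = 0"
  proof (rule invariant_vanishing[OF _ _ _ sigma_relations_at_cusp(2)[folded B_def] assms])
    show "(\<lambda>\<tau>. sigma_lambda \<tau> * B \<tau> - (4 * lambda_sq \<tau> ^ 2 + 4 * lambda_sq \<tau>)) holomorphic_on upper_half_plane"
      by (intro holomorphic_intros hol holB)
    show "invariant_26_13 (\<lambda>\<tau>. sigma_lambda \<tau> * B \<tau> - (4 * lambda_sq \<tau> ^ 2 + 4 * lambda_sq \<tau>))"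
      unfolding invariant_26_13_def by (auto simp only: inv)
  qed (simp only: swap lambda_sq_Fricke, simp only: mult.commute)
  ultimately show ?thesis by algebra
qed

section \<open>The real identities\<close>

text \<open>The restriction of \<open>h13\<close> to the imaginary axis, in terms of the real
  nome.\<close>

definition level13_ratio :: "real \<Rightarrow> real" where
  "level13_ratio q = q * (qpochhammer_inf (q ^ 13) (q ^ 13) / qpochhammer_inf q q) ^ 2"

text \<open>The limit of nonnegative partial products is nonnegative, and it is nonzero since no
  factor vanishes. Positivity selects the square roots in the final computation.\<close>

lemma qpochhammer_inf_pos:
  fixes q :: real
  assumes "0 < q" "q < 1" "a \<le> q"
  shows "qpochhammer_inf a q > 0"
proof -
  have le: "a * q ^ k \<le> q" for k
  proof (cases "a \<ge> 0")
    case True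
    then have "a * q ^ k \<le> a * 1" using assms by (intro mult_left_mono power_le_one) auto
    then show ?thesis using assms by simp
  next
    case False
    then have "a * q ^ k \<le> 0" using assms by (intro mult_nonpos_nonneg) auto
    then show ?thesis using assms by simp
  qed
  have "1 - a * q ^ k \<noteq> 0" for k using le[of k] assms by simp
  then have "qpochhammer_inf a q \<noteq> 0"
    using qpochhammer_inf_eq_0_iff[of q a] assms by auto
  moreover have "qpochhammer_inf a q \<ge> 0"
  proof (rule LIMSEQ_le_const[OF qpochhammer_inf_LIMSEQ])
    have "0 \<le> (\<Prod>k<n. 1 - a * q ^ k)" for n
      using le assms by (intro prod_nonneg) (auto intro: order_trans[OF le])
    then show "\<exists>N. \<forall>n\<ge>N. 0 \<le> (\<Prod>k<n. 1 - a * q ^ k)" by blast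
  qed (use assms in auto)
  ultimately show ?thesis by simp
qed

lemma level13_ratio_pos:
  assumes "0 < q" "q < 1"
  shows "level13_ratio q > 0"
proof -
  have "0 < q ^ 13" "q ^ 13 < 1" using assms by (auto simp: power_less_one_iff)
  then show ?thesis
    using assms unfolding level13_ratio_def
    by (intro mult_pos_pos zero_less_power divide_pos_pos qpochhammer_inf_pos) auto
qed

lemma h13_of_real:
  assumes q: "0 < q" "q < 1" and \<tau>: "nome \<tau> = of_real q"
  shows "h13 \<tau> = of_real (level13_ratio q)"
proof -
  have "Im \<tau> > 0"
    using q \<tau> norm_nome_less_1_iff[of \<tau>] by simp
  moreover have "\<bar>q ^ 13\<bar> < 1"
    using q by (simp add: power_less_one_iff)
  then have "qpochhammer_inf (complex_of_real q ^ 13) (complex_of_real q ^ 13) = of_real (qpochhammer_inf (q ^ 13) (q ^ 13))"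
    using qpochhammer_inf_of_real[of "q ^ 13" "q ^ 13"] by simp
  moreover have "qpochhammer_inf (complex_of_real q) (complex_of_real q) = of_real (qpochhammer_inf q q)"
    using q by (intro qpochhammer_inf_of_real) simp
  ultimately show ?thesis
    by (simp add: h13_nome \<tau> euler_ratio_def level13_ratio_def power_divide)
qed

lemma level13_ratio_relations:
  fixes q h k l M A :: real
  assumes q: "0 < q" "q < 1"
  defines "h \<equiv> level13_ratio q" and "k \<equiv> level13_ratio (q ^ 2)" and "l \<equiv> level13_ratio (q ^ 4)"
  defines "M \<equiv> lambda_form h k" and "A \<equiv> sigma_form h k l"
  shows "1 / (h * k) + 169 * (h * k) = M ^ 3 - 2 * M ^ 2 - 15 * M + 10"
    and "A ^ 2 - (M ^ 2 - M) * A + 4 * M ^ 2 + 4 * M = 0"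
proof -
  define \<tau> where "\<tau> = of_real (- ln q / (2 * pi)) * \<i>"
  have "nome \<tau> = exp (of_real (ln q))"
    unfolding nome_def by (rule arg_cong[of _ _ exp]) (simp add: \<tau>_def complex_eq_iff)
  then have n1: "nome \<tau> = of_real q"
    using q by (metis exp_ln exp_of_real)
  then have n2: "nome (2 * \<tau>) = of_real (q ^ 2)" and n4: "nome (4 * \<tau>) = of_real (q ^ 4)"
    using nome_of_nat_mult[of 2 \<tau>] nome_of_nat_mult[of 4 \<tau>] by simp_all
  have pw: "0 < q ^ n" "q ^ n < 1" if "n > 0" for n
    using q that by (auto simp: power_less_one_iff)
  have \<tau>: "Im \<tau> > 0"
    using q n1 norm_nome_less_1_iff[of \<tau>] by simp
  have h: "h13 \<tau> = of_real h" "h13 (2 * \<tau>) = of_real k" "h13 (4 * \<tau>) = of_real l"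
    unfolding h_def k_def l_def using q pw n1 n2 n4 by (auto intro!: h13_of_real)
  have M: "lambda_sq \<tau> = of_real M" and A: "sigma_lambda \<tau> = of_real A"
    by (simp_all add: lambda_sq_def sigma_lambda_def h M_def A_def lambda_form_def sigma_form_def)
  have "complex_of_real (1 / (h * k) + 169 * (h * k) - (M ^ 3 - 2 * M ^ 2 - 15 * M + 10)) = 0"
    using level13_relation_eq_0[OF \<tau>] by (simp add: level13_relation_def h M)
  then show "1 / (h * k) + 169 * (h * k) = M ^ 3 - 2 * M ^ 2 - 15 * M + 10"
    unfolding of_real_eq_0_iff by simp
  have "complex_of_real (A ^ 2 - (M ^ 2 - M) * A + 4 * M ^ 2 + 4 * M) = 0"
    using sigma_relations[OF \<tau>] by (simp add: A M)
  then show "A ^ 2 - (M ^ 2 - M) * A + 4 * M ^ 2 + 4 * M = 0"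
    unfolding of_real_eq_0_iff .
qed

text \<open>The first equation is the quadratic equation of \<open>S L\<close> divided by \<open>L\<^sup>2\<close>; here \<open>L \<noteq> 0\<close> because
  \<open>L = 0\<close> would force \<open>1/p + 169 p = 10 < 26\<close>. For the second, with \<open>p = h k\<close> and \<open>u = \<Lambda>\<^sup>3\<close>, the numbers
  \<open>T = u/(13 p) - 13 p/u\<close> and \<open>13 p u - 1/(13 p u)\<close> have sum and product rational in \<open>u\<close> and \<open>1/p + 169 p\<close>.\<close>

lemma class_invariant_equations:
  fixes h k l \<Lambda> a b S T L :: real
  assumes pos: "h > 0" "k > 0" "l > 0" "\<Lambda> > 0"
    and \<Lambda>: "\<Lambda> ^ 2 = h / k" and ab: "a / b = k ^ 3 / (l ^ 2 * h)" "a * b = 169 * k ^ 5 / h"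
    and S: "S = sqrt (a / b) - sqrt (b / a)" and T: "T = 1 / sqrt (a * b) - sqrt (a * b)" and L: "L = \<Lambda> - 1 / \<Lambda>"
    and R1: "1 / (h * k) + 169 * (h * k) = lambda_form h k ^ 3 - 2 * lambda_form h k ^ 2 - 15 * lambda_form h k + 10"
    and R2: "sigma_form h k l ^ 2 - (lambda_form h k ^ 2 - lambda_form h k) * sigma_form h k l
               + 4 * lambda_form h k ^ 2 + 4 * lambda_form h k = 0"
  shows "S ^ 2 = S * (L ^ 3 - L) - 4 * L ^ 2 - 4"
    and "169 * T ^ 2 = 13 * T * (L ^ 9 + L ^ 7 - 21 * L ^ 5 - 35 * L ^ 3 + 30 * L)
           + L ^ 12 - 4 * L ^ 10 - 26 * L ^ 8 - 89 * L ^ 6 - 829 * L ^ 4 - 1821 * L ^ 2 - 576"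
proof -
  have h: "h = k * \<Lambda> ^ 2" using \<Lambda> pos by (simp add: field_simps)
  have M: "lambda_form h k = L ^ 2"
    using pos by (simp add: lambda_form_def h L field_simps power2_eq_square)
  \<comment> \<open>The positive square root of a/b, as k^3/(l^2 h) = k^2/(l \<Lambda>)^2.\<close>
  define y where "y = k / (l * \<Lambda>)"
  have "sqrt (a / b) = y"
    unfolding ab y_def by (rule real_sqrt_unique) (use pos in \<open>simp_all add: h field_simps eval_nat_numeral\<close>)
  moreover have "sqrt (b / a) = 1 / sqrt (a / b)"
    by (simp add: real_sqrt_divide)
  ultimately have S': "S = y - 1 / y" using S by simp
  have SL: "sigma_form h k l = S * L"
    using pos by (simp add: sigma_form_def S' L y_def h field_simps eval_nat_numeral)
  define p where "p = h * k"
  define V where "V = 1 / p + 169 * p"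
  have p: "p > 0" using pos by (simp add: p_def)
  have V: "V = L ^ 6 - 2 * L ^ 4 - 15 * L ^ 2 + 10"
    using R1 unfolding M by (simp add: V_def p_def)
  have "V \<ge> 26"
  proof -
    have "V - 26 = (13 * p - 1) ^ 2 / p"
      using p by (simp add: V_def field_simps power2_eq_square)
    then show ?thesis using p by (smt (verit) divide_nonneg_pos zero_le_power2)
  qed
  then have "L \<noteq> 0" using V by auto
  have "L ^ 2 * (S ^ 2 - (S * (L ^ 3 - L) - 4 * L ^ 2 - 4)) = 0"
    using R2 unfolding M SL by (simp add: algebra_simps eval_nat_numeral)
  then show "S ^ 2 = S * (L ^ 3 - L) - 4 * L ^ 2 - 4"
    using \<open>L \<noteq> 0\<close> by simp
  \<comment> \<open>The cube enters because k^5/h = (h k)^2/\<Lambda>^6.\<close>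
  define u where "u = \<Lambda> ^ 3"
  have u: "u > 0" using pos by (simp add: u_def)
  have "sqrt (a * b) = 13 * p / u"
    unfolding ab p_def u_def by (rule real_sqrt_unique) (use pos in \<open>simp_all add: h field_simps eval_nat_numeral\<close>)
  then have T': "T = u / (13 * p) - 13 * p / u" using T by simp
  have U: "u - 1 / u = L ^ 3 + 3 * L"
    using pos by (simp add: u_def L field_simps eval_nat_numeral)
  \<comment> \<open>If W and Z are the sum and product of the pair containing T, then T^2 = T W - Z,
    where 13 W = V (u - 1/u) and 169 Z = 169 (u - 1/u)^2 - V^2 + 676.\<close>
  have "169 * T ^ 2 = 13 * T * (V * (u - 1 / u)) + V ^ 2 - 169 * (u - 1 / u) ^ 2 - 676"
    using p u by (simp add: T' V_def field_simps eval_nat_numeral)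
  then show "169 * T ^ 2 = 13 * T * (L ^ 9 + L ^ 7 - 21 * L ^ 5 - 35 * L ^ 3 + 30 * L)
           + L ^ 12 - 4 * L ^ 10 - 26 * L ^ 8 - 89 * L ^ 6 - 829 * L ^ 4 - 1821 * L ^ 2 - 576"
    unfolding U V by (simp add: algebra_simps eval_nat_numeral)
qed

lemma powr_nat_power: "q > 0 \<Longrightarrow> (q ^ n) powr x = q powr (real n * x)" for q :: real
  by (simp add: powr_powr flip: powr_realpow)

lemma class_invariant_eq:
  assumes q: "q = exp (- pi * sqrt (of_rat r))" "q < 1"
  shows "class_invariant r = 2 powr (- 1 / 4) * q powr (- 1 / 24) * (qpochhammer_inf q q / qpochhammer_inf (q\<^sup>2) (q\<^sup>2))"
proof -
  have "0 < q" using q by simp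
  then show ?thesis
    using q(2) qpochhammer_inf_odd[of q]
    unfolding class_invariant_def Let_def q(1)[symmetric] ramanujan_chi_def by simp
qed

theorem theorem4p9:
  fixes m :: rat and \<Lambda> a b S T L :: real
  assumes "m > 0"
    and "\<Lambda> = class_invariant (13 * m) / class_invariant (m / 13)"
    and "a = theta_ratio_a m 13"
    and "b = theta_ratio_b (4 * m) 13"
    and "S = sqrt (a / b) - sqrt (b / a)"
    and "T = 1 / sqrt (a * b) - sqrt (a * b)"
    and "L = \<Lambda> - 1 / \<Lambda>"
  shows "S ^ 2 = S * (L ^ 3 - L) - 4 * L ^ 2 - 4
       \<and> 169 * T ^ 2 = 13 * T * (L ^ 9 + L ^ 7 - 21 * L ^ 5 - 35 * L ^ 3 + 30 * L)
           + L ^ 12 - 4 * L ^ 10 - 26 * L ^ 8 - 89 * L ^ 6 - 829 * L ^ 4 - 1821 * L ^ 2 - 576"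
proof -
  \<comment> \<open>A single q serves all invariants: \<surd>(13 m) = 13 t and \<surd>(4 m / 13) = 2
    t, so the other nomes are q^13 and q^2.\<close>
  define t where "t = sqrt (of_rat (m / 13))"
  define q where "q = exp (- pi * t)"
  have "t > 0" using assms(1) by (simp add: t_def)
  then have q: "0 < q" "q < 1" by (simp_all add: q_def)
  have pw: "0 < q ^ n" "q ^ n < 1" if "n > 0" for n
    using q that by (auto simp: power_less_one_iff)
  have q13: "q ^ 13 = exp (- pi * sqrt (of_rat (13 * m)))"
  proof -
    have "sqrt (of_rat (13 * m)) = sqrt (13\<^sup>2 * of_rat (m / 13))"
      by (simp add: of_rat_mult of_rat_divide)
    also have "\<dots> = 13 * t" by (simp add: real_sqrt_mult t_def)
    finally show ?thesis by (simp add: q_def exp_of_nat_mult[symmetric] mult_ac)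
  qed
  have q2: "q ^ 2 = exp (- pi * sqrt (of_rat (4 * m / 13)))"
  proof -
    have "sqrt (of_rat (4 * m / 13)) = sqrt (2\<^sup>2 * of_rat (m / 13))"
      by (simp add: of_rat_mult of_rat_divide)
    also have "\<dots> = 2 * t" by (simp add: real_sqrt_mult t_def)
    finally show ?thesis by (simp add: q_def exp_of_nat_mult[symmetric] mult_ac)
  qed
  define P where "P n = qpochhammer_inf (q ^ n) (q ^ n)" for n
  have Ppos: "P n > 0" if "n > 0" for n
    unfolding P_def using pw[OF that] by (intro qpochhammer_inf_pos) auto
  have \<psi>: "ramanujan_psi (q ^ n) = P (2 * n) ^ 2 / P n" and \<phi>: "ramanujan_phi (- (q ^ n)) = P n ^ 2 / P (2 * n)"
    if "n > 0" for n
    using ramanujan_psi_eq[OF pw[OF that]] ramanujan_phi_minus_eq[OF pw[OF that]]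
    by (simp_all add: P_def power_mult[symmetric] mult.commute)
  have powr: "q powr numeral n = q ^ numeral n" "(q ^ 2) powr numeral n = q ^ (2 * numeral n)" for n
    using q by (simp_all add: powr_numeral power_mult)
  define h where "h = level13_ratio q"
  define k where "k = level13_ratio (q ^ 2)"
  define l where "l = level13_ratio (q ^ 4)"
  have pos: "h > 0" "k > 0" "l > 0"
    unfolding h_def k_def l_def using q pw by (auto intro!: level13_ratio_pos)
  have h: "h = q * (P 13 / P 1) ^ 2" "k = q ^ 2 * (P 26 / P 2) ^ 2" "l = q ^ 4 * (P 52 / P 4) ^ 2"
    by (simp_all add: h_def k_def l_def level13_ratio_def P_def flip: power_mult)
  have P: "P 1 > 0" "P 2 > 0" "P 4 > 0" "P 13 > 0" "P 26 > 0" "P 52 > 0" by (simp_all add: Ppos)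
  have g1: "class_invariant (m / 13) = 2 powr (- 1 / 4) * q powr (- 1 / 24) * (P 1 / P 2)"
    using class_invariant_eq[of q "m / 13"] q by (simp add: q_def t_def P_def)
  have g2: "class_invariant (13 * m) = 2 powr (- 1 / 4) * (q ^ 13) powr (- 1 / 24) * (P 13 / P 26)"
    using class_invariant_eq[OF q13] pw[of 13] by (simp add: P_def flip: power_mult)
  \<comment> \<open>In \<Lambda> the fractional powers reduce to q^(-1/2), so its square contains
    only 1/q.\<close>
  have "(q ^ 13) powr (- 1 / 24) = q powr (- 1 / 2) * q powr (- 1 / 24)"
    using q by (simp add: powr_nat_power flip: powr_add)
  then have \<Lambda>: "\<Lambda> = q powr (- 1 / 2) * ((P 13 / P 26) / (P 1 / P 2))"
    using q P by (simp add: assms(2) g1 g2)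
  have "(q powr (- 1 / 2)) ^ 2 = 1 / q"
    unfolding power2_eq_square powr_add[symmetric] using q by (simp add: powr_neg_one)
  then have \<Lambda>2: "\<Lambda> ^ 2 = h / k"
    unfolding \<Lambda> power_mult_distrib h using q P by (simp add: field_simps eval_nat_numeral)
  \<comment> \<open>For n = 13 the exponent (n - 1)/4 of the prefactor is 3; in \<open>b\<close> the
    base is q^2, which doubles it to 6.\<close>
  have a: "a = 13 * q ^ 3 * (P 26 ^ 2 / P 13) ^ 2 * (P 26 ^ 2 / P 52) ^ 2 / ((P 2 ^ 2 / P 1) ^ 2 * (P 2 ^ 2 / P 4) ^ 2)"
    unfolding assms(3) theta_ratio_a_def Let_def q_def[symmetric, unfolded t_def]
    using \<psi>[of 1] \<psi>[of 13] \<phi>[of 2] \<phi>[of 26] by (simp add: powr)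
  have b: "b = 13 * q ^ 6 * (P 52 ^ 2 / P 26) ^ 2 * (P 26 ^ 2 / P 52) ^ 2 / ((P 4 ^ 2 / P 2) ^ 2 * (P 2 ^ 2 / P 4) ^ 2)"
    unfolding assms(4) theta_ratio_b_def Let_def q2[symmetric]
    using \<psi>[of 2] \<psi>[of 26] \<phi>[of 2] \<phi>[of 26] by (simp add: powr flip: power_mult)
  have "a / b = k ^ 3 / (l ^ 2 * h)" "a * b = 169 * k ^ 5 / h"
    unfolding a b h using q P by (simp_all add: field_simps eval_nat_numeral)
  moreover have "\<Lambda> > 0" unfolding \<Lambda> using q P by simp
  ultimately show ?thesis
    using class_invariant_equations[OF pos _ \<Lambda>2 _ _ assms(5-7)] level13_ratio_relations[OF q]
    by (simp add: h_def k_def l_def)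
qed

end
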